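(* Let $\Phi:\mathcal H\to\mathbb R\cup\{+\infty\}$ be convex, lower semicontinuous, with nonempty effective domain and bounded from below; let $u_0\in D(\Phi)$, $f\in L^2_\alpha(0,T;\mathcal H)$, and let $u$ be the energy solution of $D_c^\alpha u+\partial\Phi(u)\ni f$ on $(0,T]$, $u(0)=u_0$. Let $\mathcal P$ be a partition of $[0,T]$ and let $\mathbf U$ be the discrete solution on $\mathcal P$ starting from $U_0\in D(\Phi)$. Let $\mathcal E_{\mathcal P}$ be the error estimator $$\mathcal E_{\mathcal P}(t)=\langle D_c^\alpha\widehat U_{\mathcal P}(t)-\overline F_{\mathcal P}(t),\widehat U_{\mathcal P}(t)-\overline U_{\mathcal P}(t)\rangle+\Phi(\widehat U_{\mathcal P}(t))-\Phi(\overline U_{\mathcal P}(t)),$$ and let the error be $E=\big(\sup_{t\in[0,T]}\{E_{\mathcal H}^2(t)+E_\sigma^2(t)\}\big)^{1/2}$, where $E_{\mathcal H}(t)=\|u(t)-\widehat U_{\mathcal P}(t)\|$ and $$E_\sigma(t)=\Big(\frac2{\Gamma(\alpha)}\int_0^t(t-s)^{\alpha-1}\big[\sigma(u(s);\widehat U_{\mathcal P}(s))+\sigma(\overline U_{\mathcal P}(s);u(s))\big]ds\Big)^{1/2}.$$ Then $$E\le\Big(\|u_0-U_0\|^2+\frac2{\Gamma(\alpha)}\|\mathcal E_{\mathcal P}\|_{L^1_\alpha(0,T;\mathbb R)}\Big)^{1/2}+\frac2{\Gamma(\alpha)}\|f-\overline F_{\mathcal P}\|_{L^1_\alpha(0,T;\mathcal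 H)}.$$
   Context: Setting: $T\in(0,\infty)$, $\alpha\in(0,1)$, $\mathcal H$ is a separable real Hilbert space. $D(\Phi)=\{w\in\mathcal H:\Phi(w)<+\infty\}$, $\partial\Phi(w)=\{\xi:\langle\xi,v-w\rangle\le\Phi(v)-\Phi(w)\ \forall v\in\mathcal H\}$, $D(\partial\Phi)=\{w:\partial\Phi(w)\ne\emptyset\}$. Coercivity modulus: for $w_1\in D(\partial\Phi)$ and $w_2\in D(\Phi)$, $\sigma(w_1;w_2)=\Phi(w_2)-\Phi(w_1)-\sup_{\xi\in\partial\Phi(w_1)}\langle\xi,w_2-w_1\rangle\ge0$. For a normed space $X$, $\|w\|_{L^p_\alpha(0,T;X)}=\sup_{t\in[0,T]}\big(\int_0^t(t-s)^{\alpha-1}\|w(s)\|_X^p\,ds\big)^{1/p}$, and $L^p_\alpha(0,T;X)$ is the space of (strongly measurable) functions for which this is finite. Generalized Caputo derivative: for $w\in L^1_{loc}([0,T);\mathcal H)$ with initial value $w_0$, $D_c^\alpha w$ is the distributional derivative on $(-\infty,T)$ of the function equal to $\frac1{\Gamma(1-\alpha)}\int_0^t(t-s)^{-\alpha}(w(s)-w_0)\,ds$ for $t\ge0$ and $0$ for $t<0$; if $\lim_{t\downarrow0}\frac1t\int_0^t\|w(s)-w(0)\|ds=0$ for some $w(0)\in\mathcal H$, then $w_0=w(0)$. Energy solution: $u\in L^2(0,T;\mathcal H)$ with $\lim_{t\downarrow0}\frac1t\int_0^t\|u(s)-u_0\|^2ds=0$, $D_c^\alpha u\in L^2(0,T;\mathcal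 H)$, and $\int_0^T[\langle D_c^\alpha u,u-w\rangle+\Phi(u)-\Phi(w)]dt\le\int_0^T\langle f,u-w\rangle dt$ for all $w\in L^2(0,T;\mathcal H)$ (trivially satisfied when $\int_0^T\Phi(w)dt=+\infty$). Under the stated assumptions it exists, is unique, and $f(t)-D_c^\alpha u(t)\in\partial\Phi(u(t))$ for a.e. $t$. Discretization: $\mathcal P=\{0=t_0<t_1<\dots<t_N=T\}$, $\tau_n=t_n-t_{n-1}$; for $t\in(t_{n-1},t_n]$ put $n(t)=n$. $\mathbf K_{\mathcal P}\in\mathbb R^{N\times N}$ is the (invertible) lower triangular matrix with $\mathbf K_{\mathcal P,ni}=\frac1{\Gamma(\alpha+1)}\big((t_n-t_{i-1})^\alpha-(t_n-t_i)^\alpha\big)$ for $1\le i\le n\le N$ and $0$ for $i>n$. The discrete Caputo derivative of $(W_0,\dots,W_N)$ is $(D^\alpha_{\mathcal P}\mathbf W)_n=\sum_{i=1}^n\mathbf K^{-1}_{\mathcal P,ni}(W_i-W_0)$, where $\mathbf K^{-1}_{\mathcal P,ni}$ are the entries of $\mathbf K_{\mathcal P}^{-1}$. With $F_n=\frac1{\tau_n}\int_{t_{n-1}}^{t_n}f(t)\,dt$, the discrete solution $\mathbf U=(U_n)_{n=0}^N$ starting from $U_0$ is defined recursively (and uniquely) by $F_n-(D^\alpha_{\mathcal P}\mathbf U)_n\in\partial\Phi(U_n)$, $n=1,\dots,N$. Interpolants: $\overline U_{\mathcal P}(t)=U_{n(t)}$, $\overline F_{\mathcal P}(t)=F_{n(t)}$,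 and $\widehat U_{\mathcal P}(t)=U_0+\frac1{\Gamma(\alpha)}\int_0^t(t-s)^{\alpha-1}(D^\alpha_{\mathcal P}\mathbf U)_{n(s)}\,ds$, so that $D_c^\alpha\widehat U_{\mathcal P}(t)=(D^\alpha_{\mathcal P}\mathbf U)_{n(t)}$. *)

theory Defs
  imports "HOL-Analysis.Analysis"
begin

section \<open>Convex energies\<close>

definition effdom :: "('a \<Rightarrow> ereal) \<Rightarrow> 'a set" where
  "effdom \<Phi> = {w. \<Phi> w < \<infinity>}"

definition convex_ext :: "('a::real_vector \<Rightarrow> ereal) \<Rightarrow> bool" where
  "convex_ext \<Phi> \<longleftrightarrow>
     (\<forall>x y. \<forall>r::real. 0 < r \<and> r < 1 \<longrightarrow>
        \<Phi> ((1 - r) *\<^sub>R x + r *\<^sub>R y) \<le> ereal (1 - r) * \<Phi> x + ereal r * \<Phi> y)"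

definition lower_semicont :: "('a::topological_space \<Rightarrow> ereal) \<Rightarrow> bool" where
  "lower_semicont \<Phi> \<longleftrightarrow> (\<forall>x. \<Phi> x \<le> Liminf (at x) \<Phi>)"

text \<open>Together with the target type, boundedness from below rules out the value \<open>-\<infinity>\<close>.\<close>

definition bounded_from_below :: "('a \<Rightarrow> ereal) \<Rightarrow> bool" where
  "bounded_from_below \<Phi> \<longleftrightarrow> (\<exists>c::real. \<forall>w. ereal c \<le> \<Phi> w)"

text \<open>In \<^typ>\<open>ereal\<close> one has \<open>\<infinity> - \<infinity> = \<infinity>\<close>; this is harmless below: for a proper \<open>\<Phi>\<close>
  and \<open>\<Phi> w = \<infinity>\<close>, any \<open>v\<close> in the effective domain gives \<open>\<Phi> v - \<Phi> w = -\<infinity>\<close>, so the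
  subdifferential at \<open>w\<close> is empty.\<close>

definition subdiff :: "('a::real_inner \<Rightarrow> ereal) \<Rightarrow> 'a \<Rightarrow> 'a set" where
  "subdiff \<Phi> w = {\<xi>. \<forall>v. ereal (\<xi> \<bullet> (v - w)) \<le> \<Phi> v - \<Phi> w}"

text \<open>The coercivity modulus is meaningful for \<open>subdiff \<Phi> w1 \<noteq> {}\<close> and \<open>w2 \<in> effdom \<Phi>\<close>; there it is
  a nonnegative real.\<close>

definition coerc_mod :: "('a::real_inner \<Rightarrow> ereal) \<Rightarrow> 'a \<Rightarrow> 'a \<Rightarrow> ereal" where
  "coerc_mod \<Phi> w1 w2 = \<Phi> w2 - \<Phi> w1 - (SUP \<xi>\<in>subdiff \<Phi> w1. ereal (\<xi> \<bullet> (w2 - w1)))"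

section \<open>Function spaces\<close>

text \<open>Power with a positive exponent on \<open>[0,\<infinity>]\<close>.\<close>

definition ennreal_powr :: "ennreal \<Rightarrow> real \<Rightarrow> ennreal" where
  "ennreal_powr x a = (if x = top then top else ennreal (enn2real x powr a))"

definition weighted_int :: "real \<Rightarrow> (real \<Rightarrow> ennreal) \<Rightarrow> real \<Rightarrow> ennreal" where
  "weighted_int \<alpha> g t = (\<integral>\<^sup>+ s\<in>{0..t}. ennreal ((t - s) powr (\<alpha> - 1)) * g s \<partial>lebesgue)"

text \<open>The norm of \<open>L\<^sup>p\<^sub>\<alpha>(0,T;X)\<close> as a functional of the pointwise norm \<open>s \<mapsto> \<parallel>w(s)\<parallel> \<in> [0,\<infinity>]\<close>.
  It is stated for extended values so that it also applies to functions built from \<open>\<Phi>\<close>.\<close>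

definition Lpa_norm_ext :: "real \<Rightarrow> real \<Rightarrow> real \<Rightarrow> (real \<Rightarrow> ennreal) \<Rightarrow> ennreal" where
  "Lpa_norm_ext p \<alpha> T g =
     (SUP t\<in>{0..T}. ennreal_powr (weighted_int \<alpha> (\<lambda>s. ennreal_powr (g s) p) t) (1 / p))"

abbreviation Lpa_norm :: "real \<Rightarrow> real \<Rightarrow> real \<Rightarrow> (real \<Rightarrow> 'a::real_normed_vector) \<Rightarrow> ennreal" where
  "Lpa_norm p \<alpha> T w \<equiv> Lpa_norm_ext p \<alpha> T (\<lambda>s. ennreal (norm (w s)))"

text \<open>On a separable space strong and Borel measurability agree.\<close>

definition Lpa_space ::
    "real \<Rightarrow> real \<Rightarrow> real \<Rightarrow> (real \<Rightarrow> 'a::{real_normed_vector, second_countable_topology}) set" where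
  "Lpa_space p \<alpha> T = {w. w \<in> borel_measurable (lebesgue_on {0<..<T}) \<and> Lpa_norm p \<alpha> T w < top}"

definition L2_space ::
    "real \<Rightarrow> (real \<Rightarrow> 'a::{real_normed_vector, second_countable_topology}) set" where
  "L2_space T = {w. w \<in> borel_measurable (lebesgue_on {0<..<T}) \<and>
                    (\<integral>\<^sup>+ s\<in>{0<..<T}. ennreal ((norm (w s))\<^sup>2) \<partial>lebesgue) < top}"

text \<open>The space \<open>L\<^sup>1\<^sub>l\<^sub>o\<^sub>c([0,T);X)\<close>: integrable up to \<open>0\<close>, but only locally towards \<open>T\<close>.\<close>

definition L1loc_space ::
    "real \<Rightarrow> (real \<Rightarrow> 'a::{banach, second_countable_topology}) set" where
  "L1loc_space T = {w. \<forall>S<T. set_integrable lebesgue {0..S} w}"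

text \<open>Integral over \<open>(0,T)\<close> of an extended real function, as the difference of the integrals of its
  positive and negative part.\<close>

definition ext_integral :: "real \<Rightarrow> (real \<Rightarrow> ereal) \<Rightarrow> ereal" where
  "ext_integral T h = enn2ereal (\<integral>\<^sup>+ t\<in>{0<..<T}. e2ennreal (h t) \<partial>lebesgue)
                    - enn2ereal (\<integral>\<^sup>+ t\<in>{0<..<T}. e2ennreal (- h t) \<partial>lebesgue)"

section \<open>The generalized Caputo derivative\<close>

text \<open>Test functions on \<open>(-\<infinity>,T)\<close>.\<close>

definition test_function :: "real \<Rightarrow> (real \<Rightarrow> real) \<Rightarrow> bool" where
  "test_function T \<phi> \<longleftrightarrow>
     (\<forall>n x. ((deriv ^^ n) \<phi>) field_differentiable (at x)) \<and>
     compact (closure {x. \<phi> x \<noteq> 0}) \<and> closure {x. \<phi> x \<noteq> 0} \<subseteq> {..<T}"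

definition caputo_primitive ::
    "real \<Rightarrow> 'a::{banach, second_countable_topology} \<Rightarrow> (real \<Rightarrow> 'a) \<Rightarrow> real \<Rightarrow> 'a" where
  "caputo_primitive \<alpha> w0 w t =
     (if t \<ge> 0
      then (1 / Gamma (1 - \<alpha>)) *\<^sub>R (LINT s:{0..t}|lebesgue. (t - s) powr (- \<alpha>) *\<^sub>R (w s - w0))
      else 0)"

text \<open>The distributional derivative on \<open>(-\<infinity>,T)\<close> of the primitive is the function \<open>g\<close> on \<open>(0,T)\<close>,
  extended by zero to the negative axis (where the primitive vanishes).\<close>

definition has_caputo_deriv ::
    "real \<Rightarrow> real \<Rightarrow> 'a::{banach, second_countable_topology} \<Rightarrow> (real \<Rightarrow> 'a) \<Rightarrow> (real \<Rightarrow> 'a) \<Rightarrow> bool" where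
  "has_caputo_deriv \<alpha> T w0 w g \<longleftrightarrow>
     w \<in> L1loc_space T \<and> g \<in> L1loc_space T \<and>
     (\<forall>\<phi>. test_function T \<phi> \<longrightarrow>
        (LINT t:{..<T}|lebesgue. deriv \<phi> t *\<^sub>R caputo_primitive \<alpha> w0 w t)
        = - (LINT t:{0<..<T}|lebesgue. \<phi> t *\<^sub>R g t))"

text \<open>The derivative is determined up to null sets of \<open>(0,T)\<close>; any representative is chosen.\<close>

definition caputo_deriv ::
    "real \<Rightarrow> real \<Rightarrow> 'a::{banach, second_countable_topology} \<Rightarrow> (real \<Rightarrow> 'a) \<Rightarrow> real \<Rightarrow> 'a" where
  "caputo_deriv \<alpha> T w0 w = (SOME g. has_caputo_deriv \<alpha> T w0 w g)"

section \<open>Energy solutions\<close>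

text \<open>The term \<open>\<integral>\<Phi>(w)\<close> stands on the right-hand side of the variational inequality, so that the
  inequality is trivial when this integral is \<open>\<infinity>\<close>. Nothing here depends on the values of \<open>u\<close>
  on null sets; pointwise statements about an energy solution (such as a supremum of its error over
  \<open>[0,T]\<close>) refer to its continuous representative on \<open>[0,T]\<close>.\<close>

definition energy_solution ::
    "real \<Rightarrow> real \<Rightarrow> ('a::{real_inner, banach, second_countable_topology} \<Rightarrow> ereal) \<Rightarrow>
     (real \<Rightarrow> 'a) \<Rightarrow> 'a \<Rightarrow> (real \<Rightarrow> 'a) \<Rightarrow> bool" where
  "energy_solution \<alpha> T \<Phi> f u0 u \<longleftrightarrow>
     u \<in> L2_space T \<and>
     ((\<lambda>t. (1 / t) * (LINT s:{0..t}|lebesgue. (norm (u s - u0))\<^sup>2)) \<longlongrightarrow> 0) (at_right 0) \<and>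
     (\<exists>g. has_caputo_deriv \<alpha> T u0 u g) \<and>
     caputo_deriv \<alpha> T u0 u \<in> L2_space T \<and>
     (\<forall>w\<in>L2_space T.
        ereal (LINT t:{0<..<T}|lebesgue. caputo_deriv \<alpha> T u0 u t \<bullet> (u t - w t))
          + ext_integral T (\<lambda>t. \<Phi> (u t))
        \<le> ereal (LINT t:{0<..<T}|lebesgue. f t \<bullet> (u t - w t))
          + ext_integral T (\<lambda>t. \<Phi> (w t)))"

section \<open>Discretization\<close>

definition is_partition :: "real \<Rightarrow> nat \<Rightarrow> (nat \<Rightarrow> real) \<Rightarrow> bool" where
  "is_partition T N P \<longleftrightarrow> P 0 = 0 \<and> P N = T \<and> (\<forall>n<N. P n < P (Suc n))"

text \<open>The index \<open>n(t)\<close>, specified for \<open>0 < t \<le> T\<close> only.\<close>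

definition interval_index :: "nat \<Rightarrow> (nat \<Rightarrow> real) \<Rightarrow> real \<Rightarrow> nat" where
  "interval_index N P t = (THE n. n \<in> {1..N} \<and> t \<in> {P (n - 1)<..P n})"

text \<open>\<open>N \<times> N\<close> matrices are functions of two indices in \<open>{1..N}\<close> that vanish for all other indices.\<close>

definition Kmat :: "real \<Rightarrow> nat \<Rightarrow> (nat \<Rightarrow> real) \<Rightarrow> nat \<Rightarrow> nat \<Rightarrow> real" where
  "Kmat \<alpha> N P n i =
     (if 1 \<le> i \<and> i \<le> n \<and> n \<le> N
      then (1 / Gamma (\<alpha> + 1)) * ((P n - P (i - 1)) powr \<alpha> - (P n - P i) powr \<alpha>)
      else 0)"

definition is_inverse_mat :: "nat \<Rightarrow> (nat \<Rightarrow> nat \<Rightarrow> real) \<Rightarrow> (nat \<Rightarrow> nat \<Rightarrow> real) \<Rightarrow> bool" where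
  "is_inverse_mat N A B \<longleftrightarrow>
     (\<forall>n i. \<not> (n \<in> {1..N} \<and> i \<in> {1..N}) \<longrightarrow> B n i = 0) \<and>
     (\<forall>n\<in>{1..N}. \<forall>i\<in>{1..N}. (\<Sum>j=1..N. A n j * B j i) = (if n = i then 1 else 0)) \<and>
     (\<forall>n\<in>{1..N}. \<forall>i\<in>{1..N}. (\<Sum>j=1..N. B n j * A j i) = (if n = i then 1 else 0))"

definition Kinv :: "real \<Rightarrow> nat \<Rightarrow> (nat \<Rightarrow> real) \<Rightarrow> nat \<Rightarrow> nat \<Rightarrow> real" where
  "Kinv \<alpha> N P = (THE B. is_inverse_mat N (Kmat \<alpha> N P) B)"

definition discrete_caputo ::
    "real \<Rightarrow> nat \<Rightarrow> (nat \<Rightarrow> real) \<Rightarrow> (nat \<Rightarrow> 'a::real_vector) \<Rightarrow> nat \<Rightarrow> 'a" where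
  "discrete_caputo \<alpha> N P W n = (\<Sum>i=1..n. Kinv \<alpha> N P n i *\<^sub>R (W i - W 0))"

definition avg_rhs ::
    "(nat \<Rightarrow> real) \<Rightarrow> (real \<Rightarrow> 'a::{banach, second_countable_topology}) \<Rightarrow> nat \<Rightarrow> 'a" where
  "avg_rhs P f n = (1 / (P n - P (n - 1))) *\<^sub>R (LINT t:{P (n - 1)..P n}|lebesgue. f t)"

definition discrete_solution ::
    "real \<Rightarrow> nat \<Rightarrow> (nat \<Rightarrow> real) \<Rightarrow>
     ('a::{real_inner, banach, second_countable_topology} \<Rightarrow> ereal) \<Rightarrow>
     (real \<Rightarrow> 'a) \<Rightarrow> (nat \<Rightarrow> 'a) \<Rightarrow> bool" where
  "discrete_solution \<alpha> N P \<Phi> f U \<longleftrightarrow>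
     (\<forall>n\<in>{1..N}. avg_rhs P f n - discrete_caputo \<alpha> N P U n \<in> subdiff \<Phi> (U n))"

definition Ubar :: "nat \<Rightarrow> (nat \<Rightarrow> real) \<Rightarrow> (nat \<Rightarrow> 'a) \<Rightarrow> real \<Rightarrow> 'a" where
  "Ubar N P U t = U (interval_index N P t)"

definition Fbar ::
    "nat \<Rightarrow> (nat \<Rightarrow> real) \<Rightarrow> (real \<Rightarrow> 'a::{banach, second_countable_topology}) \<Rightarrow> real \<Rightarrow> 'a" where
  "Fbar N P f t = avg_rhs P f (interval_index N P t)"

definition Uhat ::
    "real \<Rightarrow> nat \<Rightarrow> (nat \<Rightarrow> real) \<Rightarrow> (nat \<Rightarrow> 'a::{banach, second_countable_topology}) \<Rightarrow> real \<Rightarrow> 'a" where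
  "Uhat \<alpha> N P U t =
     U 0 + (1 / Gamma \<alpha>) *\<^sub>R
       (LINT s:{0..t}|lebesgue.
          (t - s) powr (\<alpha> - 1) *\<^sub>R discrete_caputo \<alpha> N P U (interval_index N P s))"

section \<open>Error estimator and error\<close>

definition estimator ::
    "real \<Rightarrow> real \<Rightarrow> nat \<Rightarrow> (nat \<Rightarrow> real) \<Rightarrow>
     ('a::{real_inner, banach, second_countable_topology} \<Rightarrow> ereal) \<Rightarrow>
     (real \<Rightarrow> 'a) \<Rightarrow> (nat \<Rightarrow> 'a) \<Rightarrow> real \<Rightarrow> ereal" where
  "estimator \<alpha> T N P \<Phi> f U t =
     ereal ((caputo_deriv \<alpha> T (U 0) (Uhat \<alpha> N P U) t - Fbar N P f t)
              \<bullet> (Uhat \<alpha> N P U t - Ubar N P U t))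
     + \<Phi> (Uhat \<alpha> N P U t) - \<Phi> (Ubar N P U t)"

definition err_H ::
    "real \<Rightarrow> nat \<Rightarrow> (nat \<Rightarrow> real) \<Rightarrow>
     (real \<Rightarrow> 'a::{real_inner, banach, second_countable_topology}) \<Rightarrow> (nat \<Rightarrow> 'a) \<Rightarrow> real \<Rightarrow> real" where
  "err_H \<alpha> N P u U t = norm (u t - Uhat \<alpha> N P U t)"

definition err_sigma ::
    "real \<Rightarrow> nat \<Rightarrow> (nat \<Rightarrow> real) \<Rightarrow>
     ('a::{real_inner, banach, second_countable_topology} \<Rightarrow> ereal) \<Rightarrow>
     (real \<Rightarrow> 'a) \<Rightarrow> (nat \<Rightarrow> 'a) \<Rightarrow> real \<Rightarrow> ennreal" where
  "err_sigma \<alpha> N P \<Phi> u U t =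
     ennreal_powr
       (ennreal (2 / Gamma \<alpha>) *
        weighted_int \<alpha>
          (\<lambda>s. e2ennreal (coerc_mod \<Phi> (u s) (Uhat \<alpha> N P U s) + coerc_mod \<Phi> (Ubar N P U s) (u s))) t)
       (1 / 2)"

definition total_err ::
    "real \<Rightarrow> real \<Rightarrow> nat \<Rightarrow> (nat \<Rightarrow> real) \<Rightarrow>
     ('a::{real_inner, banach, second_countable_topology} \<Rightarrow> ereal) \<Rightarrow>
     (real \<Rightarrow> 'a) \<Rightarrow> (nat \<Rightarrow> 'a) \<Rightarrow> ennreal" where
  "total_err \<alpha> T N P \<Phi> u U =
     ennreal_powr
       (SUP t\<in>{0..T}. ennreal ((err_H \<alpha> N P u U t)\<^sup>2) + (err_sigma \<alpha> N P \<Phi> u U t)\<^sup>2)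
       (1 / 2)"

end

theory Submission
  imports Defs
begin

text \<open>Write \<open>v = u - \<close>\<^term>\<open>Uhat\<close> and let \<open>h\<close> be its Caputo derivative. Adding the subgradient
  inequality of the equation at \<open>u\<close> (tested with \<^term>\<open>Uhat\<close>) to that of the scheme at \<^term>\<open>Ubar\<close> (tested
  with \<open>u\<close>) bounds \<open>h \<bullet> v\<close> plus the two coercivity moduli by the estimator plus
  \<open>\<parallel>f - \<close>\<^term>\<open>Fbar\<close>\<open>\<parallel> \<parallel>v\<parallel>\<close>. The fractional chain inequality
  \<open>\<parallel>v(t)\<parallel>\<^sup>2 \<le> \<parallel>v(0)\<parallel>\<^sup>2 + 2 I\<^sup>\<alpha>(h \<bullet> v)(t)\<close> turns this into a quadratic inequality for the error, which is
  solved for the error. For \<open>C\<^sup>1\<close> functions the chain inequality follows by integrating by parts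
  against the decreasing kernel of \<open>I\<^bsup>1-\<alpha>\<^esup>\<close>. In general only \<open>v\<close> continuous with
  \<open>I\<^bsup>1-\<alpha>\<^esup>(v - v(0))\<close> absolutely continuous is available: it is approximated by Steklov means, the
  limit is taken in the once integrated inequality, and lower semicontinuity recovers every \<open>t\<close>.\<close>

section \<open>Smooth bump functions\<close>

text \<open>The Caputo derivative is given as a distribution and \<open>caputo_deriv\<close> is an
  arbitrary representative, so it is used only through its primitive: for continuous w,
  \<open>RL (1 - \<alpha>)\<close> of w - w(0) equals the primitive of the derivative at every t <
  T. Testing with bumps leaves no constant of integration undetermined, because the compensating
  bump sits on the negative axis, where the Caputo primitive is zero by definition. A second
  obstacle: \<open>RL \<alpha>\<close> of an integrable function exists only almost everywhere,
  whereas the kernel of \<open>RL (\<alpha> + 1)\<close> is bounded on bounded intervals. This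
  forces the detour through one more integration. The final inequality is M \<le> A + b sqrt(M),
  where M is the squared error. The factor sqrt(M) stems from Cauchy-Schwarz in the data term: the
  maximal norm of u - \<open>Uhat\<close> is at most sqrt(M), since M dominates the square of E_H.
  Hence sqrt(M) \<le> sqrt(A) + b, which is why the data error stands outside the root. The constant
  2 / Gamma(\<alpha>) is the 2 of the chain inequality times the normalisation of the
  kernel.\<close>

definition flat_exp :: "nat \<Rightarrow> real \<Rightarrow> real" where
  "flat_exp k x = (if 0 < x then (1 / x) ^ k * exp (- (1 / x)) else 0)"

lemma flat_exp_tendsto_0: "(flat_exp k \<longlongrightarrow> 0) (at_right 0)"
proof -
  have "((\<lambda>x::real. (inverse x) ^ k / exp (inverse x)) \<longlongrightarrow> 0) (at_right 0)"
    by (rule filterlim_compose[OF tendsto_power_div_exp_0 filterlim_inverse_at_top_right])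
  moreover have "\<forall>\<^sub>F x in at_right (0::real). inverse x ^ k / exp (inverse x) = flat_exp k x"
    by (rule eventually_at_right_less[THEN eventually_mono])
       (auto simp: flat_exp_def exp_minus field_simps)
  ultimately show ?thesis by (rule Lim_transform_eventually)
qed

text \<open>Differentiation stays in the span of the family x^(-k) exp(-1/x), whose members all
  vanish at 0. This carries the smoothness of the glued function through all orders at once.\<close>

lemma flat_exp_deriv:
  "(flat_exp k has_field_derivative (flat_exp (k + 2) x - real k * flat_exp (k + 1) x)) (at x)"
proof -
  consider "x > 0" | "x < 0" | "x = 0" by linarith
  then show ?thesis
  proof cases
    case 1
    have "((\<lambda>x. (1 / x) ^ k * exp (- (1 / x))) has_field_derivative
        (flat_exp (k + 2) x - real k * flat_exp (k + 1) x)) (at x)"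
    proof (cases k)
      case 0
      then show ?thesis using 1
        by (auto intro!: derivative_eq_intros simp: flat_exp_def power2_eq_square)
    next
      case (Suc n)
      have e: "real (Suc n) * (1 / x) ^ n * (- (1 / (x * x))) * exp (- (1 / x))
          + (1 / x) ^ Suc n * (exp (- (1 / x)) * (1 / (x * x)))
          = flat_exp (Suc n + 2) x - real (Suc n) * flat_exp (Suc n + 1) x"
        using 1 by (simp add: flat_exp_def algebra_simps add_divide_distrib)
      have "((\<lambda>x. 1 / x) has_field_derivative - (1 / (x * x))) (at x)"
        using 1 by (intro derivative_eq_intros refl) auto
      then have "((\<lambda>x. (1 / x) ^ Suc n * exp (- (1 / x))) has_field_derivative
        real (Suc n) * (1 / x) ^ n * (- (1 / (x * x))) * exp (- (1 / x))
          + (1 / x) ^ Suc n * (exp (- (1 / x)) * (1 / (x * x)))) (at x)"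
        using 1 by (auto intro!: derivative_eq_intros simp del: power_Suc simp: ac_simps)
      then show ?thesis unfolding e Suc .
    qed
    then show ?thesis
      by (rule has_field_derivative_transform_within_open[of _ _ _ "{0<..}"])
         (use 1 in \<open>auto simp: flat_exp_def\<close>)
  next
    case 2
    have "((\<lambda>x. 0) has_field_derivative
        (flat_exp (k + 2) x - real k * flat_exp (k + 1) x)) (at x)"
      using 2 by (auto simp: flat_exp_def)
    then show ?thesis
      by (rule has_field_derivative_transform_within_open[of _ _ _ "{..<0}"])
         (use 2 in \<open>auto simp: flat_exp_def\<close>)
  next
    case 3
    \<comment> \<open>On the right the difference quotient at 0 is \<open>flat_exp (Suc k)\<close>,
      the next member of the family.\<close>
    have "((\<lambda>y. flat_exp k y / y) \<longlongrightarrow> 0) (at_right 0)"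
      by (rule Lim_transform_eventually[OF flat_exp_tendsto_0[of "Suc k"]])
         (auto simp: flat_exp_def eventually_at_filter)
    moreover have "((\<lambda>y. flat_exp k y / y) \<longlongrightarrow> 0) (at_left 0)"
      by (rule Lim_transform_eventually[OF tendsto_const])
         (auto simp: flat_exp_def eventually_at_filter)
    ultimately have "((\<lambda>y. flat_exp k y / y) \<longlongrightarrow> 0) (at 0)"
      by (simp add: filterlim_split_at)
    then show ?thesis
      using 3 by (simp add: has_field_derivative_iff flat_exp_def)
  qed
qed

text \<open>A class of functions closed under differentiation, so that the condition on all iterated
  derivatives in \<open>test_function\<close> follows by one induction.\<close>

inductive bump_expr :: "(real \<Rightarrow> real) \<Rightarrow> bool" where
  base: "bump_expr (\<lambda>x. flat_exp k (c * x + d))"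
| const: "bump_expr (\<lambda>x. c)"
| add: "bump_expr f \<Longrightarrow> bump_expr g \<Longrightarrow> bump_expr (\<lambda>x. f x + g x)"
| mult: "bump_expr f \<Longrightarrow> bump_expr g \<Longrightarrow> bump_expr (\<lambda>x. f x * g x)"

lemma bump_expr_deriv:
  assumes "bump_expr f"
  shows "\<exists>f'. bump_expr f' \<and> (\<forall>x. (f has_field_derivative f' x) (at x))"
  using assms
proof induction
  case (base k c d)
  define f' where "f' = (\<lambda>x. c * (flat_exp (k + 2) (c * x + d) + (- real k) * flat_exp (k + 1) (c * x + d)))"
  have "bump_expr f'" unfolding f'_def by (intro bump_expr.intros)
  moreover have "((\<lambda>x. flat_exp k (c * x + d)) has_field_derivative f' x) (at x)" for x
  proof -
    have "((\<lambda>x. c * x + d) has_field_derivative c) (at x)"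
      by (auto intro!: derivative_eq_intros)
    from DERIV_chain2[OF flat_exp_deriv this, of k] show ?thesis
      by (simp add: f'_def algebra_simps)
  qed
  ultimately show ?case by blast
next
  case (const c)
  show ?case by (intro exI[of _ "\<lambda>x. 0"]) (auto intro: bump_expr.intros)
next
  case (add f g)
  then obtain f' g' where "bump_expr f'" "bump_expr g'"
    "\<forall>x. (f has_field_derivative f' x) (at x)" "\<forall>x. (g has_field_derivative g' x) (at x)" by blast
  then show ?case
    by (intro exI[of _ "\<lambda>x. f' x + g' x"]) (auto intro!: bump_expr.intros derivative_eq_intros)
next
  case (mult f g)
  then obtain f' g' where fg: "bump_expr f'" "bump_expr g'"
    "\<forall>x. (f has_field_derivative f' x) (at x)" "\<forall>x. (g has_field_derivative g' x) (at x)" by blast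
  have "bump_expr (\<lambda>x. f' x * g x + f x * g' x)"
    using fg mult by (intro bump_expr.intros)
  moreover have "((\<lambda>x. f x * g x) has_field_derivative f' x * g x + f x * g' x) (at x)" for x
    using fg(3,4) by (auto intro!: derivative_eq_intros)
  ultimately show ?case by blast
qed

lemma bump_expr_smooth:
  assumes "bump_expr f"
  shows "((deriv ^^ n) f) field_differentiable (at x)"
proof -
  have "bump_expr ((deriv ^^ n) f)"
  proof (induction n)
    case 0
    show ?case using assms by simp
  next
    case (Suc n)
    then obtain f' where "bump_expr f'" "\<forall>x. (((deriv ^^ n) f) has_field_derivative f' x) (at x)"
      using bump_expr_deriv by blast
    moreover have "deriv ((deriv ^^ n) f) = f'"
      using calculation by (auto intro!: ext DERIV_imp_deriv)
    ultimately show ?case by simp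
  qed
  then show ?thesis
    using bump_expr_deriv field_differentiable_def by blast
qed

definition bump :: "real \<Rightarrow> real \<Rightarrow> real \<Rightarrow> real" where
  "bump a b x = flat_exp 0 (x - a) * flat_exp 0 (b - x)"

lemma bump_expr_bump: "bump_expr (\<lambda>x. bump a b (x + d))"
proof -
  have "bump_expr (\<lambda>x. flat_exp 0 (1 * x + (d - a)) * flat_exp 0 ((-1) * x + (b - d)))"
    by (intro bump_expr.intros)
  also have "(\<lambda>x. flat_exp 0 (1 * x + (d - a)) * flat_exp 0 ((-1) * x + (b - d))) = (\<lambda>x. bump a b (x + d))"
    by (auto simp: bump_def algebra_simps)
  finally show ?thesis .
qed

lemma bump_nonneg: "0 \<le> bump a b x"
  and bump_pos: "a < x \<Longrightarrow> x < b \<Longrightarrow> 0 < bump a b x"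
  and bump_zero: "x \<le> a \<or> b \<le> x \<Longrightarrow> bump a b x = 0"
  by (auto simp: bump_def flat_exp_def)

lemma continuous_bump [continuous_intros]: "continuous_on S (bump a b)"
proof -
  have "\<exists>D. (bump a b has_field_derivative D) (at x)" for x
    using bump_expr_deriv[OF bump_expr_bump[of a b 0]] by auto
  then show ?thesis
    by (meson DERIV_isCont continuous_at_imp_continuous_on)
qed

text \<open>The derivative of a test function on \<open>(-\<infinity>,T)\<close> can be prescribed to be minus a bump inside
  \<open>(0,T)\<close>, as long as it is compensated by a translated copy on the negative axis.\<close>

lemma test_function_bump_primitive:
  assumes "0 \<le> a" "a < b" "b < T"
  obtains \<phi> where "test_function T \<phi>" "\<And>x. b < x \<Longrightarrow> \<phi> x = 0" "\<And>x. (\<phi> has_field_derivative (bump a b (x + T) - bump a b x)) (at x)"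
proof -
  \<comment> \<open>The translated bump lives on (a - T, b - T), left of 0 because b < T. The base
    point a - T - 1 lies left of both supports.\<close>
  define E where "E = (\<lambda>x. integral {a - T - 1..x} (\<lambda>y. bump a b (y + T) - bump a b y))"
  define \<phi> where "\<phi> = (\<lambda>x. if x > a - T - 1 then E x else 0)"
  have E': "(E has_field_derivative (bump a b (x + T) - bump a b x)) (at x)" if "x > a - T - 1" for x
  proof -
    have "continuous_on {a - T - 1..x + 1} (\<lambda>y. bump a b (y + T) - bump a b y)"
      by (intro continuous_intros continuous_on_compose2[OF continuous_bump[of UNIV]]) auto
    then have "(E has_vector_derivative (bump a b (x + T) - bump a b x)) (at x within {a - T - 1..x + 1})"
      unfolding E_def by (rule integral_has_vector_derivative) (use that in auto)
    moreover have "at x within {a - T - 1..x + 1} = at x"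
      by (rule at_within_interior) (use that in simp)
    ultimately show ?thesis
      by (simp add: has_real_derivative_iff_has_vector_derivative)
  qed
  have E0: "E x = 0" if "x > a - T - 1" "x \<le> a - T" for x
  proof -
    have "E x = integral {a - T - 1..x} (\<lambda>y. 0)"
      unfolding E_def by (intro integral_cong) (use that assms in \<open>auto simp: bump_zero\<close>)
    then show ?thesis by simp
  qed
  have d: "(\<phi> has_field_derivative (bump a b (x + T) - bump a b x)) (at x)" for x
  proof (cases "x > a - T - 1")
    case True
    show ?thesis
      by (rule has_field_derivative_transform_within_open[OF E'[OF True], of "{a - T - 1<..}"])
         (use True in \<open>auto simp: \<phi>_def\<close>)
  next
    case False
    have "((\<lambda>x. 0) has_field_derivative (bump a b (x + T) - bump a b x)) (at x)"
      using False assms by (simp add: bump_zero)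
    then show ?thesis
      by (rule has_field_derivative_transform_within_open[of _ _ _ "{..<a - T}"])
         (use False E0 in \<open>auto simp: \<phi>_def\<close>)
  qed
  have zero: "\<phi> x = 0" if "x \<notin> {a - T..b}" for x
  proof (cases "x \<le> a - T")
    case True
    then show ?thesis using E0 by (auto simp: \<phi>_def)
  next
    case False
    with that have x: "x > b" by auto
    have "continuous_on {c..d} (\<lambda>y. bump a b (y + T))" for c d
      by (rule continuous_on_compose2[OF continuous_bump[of UNIV a b]]) (auto intro!: continuous_intros)
    then have i: "(bump a b) integrable_on {c..d}" "(\<lambda>y. bump a b (y + T)) integrable_on {c..d}" for c d
      by (auto intro!: integrable_continuous_real continuous_bump)
    have *: "integral {c..d} (bump a b) = integral {a..b} (bump a b)" if "c \<le> a" "b \<le> d" for c d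
    proof -
      have "integral {a..b} (bump a b) = integral {c..d} (\<lambda>x. if x \<in> {a..b} then bump a b x else 0)"
        using that by (simp only: Henstock_Kurzweil_Integration.integral_restrict_Int) (simp add: Int_absorb2)
      also have "\<dots> = integral {c..d} (bump a b)"
        by (rule integral_cong) (auto simp: bump_zero)
      finally show ?thesis ..
    qed
    \<comment> \<open>Both bumps have the same mass, so the primitive returns to zero beyond b; this
      is what makes the support compact.\<close>
    have "integral {a - T - 1..x} (\<lambda>y. bump a b (y + T)) = integral {a - 1..x + T} (bump a b)"
      using integral_shift_real_ivl[of "a - 1" T "x + T" "bump a b"] by (simp add: algebra_simps)
    also have "\<dots> = integral {a..b} (bump a b)" by (rule *) (use x assms in auto)
    also have "\<dots> = integral {a - T - 1..x} (bump a b)"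
      by (rule *[symmetric]) (use x assms in auto)
    finally have "E x = 0" unfolding E_def using i by (subst integral_diff) auto
    then show ?thesis by (simp add: \<phi>_def)
  qed
  have "((deriv ^^ n) \<phi>) field_differentiable (at x)" for n x
  proof (cases n)
    case 0
    then show ?thesis using d field_differentiable_def by auto
  next
    case (Suc m)
    have "deriv \<phi> = (\<lambda>x. bump a b (x + T) + (-1) * bump a b (x + 0))"
      using d by (auto intro!: ext DERIV_imp_deriv)
    moreover have "bump_expr \<dots>" by (intro bump_expr.intros bump_expr_bump)
    ultimately show ?thesis
      unfolding Suc funpow_Suc_right comp_def by (simp only: bump_expr_smooth)
  qed
  moreover have cl: "closure {x. \<phi> x \<noteq> 0} \<subseteq> {a - T..b}"
  proof (rule closure_minimal)
    show "{x. \<phi> x \<noteq> 0} \<subseteq> {a - T..b}" using zero by blast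
  qed simp
  moreover have "compact (closure {x. \<phi> x \<noteq> 0})"
    using cl compact_Icc by (meson bounded_closed_interval bounded_subset closed_closure compact_eq_bounded_closed)
  ultimately have "test_function T \<phi>"
    unfolding test_function_def using assms by fastforce
  with d zero that show ?thesis by fastforce
qed

section \<open>Riemann-Liouville integrals\<close>

lemma sigma_finite_lebesgue: "sigma_finite_measure (lebesgue :: real measure)"
proof
  have "countable (range (\<lambda>n::nat. {- real n..real n}))" by simp
  moreover have "\<Union> (range (\<lambda>n::nat. {- real n..real n})) = UNIV"
  proof -
    have "x \<in> (\<Union>n. {- real n..real n})" for x
    proof -
      obtain n where "\<bar>x\<bar> \<le> real n" using real_arch_simple by blast
      then have "x \<in> {- real n..real n}" by auto
      then show ?thesis by blast
    qed
    then show ?thesis by blast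
  qed
  ultimately show "\<exists>A. countable A \<and> A \<subseteq> sets (lebesgue :: real measure) \<and> \<Union> A = space lebesgue \<and>
      (\<forall>a\<in>A. emeasure lebesgue a \<noteq> \<infinity>)"
    by (intro exI[of _ "range (\<lambda>n::nat. {- real n..real n})"]) auto
qed

interpretation leb: sigma_finite_measure "lebesgue :: real measure"
  by (rule sigma_finite_lebesgue)

interpretation leb_pair: pair_sigma_finite "lebesgue :: real measure" "lebesgue :: real measure" ..

text \<open>The product is one of completed measures; with its coordinates known as Borel functions,
  kernels that are Borel in both variables become measurable on it.\<close>

lemma borel_measurable_leb_fst [measurable]:
    "fst \<in> borel_measurable ((lebesgue :: real measure) \<Otimes>\<^sub>M (lebesgue :: real measure))" (is ?A)
  and borel_measurable_leb_snd [measurable]: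
    "snd \<in> borel_measurable ((lebesgue :: real measure) \<Otimes>\<^sub>M (lebesgue :: real measure))" (is ?B)
proof -
  have i: "(\<lambda>x::real. x) \<in> borel_measurable lebesgue"
    by (simp add: borel_measurable_continuous_onI measurable_completion)
  show ?A by (rule measurable_compose[OF measurable_fst i])
  show ?B by (rule measurable_compose[OF measurable_snd i])
qed

text \<open>The kernel \<^term>\<open>kap b\<close> is extended by zero, so that \<^term>\<open>RL b\<close> is the Riemann-Liouville
  integral \<open>I\<^sup>b\<close> and convolution identities hold on the whole line.\<close>

definition kap :: "real \<Rightarrow> real \<Rightarrow> real" where
  "kap b r = (if 0 < r then r powr (b - 1) / Gamma b else 0)"

definition RL :: "real \<Rightarrow> (real \<Rightarrow> 'a::{banach, second_countable_topology}) \<Rightarrow> real \<Rightarrow> 'a" where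
  "RL b w t = (LINT s:{0..t}|lebesgue. kap b (t - s) *\<^sub>R w s)"

lemma kap_measurable [measurable]: "kap b \<in> borel_measurable borel"
  unfolding kap_def by measurable

lemma kap_nonneg: "0 < b \<Longrightarrow> 0 \<le> kap b r"
  by (simp add: kap_def less_imp_le Gamma_real_pos)

lemma kap_1: "kap 1 r = (if 0 < r then 1 else 0)"
  by (simp add: kap_def)

lemma kap_scale: "0 < c \<Longrightarrow> kap b (c * x) = c powr (b - 1) * kap b x"
  by (simp add: kap_def powr_mult zero_less_mult_iff)

lemma kap_le:
  assumes "1 \<le> b" "r \<le> t" "0 \<le> t"
  shows "kap b r \<le> t powr (b - 1) / Gamma b"
  using assms by (auto simp: kap_def intro!: divide_right_mono powr_mono2 less_imp_le[OF Gamma_real_pos])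

lemma kap_antimono:
  assumes "0 < b" "b \<le> 1" "0 < r" "r \<le> r'"
  shows "kap b r' \<le> kap b r"
  using assms by (auto simp: kap_def intro!: divide_right_mono powr_mono2' less_imp_le[OF Gamma_real_pos])

lemma kap_Beta:
  assumes "0 < a" "0 < b"
  shows "has_bochner_integral lborel (\<lambda>x. kap a (1 - x) * kap b x) (1 / Gamma (a + b))"
proof -
  have i: "set_integrable lborel {0..1} (\<lambda>t. t powr (b - 1) * (1 - t) powr (a - 1))"
    using assms by (intro integrable_Beta)
  have "(LBINT t:{0..1}. t powr (b - 1) * (1 - t) powr (a - 1)) = Beta b a"
    using set_borel_integral_eq_integral(2)[OF i] has_integral_Beta_real[of b a] assms
    by (simp add: integral_unique)
  with i have "has_bochner_integral lborel
      (\<lambda>t. indicator {0..1} t *\<^sub>R (t powr (b - 1) * (1 - t) powr (a - 1))) (Beta b a)"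
    by (simp add: has_bochner_integral_iff set_integrable_def set_lebesgue_integral_def)
  then have "has_bochner_integral lborel
      (\<lambda>t. indicator {0..1} t *\<^sub>R (t powr (b - 1) * (1 - t) powr (a - 1)) / (Gamma a * Gamma b))
      (Beta b a / (Gamma a * Gamma b))"
    by (rule has_bochner_integral_divide_zero)
  moreover have "(\<lambda>t. indicator {0..1} t *\<^sub>R (t powr (b - 1) * (1 - t) powr (a - 1)) / (Gamma a * Gamma b))
      = (\<lambda>x. kap a (1 - x) * kap b x)"
    by (auto simp: fun_eq_iff kap_def indicator_def)
  moreover have "Beta b a / (Gamma a * Gamma b) = 1 / Gamma (a + b)"
    using Gamma_real_pos[OF assms(1)] Gamma_real_pos[OF assms(2)]
    by (simp add: Beta_def add.commute divide_eq_eq)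
  ultimately show ?thesis by simp
qed

text \<open>The substitution r = s + (t - s) x reduces the convolution to the Beta integral
  \<open>kap_Beta\<close>. For s \<ge> t both sides vanish, since the two kernels are never nonzero
  together.\<close>

lemma kap_conv:
  assumes "0 < a" "0 < b"
  shows "has_bochner_integral lebesgue (\<lambda>r. kap a (t - r) * kap b (r - s)) (kap (a + b) (t - s))"
proof (cases "s < t")
  case True
  define c where "c = t - s"
  have c: "0 < c" using True by (simp add: c_def)
  have "has_bochner_integral lborel (\<lambda>x. (c powr (a - 1) * c powr (b - 1)) * (kap a (1 - x) * kap b x))
     (c powr (a - 1) * c powr (b - 1) * (1 / Gamma (a + b)))"
    by (intro has_bochner_integral_mult_right kap_Beta assms)
  also have "(\<lambda>x. (c powr (a - 1) * c powr (b - 1)) * (kap a (1 - x) * kap b x))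
      = (\<lambda>x. kap a (t - (s + c * x)) * kap b ((s + c * x) - s))"
  proof
    fix x
    have "t - (s + c * x) = c * (1 - x)" by (simp add: c_def algebra_simps)
    then show "(c powr (a - 1) * c powr (b - 1)) * (kap a (1 - x) * kap b x)
      = kap a (t - (s + c * x)) * kap b ((s + c * x) - s)"
      using c by (simp add: kap_scale)
  qed
  also have "c powr (a - 1) * c powr (b - 1) * (1 / Gamma (a + b)) = kap (a + b) (t - s) /\<^sub>R \<bar>c\<bar>"
  proof -
    have "c powr (a - 1) * c powr (b - 1) * c = c powr (a + b - 1)"
      using c powr_add[of c "a - 1 + (b - 1)" 1] by (simp add: powr_add[symmetric] algebra_simps)
    then have "c powr (a - 1) * c powr (b - 1) = c powr (a + b - 1) / c"
      using c by (simp add: eq_divide_eq)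
    then show ?thesis using c by (simp add: kap_def c_def[symmetric] divide_inverse ac_simps)
  qed
  finally have "has_bochner_integral lborel (\<lambda>r. kap a (t - r) * kap b (r - s)) (kap (a + b) (t - s))"
    using c lborel_has_bochner_integral_real_affine_iff[of c "\<lambda>r. kap a (t - r) * kap b (r - s)" "kap (a + b) (t - s)" s]
    by simp
  then show ?thesis
    by (simp add: has_bochner_integral_iff integrable_completion integral_completion)
next
  case False
  then have "(\<lambda>r. kap a (t - r) * kap b (r - s)) = (\<lambda>r. 0)" "kap (a + b) (t - s) = 0"
    by (auto simp: kap_def fun_eq_iff)
  then show ?thesis by (simp add: has_bochner_integral_zero)
qed

text \<open>Tonelli criterion that justifies each exchange of integrals below: the kernel c is
  integrated out in its first variable with a bound uniform in the second, and the integrable weight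
  p remains.\<close>

lemma integrable_pair_kernel:
  fixes F :: "real \<Rightarrow> real \<Rightarrow> 'a::{banach, second_countable_topology}"
  assumes F: "case_prod F \<in> borel_measurable (lebesgue \<Otimes>\<^sub>M lebesgue)"
    and c: "case_prod c \<in> borel_measurable (lebesgue \<Otimes>\<^sub>M lebesgue)"
    and bnd: "\<And>t s. norm (F t s) \<le> c t s * p s"
    and c0: "\<And>t s. 0 \<le> c t s"
    and p: "integrable lebesgue p" and p0: "\<And>s. 0 \<le> p s"
    and C: "\<And>s. p s \<noteq> 0 \<Longrightarrow> (\<integral>\<^sup>+ t. ennreal (c t s) \<partial>lebesgue) \<le> ennreal C"
  shows "integrable (lebesgue \<Otimes>\<^sub>M lebesgue) (case_prod F)"
proof (rule integrableI_bounded[OF F])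
  have [measurable]: "p \<in> borel_measurable lebesgue" using p by simp
  note c[measurable]
  have "(\<integral>\<^sup>+ z. ennreal (norm (case_prod F z)) \<partial>(lebesgue \<Otimes>\<^sub>M lebesgue))
      \<le> (\<integral>\<^sup>+ z. ennreal (case_prod c z) * ennreal (p (snd z)) \<partial>(lebesgue \<Otimes>\<^sub>M lebesgue))"
    by (intro nn_integral_mono) (auto simp: ennreal_mult[symmetric] c0 p0 intro!: ennreal_leI bnd)
  also have "\<dots> = (\<integral>\<^sup>+ s. \<integral>\<^sup>+ t. ennreal (c t s) * ennreal (p s) \<partial>lebesgue \<partial>lebesgue)"
    by (subst leb_pair.nn_integral_snd[symmetric]) simp_all
  also have "\<dots> \<le> (\<integral>\<^sup>+ s. ennreal C * ennreal (p s) \<partial>lebesgue)"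
  proof (rule nn_integral_mono)
    fix s :: real
    have [measurable]: "(\<lambda>t. c t s) \<in> borel_measurable lebesgue"
      using measurable_compose[OF measurable_Pair2'[of s lebesgue lebesgue] c] by simp
    show "(\<integral>\<^sup>+ t. ennreal (c t s) * ennreal (p s) \<partial>lebesgue) \<le> ennreal C * ennreal (p s)"
      using C[of s] by (cases "p s = 0") (auto simp: nn_integral_multc intro!: mult_right_mono)
  qed
  also have "\<dots> = ennreal C * (\<integral>\<^sup>+ s. ennreal (p s) \<partial>lebesgue)"
    by (simp add: nn_integral_cmult)
  also have "\<dots> < \<infinity>"
    using p p0 by (simp add: nn_integral_eq_integral ennreal_mult_less_top)
  finally show "(\<integral>\<^sup>+ z. ennreal (norm (case_prod F z)) \<partial>(lebesgue \<Otimes>\<^sub>M lebesgue)) < \<infinity>" .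
qed

text \<open>The kernel vanishes for nonpositive arguments, so the upper limit t can be moved out of
  the domain of integration. Fractional integrals at different times then live on the same
  set.\<close>

lemma RL_eq_LINT:
  assumes "t \<le> S"
  shows "RL b w t = (LINT s|lebesgue. kap b (t - s) *\<^sub>R (indicator {0..S} s *\<^sub>R w s))"
  unfolding RL_def set_lebesgue_integral_def
  by (rule Bochner_Integration.integral_cong) (use assms in \<open>auto simp: indicator_def kap_def\<close>)

lemma RL_cong:
  assumes "\<And>s. 0 < s \<Longrightarrow> s < t \<Longrightarrow> w s = w' s"
  shows "RL b w t = RL b w' t"
  unfolding RL_def set_lebesgue_integral_def
  by (rule integral_discrete_difference[of "{0}"])
     (use assms in \<open>auto simp: indicator_def kap_def\<close>)

lemma RL_1: "RL 1 w t = (LINT s:{0..t}|lebesgue. w s)"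
  unfolding RL_def set_lebesgue_integral_def
  by (rule integral_discrete_difference[of "{t}"]) (auto simp: indicator_def kap_1)

text \<open>Fubini and the convolution law of the kernels. The condition
  \<open>1 \<le> a + b\<close> makes the composed kernel bounded on [0, S], so that the identity
  holds at S itself for every integrable w. The two integrability claims are by-products of Fubini;
  the last one says that the fractional integral of an integrable function exists at almost every
  time.\<close>

lemma
  fixes w :: "real \<Rightarrow> 'a::{banach, second_countable_topology}"
  assumes ab: "0 < a" "0 < b" "1 \<le> a + b"
    and w: "set_integrable lebesgue {0..S} w"
  shows RL_RL: "RL a (RL b w) S = RL (a + b) w S"
    and RL_RL_integrable: "set_integrable lebesgue {0..S} (\<lambda>r. kap a (S - r) *\<^sub>R RL b w r)"
    and AE_RL_integrable: "AE r in lebesgue. r < S \<longrightarrow> set_integrable lebesgue {0..r} (\<lambda>s. kap b (r - s) *\<^sub>R w s)"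
proof -
  define q where "q = (\<lambda>s. indicator {0..S} s *\<^sub>R w s)"
  define F where "F = (\<lambda>r s. (kap a (S - r) * kap b (r - s)) *\<^sub>R q s)"
  have q: "integrable lebesgue q" using w by (simp add: q_def set_integrable_def)
  then have q_m: "q \<in> borel_measurable lebesgue" by simp
  have q_m2[measurable]: "(\<lambda>z. q (snd z)) \<in> borel_measurable (lebesgue \<Otimes>\<^sub>M lebesgue)"
    by (rule measurable_compose[OF measurable_snd q_m])
  have q0: "q s = 0" if "s \<notin> {0..S}" for s using that by (simp add: q_def)
  have intF: "integrable (lebesgue \<Otimes>\<^sub>M lebesgue) (case_prod F)"
  proof (rule integrable_pair_kernel)
    show "(case_prod F) \<in> borel_measurable (lebesgue \<Otimes>\<^sub>M lebesgue)"
      unfolding F_def split_beta by measurable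
    show "(\<lambda>(r, s). kap a (S - r) * kap b (r - s)) \<in> borel_measurable (lebesgue \<Otimes>\<^sub>M lebesgue)"
      unfolding split_beta by measurable
    show "norm (F r s) \<le> kap a (S - r) * kap b (r - s) * norm (q s)" for r s
      using ab by (simp add: F_def kap_nonneg)
    show "0 \<le> kap a (S - r) * kap b (r - s)" for r s using ab by (simp add: kap_nonneg)
    show "integrable lebesgue (\<lambda>s. norm (q s))" using q by simp
    fix s assume "norm (q s) \<noteq> 0"
    then have s: "s \<in> {0..S}" using q0 by auto
    have "(\<integral>\<^sup>+ t. ennreal (kap a (S - t) * kap b (t - s)) \<partial>lebesgue) = ennreal (kap (a + b) (S - s))"
      using kap_conv[OF ab(1,2), of S s] ab
      by (subst nn_integral_eq_integral) (auto simp: has_bochner_integral_iff kap_nonneg)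
    also have "\<dots> \<le> ennreal (S powr (a + b - 1) / Gamma (a + b))"
      using s ab by (intro ennreal_leI kap_le) auto
    finally show "(\<integral>\<^sup>+ t. ennreal (kap a (S - t) * kap b (t - s)) \<partial>lebesgue)
        \<le> ennreal (S powr (a + b - 1) / Gamma (a + b))" .
  qed simp
  have inner: "(LINT s|lebesgue. F r s) = indicator {0..S} r *\<^sub>R (kap a (S - r) *\<^sub>R RL b w r)" for r
  proof -
    have "(LINT s|lebesgue. F r s) = kap a (S - r) *\<^sub>R (LINT s|lebesgue. kap b (r - s) *\<^sub>R q s)"
      by (simp add: F_def flip: scaleR_scaleR)
    also have "\<dots> = indicator {0..S} r *\<^sub>R (kap a (S - r) *\<^sub>R RL b w r)"
    proof (cases "r \<le> S")
      case True
      have "kap b (r - s) *\<^sub>R q s = 0" if "r < 0" for s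
        using that q0[of s] by (cases "s < 0") (auto simp: kap_def)
      then have "(LINT s|lebesgue. kap b (r - s) *\<^sub>R q s) = 0" if "r < 0"
        using Bochner_Integration.integral_cong[OF refl, of lebesgue "\<lambda>s. kap b (r - s) *\<^sub>R q s" "\<lambda>s. 0"] that
        by simp
      moreover have "RL b w r = (LINT s|lebesgue. kap b (r - s) *\<^sub>R q s)"
        using RL_eq_LINT[OF True, of b w] by (simp add: q_def)
      ultimately show ?thesis using True by (cases "r < 0") (simp_all add: indicator_def)
    qed (auto simp: kap_def)
    finally show ?thesis .
  qed
  have "RL a (RL b w) S = (LINT r|lebesgue. LINT s|lebesgue. F r s)"
    unfolding inner RL_def[of a] set_lebesgue_integral_def ..
  also have "\<dots> = (LINT s|lebesgue. LINT r|lebesgue. F r s)"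
    by (rule leb_pair.Fubini_integral[symmetric, OF intF])
  also have "\<dots> = (LINT s|lebesgue. kap (a + b) (S - s) *\<^sub>R q s)"
  proof (rule Bochner_Integration.integral_cong[OF refl])
    fix s
    show "(LINT r|lebesgue. F r s) = kap (a + b) (S - s) *\<^sub>R q s"
      unfolding F_def using kap_conv[OF ab(1,2), of S s]
      by (subst integral_scaleR_left) (auto simp: has_bochner_integral_iff)
  qed
  also have "\<dots> = RL (a + b) w S"
    unfolding q_def by (rule RL_eq_LINT[symmetric]) simp
  finally show "RL a (RL b w) S = RL (a + b) w S" .
  show "set_integrable lebesgue {0..S} (\<lambda>r. kap a (S - r) *\<^sub>R RL b w r)"
    using leb_pair.integrable_fst[OF intF] unfolding inner set_integrable_def .
  show "AE r in lebesgue. r < S \<longrightarrow> set_integrable lebesgue {0..r} (\<lambda>s. kap b (r - s) *\<^sub>R w s)"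
    using leb_pair.AE_integrable_fst[OF intF]
  proof eventually_elim
    case (elim r)
    show ?case
    proof
      assume r: "r < S"
      \<comment> \<open>The outer kernel is positive before S and can be divided out of the slice of
        F.\<close>
      then have "kap a (S - r) \<noteq> 0"
        using Gamma_real_pos[OF ab(1)] by (auto simp: kap_def)
      then have "integrable lebesgue (\<lambda>s. (1 / kap a (S - r)) *\<^sub>R F r s)"
        using elim by simp
      also have "(\<lambda>s. (1 / kap a (S - r)) *\<^sub>R F r s) = (\<lambda>s. kap b (r - s) *\<^sub>R q s)"
        using \<open>kap a (S - r) \<noteq> 0\<close> by (simp add: F_def)
      also have "\<dots> = (\<lambda>s. indicator {0..r} s *\<^sub>R (kap b (r - s) *\<^sub>R w s))"
        using r by (auto simp: q_def fun_eq_iff indicator_def kap_def)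
      finally show "set_integrable lebesgue {0..r} (\<lambda>s. kap b (r - s) *\<^sub>R w s)"
        by (simp add: set_integrable_def)
    qed
  qed
qed

text \<open>\<open>kap 1\<close> is the Heaviside function, so convolving with it yields the
  antiderivative of the kernel.\<close>

lemma kap_integrable:
  assumes "0 < b"
  shows "has_bochner_integral lebesgue (\<lambda>s. kap b (t - s) * indicator {a<..} s) (kap (b + 1) (t - a))"
  using kap_conv[OF assms zero_less_one, of t a]
  by (simp add: kap_1 indicator_def of_bool_def if_distrib[of "\<lambda>x. _ * x"] cong: if_cong)

lemma RL_integrable:
  fixes w :: "real \<Rightarrow> 'a::{banach, second_countable_topology}"
  assumes b: "0 < b" and w: "set_borel_measurable lebesgue {0..t} w"
    and B: "\<And>s. s \<in> {0..t} \<Longrightarrow> norm (w s) \<le> B"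
  shows "set_integrable lebesgue {0..t} (\<lambda>s. kap b (t - s) *\<^sub>R w s)"
  unfolding set_integrable_def
proof (rule Bochner_Integration.integrable_bound)
  \<comment> \<open>Any bound left of 0 would do in place of -1: \<open>kap_integrable\<close>
    speaks of open half-lines, and 0 must be covered.\<close>
  show "integrable lebesgue (\<lambda>s. (kap b (t - s) * indicator {-1<..} s) * B)"
    using kap_integrable[OF b, of t "-1"] by (simp add: has_bochner_integral_iff)
  have "(\<lambda>s. kap b (t - s)) \<in> borel_measurable lborel" by measurable
  then have "(\<lambda>s. kap b (t - s) *\<^sub>R (indicator {0..t} s *\<^sub>R w s)) \<in> borel_measurable lebesgue"
    using w unfolding set_borel_measurable_def
    by (rule borel_measurable_scaleR[OF measurable_completion])
  then show "(\<lambda>s. indicator {0..t} s *\<^sub>R kap b (t - s) *\<^sub>R w s) \<in> borel_measurable lebesgue"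
    by (simp add: mult.commute)
  show "AE s in lebesgue. norm (indicator {0..t} s *\<^sub>R kap b (t - s) *\<^sub>R w s)
      \<le> norm ((kap b (t - s) * indicator {-1<..} s) * B)"
    using B b by (intro AE_I2) (auto simp: indicator_def abs_mult kap_nonneg
        intro!: mult_left_mono order_trans[OF _ abs_ge_self])
qed

text \<open>The difference of the two kernels is nonpositive before \<open>t\<close> and nonnegative after \<open>t\<close>, so its
  \<open>L\<^sup>1\<close> norm is explicit.\<close>

lemma RL_holder:
  fixes w :: "real \<Rightarrow> 'a::{banach, second_countable_topology}"
  assumes b: "0 < b" "b \<le> 1" and w: "set_borel_measurable lebesgue {0..S} w"
    and B: "\<And>s. s \<in> {0..S} \<Longrightarrow> norm (w s) \<le> B"
    and t: "0 \<le> t" "t \<le> t'" "t' \<le> S"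
  shows "norm (RL b w t' - RL b w t) \<le> 2 * B * kap (b + 1) (t' - t)"
proof -
  define q where "q = (\<lambda>s. indicator {0..S} s *\<^sub>R w s)"
  have B0: "0 \<le> B" using B[of 0] t by (auto intro: order_trans[OF norm_ge_zero])
  have i: "integrable lebesgue (\<lambda>s. kap b (r - s) *\<^sub>R q s)" if "r \<in> {t, t'}" for r
  proof -
    have r: "0 \<le> r" "r \<le> S" using that t by auto
    have "set_integrable lebesgue {0..r} (\<lambda>s. kap b (r - s) *\<^sub>R w s)"
    proof (rule RL_integrable[OF b(1)])
      show "set_borel_measurable lebesgue {0..r} w"
        by (rule set_borel_measurable_subset[OF w]) (use r in auto)
      show "norm (w s) \<le> B" if "s \<in> {0..r}" for s using B[of s] that r by auto
    qed
    also have "set_integrable lebesgue {0..r} (\<lambda>s. kap b (r - s) *\<^sub>R w s)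
        = integrable lebesgue (\<lambda>s. kap b (r - s) *\<^sub>R q s)"
      unfolding set_integrable_def q_def
      by (rule Bochner_Integration.integrable_cong[OF refl])
         (use r in \<open>auto simp: indicator_def kap_def\<close>)
    finally show ?thesis .
  qed
  \<comment> \<open>For s > -1 and s \<noteq> t the integrand is the absolute difference of the two
    kernels, times B. The first two terms of its integral have a nonpositive sum and are dropped at
    the end.\<close>
  have *: "has_bochner_integral lebesgue (\<lambda>s. (kap b (t - s) * indicator {-1<..} s
      - kap b (t' - s) * indicator {-1<..} s + 2 * (kap b (t' - s) * indicator {t<..} s)) * B)
      ((kap (b + 1) (t - (-1)) - kap (b + 1) (t' - (-1)) + 2 * kap (b + 1) (t' - t)) * B)"
    by (intro has_bochner_integral_mult_left has_bochner_integral_add has_bochner_integral_diff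
         has_bochner_integral_mult_right kap_integrable b)
  define D where "D = (\<lambda>s. (kap b (t' - s) - kap b (t - s)) *\<^sub>R q s)"
  have D: "integrable lebesgue D"
    unfolding D_def using i unfolding scaleR_diff_left by (intro Bochner_Integration.integrable_diff) auto
  have "RL b w t' - RL b w t = (LINT s|lebesgue. D s)"
    using t i unfolding D_def scaleR_diff_left
    by (subst (1 2) RL_eq_LINT[of _ S]) (simp_all add: q_def del: scaleR_scaleR)
  also have "norm \<dots> \<le> (LINT s|lebesgue. norm (D s))" by (rule integral_norm_bound)
  also have "\<dots> \<le> (LINT s|lebesgue. (kap b (t - s) * indicator {-1<..} s
      - kap b (t' - s) * indicator {-1<..} s + 2 * (kap b (t' - s) * indicator {t<..} s)) * B)"
  proof (rule integral_mono_AE)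
    show "integrable lebesgue (\<lambda>s. norm (D s))" using D by simp
    show "integrable lebesgue (\<lambda>s. (kap b (t - s) * indicator {-1<..} s
      - kap b (t' - s) * indicator {-1<..} s + 2 * (kap b (t' - s) * indicator {t<..} s)) * B)"
      using * by (simp add: has_bochner_integral_iff)
    have "norm (D s) \<le> (kap b (t - s) * indicator {-1<..} s
      - kap b (t' - s) * indicator {-1<..} s + 2 * (kap b (t' - s) * indicator {t<..} s)) * B"
      (is "_ \<le> ?K * B") if "s \<noteq> t" for s
    proof (cases "s \<in> {0..S}")
      case True
      have k: "0 \<le> kap b r" for r using b by (simp add: kap_nonneg)
      have "\<bar>kap b (t' - s) - kap b (t - s)\<bar> \<le> ?K"
      proof (cases "s < t")
        case sl: True
        have "kap b (t' - s) \<le> kap b (t - s)"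
          using sl t b by (intro kap_antimono) auto
        then show ?thesis using True sl by (simp add: indicator_def)
      next
        case False
        then have "kap b (t - s) = 0" by (simp add: kap_def)
        then show ?thesis using False True that k[of "t' - s"] by (simp add: indicator_def)
      qed
      moreover have "norm (q s) \<le> B" using True B by (simp add: q_def)
      ultimately show ?thesis by (simp add: D_def mult_mono)
    next
      case False
      have k: "0 \<le> kap b r" for r using b by (simp add: kap_nonneg)
      have "0 \<le> ?K"
      proof (cases "s < t")
        case True
        then show ?thesis using False t b k[of "t' - s"] kap_antimono[of b "t - s" "t' - s"]
          by (auto simp: indicator_def)
      next
        case False
        then have "kap b (t - s) = 0" by (simp add: kap_def)
        then show ?thesis using False that k[of "t' - s"] by (simp add: indicator_def)
      qed
      with False B0 show ?thesis by (simp add: D_def q_def)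
    qed
    note neq = this
    show "AE s in lebesgue. norm (D s) \<le> (kap b (t - s) * indicator {-1<..} s
      - kap b (t' - s) * indicator {-1<..} s + 2 * (kap b (t' - s) * indicator {t<..} s)) * B"
      using AE_completion[OF AE_lborel_singleton[of t]] by (rule eventually_mono) (rule neq)
  qed
  also have "\<dots> = (kap (b + 1) (t - (-1)) - kap (b + 1) (t' - (-1)) + 2 * kap (b + 1) (t' - t)) * B"
    by (rule has_bochner_integral_integral_eq[OF *])
  also have "\<dots> \<le> (2 * kap (b + 1) (t' - t)) * B"
  proof (rule mult_right_mono[OF _ B0])
    have "kap (b + 1) (t + 1) \<le> kap (b + 1) (t' + 1)"
      using t b by (auto simp: kap_def intro!: divide_right_mono powr_mono2 less_imp_le[OF Gamma_real_pos])
    then show "kap (b + 1) (t - (-1)) - kap (b + 1) (t' - (-1)) + 2 * kap (b + 1) (t' - t)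
        \<le> 2 * kap (b + 1) (t' - t)" by simp
  qed
  finally show ?thesis by (simp add: ac_simps)
qed

lemma RL_continuous:
  fixes w :: "real \<Rightarrow> 'a::{banach, second_countable_topology}"
  assumes b: "0 < b" "b \<le> 1" and w: "set_borel_measurable lebesgue {0..S} w"
    and B: "\<And>s. s \<in> {0..S} \<Longrightarrow> norm (w s) \<le> B"
  shows "continuous_on {0..S} (RL b w)"
  unfolding continuous_on_def
proof
  fix t assume t: "t \<in> {0..S}"
  have bd: "norm (RL b w r - RL b w t) \<le> 2 * B * (\<bar>r - t\<bar> powr b / Gamma (b + 1))" if "r \<in> {0..S}" for r
  proof -
    have "norm (RL b w r - RL b w t) \<le> 2 * B * kap (b + 1) \<bar>r - t\<bar>"
    proof (cases "t \<le> r")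
      case True
      then show ?thesis using RL_holder[OF b w B, of t r] t that by auto
    next
      case False
      then show ?thesis using RL_holder[OF b w B, of r t] t that by (auto simp: norm_minus_commute)
    qed
    then show ?thesis by (cases "r = t") (auto simp: kap_def)
  qed
  have "((\<lambda>r. 2 * B * (\<bar>r - t\<bar> powr b / Gamma (b + 1))) \<longlongrightarrow> 2 * B * (\<bar>t - t\<bar> powr b / Gamma (b + 1)))
      (at t within {0..S})"
    using b by (intro tendsto_intros) (auto intro!: tendsto_eq_intros Gamma_real_pos simp: less_imp_neq[OF Gamma_real_pos, symmetric])
  then have "((\<lambda>r. 2 * B * (\<bar>r - t\<bar> powr b / Gamma (b + 1))) \<longlongrightarrow> 0) (at t within {0..S})"
    using b by simp
  then have "((\<lambda>r. RL b w r - RL b w t) \<longlongrightarrow> 0) (at t within {0..S})"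
    by (rule Lim_null_comparison[rotated]) (use bd in \<open>auto simp: eventually_at_filter\<close>)
  then show "(RL b w \<longlongrightarrow> RL b w t) (at t within {0..S})"
    by (simp add: LIM_zero_iff)
qed

lemma set_integrable_continuous_Icc:
  fixes w :: "real \<Rightarrow> 'a::{banach, second_countable_topology}"
  assumes "continuous_on {a..b} w"
  shows "set_integrable lebesgue {a..b} w"
  using borel_integrable_atLeastAtMost'[OF assms] by (simp add: set_integrable_def integrable_completion)

lemma set_borel_measurable_continuous_Icc:
  fixes w :: "real \<Rightarrow> 'a::{banach, second_countable_topology}"
  assumes "continuous_on {a..b} w"
  shows "set_borel_measurable lebesgue {a..b} w"
  using set_integrable_continuous_Icc[OF assms]
  by (simp add: set_integrable_def set_borel_measurable_def)

lemma continuous_on_primitive: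
  fixes g :: "real \<Rightarrow> 'a::{banach, second_countable_topology}"
  assumes g: "set_integrable lebesgue {0..S} g"
  shows "continuous_on {0..S} (\<lambda>t. LINT s:{0..t}|lebesgue. g s)"
  unfolding continuous_on_sequentially
proof (intro allI ballI impI, elim conjE)
  fix x :: "nat \<Rightarrow> real" and t
  assume t: "t \<in> {0..S}" and x: "\<forall>n. x n \<in> {0..S}" "x \<longlonglongrightarrow> t"
  have gi: "set_integrable lebesgue {0..r} g" if "r \<in> {0..S}" for r
    by (rule set_integrable_subset[OF g]) (use that in auto)
  show "((\<lambda>t. LINT s:{0..t}|lebesgue. g s) \<circ> x) \<longlonglongrightarrow> (LINT s:{0..t}|lebesgue. g s)"
    unfolding set_lebesgue_integral_def comp_def
  proof (rule integral_dominated_convergence)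
    show "integrable lebesgue (\<lambda>s. norm (indicat_real {0..S} s *\<^sub>R g s))"
      using g unfolding set_integrable_def by (rule integrable_norm)
    show "(\<lambda>s. indicat_real {0..t} s *\<^sub>R g s) \<in> borel_measurable lebesgue"
      "(\<lambda>s. indicat_real {0..x n} s *\<^sub>R g s) \<in> borel_measurable lebesgue" for n
      using gi[OF t] gi[of "x n"] x(1) unfolding set_integrable_def by auto
    show "AE s in lebesgue. norm (indicat_real {0..x n} s *\<^sub>R g s) \<le> norm (indicat_real {0..S} s *\<^sub>R g s)" for n
      using x(1)[rule_format, of n] by (intro AE_I2) (auto simp: indicator_def)
    have "(\<lambda>n. indicat_real {0..x n} s *\<^sub>R g s) \<longlonglongrightarrow> indicat_real {0..t} s *\<^sub>R g s" if st: "s \<noteq> t" for s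
    proof (rule tendsto_eventually)
      consider "s < t" | "t < s" using st by linarith
      then show "\<forall>\<^sub>F n in sequentially. indicat_real {0..x n} s *\<^sub>R g s = indicat_real {0..t} s *\<^sub>R g s"
      proof cases
        case 1
        show ?thesis using order_tendstoD(1)[OF x(2) 1]
          by eventually_elim (use 1 in \<open>auto simp: indicator_def\<close>)
      next
        case 2
        show ?thesis using order_tendstoD(2)[OF x(2) 2]
          by eventually_elim (use 2 in \<open>auto simp: indicator_def\<close>)
      qed
    qed
    note lim = this
    show "AE s in lebesgue. (\<lambda>n. indicat_real {0..x n} s *\<^sub>R g s) \<longlonglongrightarrow> indicat_real {0..t} s *\<^sub>R g s"
      using AE_completion[OF AE_lborel_singleton[of t]] by (rule eventually_mono) (rule lim)
  qed
qed

lemma set_integral_continuous_lborel: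
  fixes w :: "real \<Rightarrow> 'a::{banach, second_countable_topology}"
  assumes "continuous_on {a..b} w"
  shows "(LINT s:{a..b}|lebesgue. w s) = (LINT s|lborel. indicator {a..b} s *\<^sub>R w s)"
  unfolding set_lebesgue_integral_def
  by (rule integral_completion)
     (use borel_integrable_atLeastAtMost'[OF assms] in \<open>simp add: set_integrable_def\<close>)

lemma RL_0: "RL b w 0 = 0"
  unfolding RL_def set_lebesgue_integral_def
  by (subst integral_discrete_difference[of "{}" _ _ "\<lambda>_. 0"]) (auto simp: indicator_def kap_def)

lemma continuous_on_Icc_norm_bounded:
  fixes w :: "real \<Rightarrow> 'a::real_normed_vector"
  assumes "continuous_on {a..b} w"
  obtains B where "0 \<le> B" "\<And>s. s \<in> {a..b} \<Longrightarrow> norm (w s) \<le> B"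
proof -
  have "bounded (w ` {a..b})"
    by (intro compact_imp_bounded compact_continuous_image assms) auto
  then obtain B where B: "\<And>s. s \<in> {a..b} \<Longrightarrow> norm (w s) \<le> B"
    unfolding bounded_iff by blast
  show ?thesis by (rule that[of "max 0 B"]) (use B in \<open>auto intro: le_max_iff_disj[THEN iffD2]\<close>)
qed

lemma RL_integrable_continuous:
  fixes w :: "real \<Rightarrow> 'a::{banach, second_countable_topology}"
  assumes "0 < b" "continuous_on {0..S} w" "t \<le> S"
  shows "set_integrable lebesgue {0..t} (\<lambda>s. kap b (t - s) *\<^sub>R w s)"
proof -
  have c: "continuous_on {0..t} w" by (rule continuous_on_subset[OF assms(2)]) (use assms in auto)
  obtain B where B: "\<And>s. s \<in> {0..t} \<Longrightarrow> norm (w s) \<le> B"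
    using continuous_on_Icc_norm_bounded[OF c] by blast
  show ?thesis
    by (rule RL_integrable[OF assms(1) set_borel_measurable_continuous_Icc[OF c] B])
qed

lemma RL_continuous_continuous:
  fixes w :: "real \<Rightarrow> 'a::{banach, second_countable_topology}"
  assumes "0 < b" "b \<le> 1" "continuous_on {0..S} w"
  shows "continuous_on {0..S} (RL b w)"
  using continuous_on_Icc_norm_bounded[OF assms(3)]
  by (metis RL_continuous[OF assms(1,2) set_borel_measurable_continuous_Icc[OF assms(3)]])

section \<open>The distributional Caputo derivative\<close>

text \<open>Half-lines are stable under intersection and generate the Borel sets, so by Dynkin's
  argument q integrates to zero over all Borel sets, then over Lebesgue sets up to null sets. The
  cutoff S turns the integral over the whole line, needed for complements, into one over a
  half-line.\<close>

lemma AE_zero_if_integrals_atMost_zero: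
  fixes q :: "real \<Rightarrow> 'a::{banach, second_countable_topology}"
  assumes q: "integrable lebesgue q" and q0: "\<And>t. (LINT s:{..t}|lebesgue. q s) = 0"
    and S: "\<And>s. S < s \<Longrightarrow> q s = 0"
  shows "AE s in lebesgue. q s = 0"
proof (rule leb.density_zero[OF q])
  have qi: "set_integrable lebesgue A q" if "A \<in> sets lebesgue" for A
    using integrable_mult_indicator[OF that q] by (simp add: set_integrable_def)
  have UN: "(LINT s:UNIV|lebesgue. q s) = 0"
  proof -
    have "(LINT s:UNIV|lebesgue. q s) = (LINT s:{..S}|lebesgue. q s)"
      unfolding set_lebesgue_integral_def
      by (rule Bochner_Integration.integral_cong) (use S in \<open>auto simp: indicator_def\<close>)
    then show ?thesis using q0 by simp
  qed
  have borel: "(LINT s:A|lebesgue. q s) = 0" if "A \<in> sets borel" for A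
  proof -
    have A: "A \<in> sigma_sets UNIV (range atMost)"
      using that by (simp add: borel_eq_atMost)
    show ?thesis
    proof (rule sigma_sets_induct_disjoint[of "range atMost" UNIV A, OF _ _ A])
      show "Int_stable (range (atMost :: real \<Rightarrow> real set))"
        by (auto simp: Int_stable_def intro: min.left_idem)
    next
      fix A :: "real set" assume "A \<in> range atMost"
      then show "(LINT s:A|lebesgue. q s) = 0" using q0 by auto
    next
      fix A :: "real set"
      assume "A \<in> sigma_sets UNIV (range atMost)" and A0: "(LINT s:A|lebesgue. q s) = 0"
      then have A: "A \<in> sets borel" by (simp add: borel_eq_atMost)
      have "(LINT s:A \<union> (UNIV - A)|lebesgue. q s) = (LINT s:A|lebesgue. q s) + (LINT s:UNIV - A|lebesgue. q s)"
        by (rule set_integral_Un) (use A in \<open>auto intro!: qi\<close>)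
      then show "(LINT s:UNIV - A|lebesgue. q s) = 0" using UN A0 by simp
    next
      fix A :: "nat \<Rightarrow> real set"
      assume d: "disjoint_family A" and A: "range A \<subseteq> sigma_sets UNIV (range atMost)"
        and A0: "\<And>i. (LINT s:A i|lebesgue. q s) = 0"
      have "range A \<subseteq> sets borel" using A unfolding borel_eq_atMost by simp
      then have A': "A i \<in> sets lebesgue" for i by auto
      have "(LINT s:(\<Union>i. A i)|lebesgue. q s) = (\<Sum>i. (LINT s:(A i)|lebesgue. q s))"
        by (rule lebesgue_integral_countable_add)
           (use d A' in \<open>auto simp: disjoint_family_on_def intro!: qi sets.countable_UN\<close>)
      then show "(LINT s:(\<Union>i. A i)|lebesgue. q s) = 0" using A0 by simp
    qed (auto simp: set_lebesgue_integral_def)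
  qed
  fix A :: "real set" assume A: "A \<in> sets lebesgue"
  then obtain B N N' where A': "A = B \<union> N" "N \<subseteq> N'" "N' \<in> null_sets lborel" "B \<in> sets lborel"
    unfolding sets_completion by (auto elim!: completionE)
  have "AE s in lborel. s \<notin> N'" by (rule AE_not_in) (rule A')
  then have N: "AE s in lebesgue. s \<notin> N'" by (rule AE_completion)
  have "(LINT s:A|lebesgue. q s) = (LINT s:B|lebesgue. q s)"
    unfolding set_lebesgue_integral_def
  proof (rule integral_cong_AE)
    show "(\<lambda>s. indicat_real A s *\<^sub>R q s) \<in> borel_measurable lebesgue"
      using qi[OF A] by (simp add: set_integrable_def)
    show "(\<lambda>s. indicat_real B s *\<^sub>R q s) \<in> borel_measurable lebesgue"
      using qi[of B] A'(4) by (simp add: set_integrable_def)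
    show "AE s in lebesgue. indicat_real A s *\<^sub>R q s = indicat_real B s *\<^sub>R q s"
      using N by eventually_elim (use A' in \<open>auto simp: indicator_def\<close>)
  qed
  then show "(LINT s:A|lebesgue. q s) = 0" using borel[of B] A'(4) by simp
qed

text \<open>Integrability holds only up to each S < T, so [0, T) is exhausted by the countably many
  intervals [0, T - 1/(n+1)].\<close>

lemma AE_eq_if_primitive_eq:
  fixes g g' :: "real \<Rightarrow> 'a::{banach, second_countable_topology}"
  assumes g: "\<And>S. S < T \<Longrightarrow> set_integrable lebesgue {0..S} g" and g': "\<And>S. S < T \<Longrightarrow> set_integrable lebesgue {0..S} g'"
    and eq: "\<And>t. 0 \<le> t \<Longrightarrow> t < T \<Longrightarrow> (LINT s:{0..t}|lebesgue. g s) = (LINT s:{0..t}|lebesgue. g' s)"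
  shows "AE t in lebesgue. 0 \<le> t \<and> t < T \<longrightarrow> g t = g' t"
proof -
  define S where "S = (\<lambda>n::nat. T - 1 / (real n + 1))"
  have S: "S n < T" for n by (simp add: S_def)
  have "AE t in lebesgue. indicator {0..S n} t *\<^sub>R (g t - g' t) = 0" for n
  proof (rule AE_zero_if_integrals_atMost_zero[of _ "S n"])
    have d: "set_integrable lebesgue {0..S n} (\<lambda>t. g t - g' t)"
      using g[OF S] g'[OF S] by (rule set_integral_diff)
    then show "integrable lebesgue (\<lambda>t. indicat_real {0..S n} t *\<^sub>R (g t - g' t))"
      by (simp add: set_integrable_def)
    fix t
    define r where "r = min t (S n)"
    have r: "r < T" "{0..r} \<subseteq> {0..S n}" using S[of n] by (auto simp: r_def)
    have "(LINT s:{..t}|lebesgue. indicat_real {0..S n} s *\<^sub>R (g s - g' s)) = (LINT s:{0..r}|lebesgue. g s - g' s)"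
      unfolding set_lebesgue_integral_def
      by (rule Bochner_Integration.integral_cong) (auto simp: indicator_def r_def)
    also have "\<dots> = (LINT s:{0..r}|lebesgue. g s) - (LINT s:{0..r}|lebesgue. g' s)"
      using g[OF r(1)] g'[OF r(1)] by (rule set_integral_diff)
    also have "\<dots> = 0"
      using eq[of r] r by (cases "0 \<le> r") (auto simp: set_lebesgue_integral_def)
    finally show "(LINT s:{..t}|lebesgue. indicat_real {0..S n} s *\<^sub>R (g s - g' s)) = 0" .
  qed (simp add: indicator_def)
  then have "AE t in lebesgue. \<forall>n. indicator {0..S n} t *\<^sub>R (g t - g' t) = 0"
    by (simp only: AE_all_countable) blast
  then show ?thesis
  proof eventually_elim
    case (elim t)
    show ?case
    proof
      assume t: "0 \<le> t \<and> t < T"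
      obtain n where "inverse (real (Suc n)) < T - t"
        using reals_Archimedean[of "T - t"] t by auto
      then have "t \<in> {0..S n}" using t by (simp add: S_def inverse_eq_divide add.commute)
      then show "g t = g' t" using elim[rule_format, of n] by simp
    qed
  qed
qed

text \<open>For merely integrable g this is Fubini on the triangle s \<le> t: integrating \<phi>'
  over [s, S] gives - \<phi>(s), because \<phi> vanishes at S.\<close>

lemma integral_by_parts_primitive:
  fixes g :: "real \<Rightarrow> 'a::{banach, second_countable_topology}"
  assumes S: "0 \<le> S" and g: "set_integrable lebesgue {0..S} g"
    and \<phi>: "\<And>x. (\<phi> has_field_derivative \<phi>' x) (at x)" and \<phi>': "continuous_on UNIV \<phi>'" and \<phi>S: "\<phi> S = 0"
  shows "(LINT t:{0..S}|lebesgue. \<phi>' t *\<^sub>R (LINT s:{0..t}|lebesgue. g s)) = - (LINT t:{0..S}|lebesgue. \<phi> t *\<^sub>R g t)"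
proof -
  define q where "q = (\<lambda>s. indicator {0..S} s *\<^sub>R g s)"
  have q: "integrable lebesgue q" using g by (simp add: q_def set_integrable_def)
  then have q_m: "q \<in> borel_measurable lebesgue" by simp
  have q_m2[measurable]: "(\<lambda>z. q (snd z)) \<in> borel_measurable (lebesgue \<Otimes>\<^sub>M lebesgue)"
    by (rule measurable_compose[OF measurable_snd q_m])
  have [measurable]: "\<phi>' \<in> borel_measurable borel" by (rule borel_measurable_continuous_onI[OF \<phi>'])
  have "compact (\<phi>' ` {0..S})"
    by (rule compact_continuous_image[OF continuous_on_subset[OF \<phi>']]) auto
  then obtain B where B: "\<And>t. t \<in> {0..S} \<Longrightarrow> \<bar>\<phi>' t\<bar> \<le> B"
    using compact_imp_bounded bounded_iff by (metis imageI real_norm_def)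
  then have B0: "0 \<le> B" using S by (meson abs_ge_zero atLeastAtMost_iff order.refl order_trans)
  define F where "F = (\<lambda>t s. (indicator {0..S} t * (if s \<le> t then \<phi>' t else 0)) *\<^sub>R q s)"
  have intF: "integrable (lebesgue \<Otimes>\<^sub>M lebesgue) (case_prod F)"
  proof (rule integrable_pair_kernel)
    show "(case_prod F) \<in> borel_measurable (lebesgue \<Otimes>\<^sub>M lebesgue)"
      unfolding F_def split_beta by measurable
    show "(\<lambda>(t, s::real). B * indicat_real {0..S} t) \<in> borel_measurable (lebesgue \<Otimes>\<^sub>M lebesgue)"
      unfolding split_beta by measurable
    show "norm (F t s) \<le> B * indicator {0..S} t * norm (q s)" for t s
      using B[of t] by (auto simp: F_def indicator_def intro!: mult_right_mono order_trans[OF _ B])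
    show "0 \<le> B * indicat_real {0..S} t" for t using B0 by simp
    show "integrable lebesgue (\<lambda>s. norm (q s))" using q by simp
    fix s
    have "(\<integral>\<^sup>+ t. ennreal (B * indicat_real {0..S} t) \<partial>lebesgue) = ennreal (B * S)"
      using B0 S by (simp add: ennreal_mult nn_integral_cmult_indicator ennreal_indicator)
    then show "(\<integral>\<^sup>+ t. ennreal (B * indicat_real {0..S} t) \<partial>lebesgue) \<le> ennreal (B * S)" by simp
  qed simp
  have "(LINT t:{0..S}|lebesgue. \<phi>' t *\<^sub>R (LINT s:{0..t}|lebesgue. g s))
      = (LINT t|lebesgue. LINT s|lebesgue. F t s)"
    unfolding set_lebesgue_integral_def
  proof (rule Bochner_Integration.integral_cong[OF refl])
    fix t
    show "indicat_real {0..S} t *\<^sub>R \<phi>' t *\<^sub>R (LINT s|lebesgue. indicat_real {0..t} s *\<^sub>R g s)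
        = (LINT s|lebesgue. F t s)"
    proof (cases "t \<in> {0..S}")
      case True
      have "F t s = \<phi>' t *\<^sub>R indicat_real {0..t} s *\<^sub>R g s" for s
        using True by (auto simp: F_def q_def indicator_def)
      then show ?thesis using True by (simp del: scaleR_scaleR)
    next
      case False
      then have "F t s = 0" for s by (auto simp: F_def)
      then show ?thesis using False by simp
    qed
  qed
  also have "\<dots> = (LINT s|lebesgue. LINT t|lebesgue. F t s)"
    by (rule leb_pair.Fubini_integral[symmetric, OF intF])
  also have "\<dots> = (LINT s|lebesgue. - (indicat_real {0..S} s *\<^sub>R \<phi> s *\<^sub>R g s))"
  proof (rule Bochner_Integration.integral_cong[OF refl])
    fix s
    show "(LINT t|lebesgue. F t s) = - (indicat_real {0..S} s *\<^sub>R \<phi> s *\<^sub>R g s)"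
    proof (cases "s \<in> {0..S}")
      case True
      have i: "set_integrable lborel {s..S} \<phi>'"
        by (rule borel_integrable_atLeastAtMost'[OF continuous_on_subset[OF \<phi>']]) auto
      have "F t s = (indicator {s..S} t *\<^sub>R \<phi>' t) *\<^sub>R g s" for t
        using True by (auto simp: F_def q_def indicator_def)
      then have "(LINT t|lebesgue. F t s) = (LINT t|lebesgue. indicator {s..S} t *\<^sub>R \<phi>' t) *\<^sub>R g s"
        using i by (simp add: set_integrable_def integrable_completion)
      also have "(LINT t|lebesgue. indicator {s..S} t *\<^sub>R \<phi>' t) = (LINT t|lborel. indicator {s..S} t *\<^sub>R \<phi>' t)"
        by (rule integral_completion) measurable
      also have "\<dots> = \<phi> S - \<phi> s"
        using True \<phi> by (intro integral_FTC_atLeastAtMost continuous_on_subset[OF \<phi>'])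
          (auto simp: has_real_derivative_iff_has_vector_derivative[symmetric] intro: has_field_derivative_at_within)
      finally show ?thesis using True \<phi>S by simp
    next
      case False
      then have "F t s = 0" for t by (auto simp: F_def q_def)
      then show ?thesis using False by simp
    qed
  qed
  also have "\<dots> = - (LINT t:{0..S}|lebesgue. \<phi> t *\<^sub>R g t)"
    by (simp add: set_lebesgue_integral_def)
  finally show ?thesis .
qed

lemma caputo_primitive_eq_RL:
  "0 \<le> t \<Longrightarrow> caputo_primitive \<alpha> w0 w t = RL (1 - \<alpha>) (\<lambda>s. w s - w0) t"
proof -
  assume t: "0 \<le> t"
  have "RL (1 - \<alpha>) (\<lambda>s. w s - w0) t
      = (LINT s:{0..t}|lebesgue. (1 / Gamma (1 - \<alpha>)) *\<^sub>R ((t - s) powr (- \<alpha>) *\<^sub>R (w s - w0)))"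
    unfolding RL_def set_lebesgue_integral_def
    by (rule Bochner_Integration.integral_cong) (auto simp: indicator_def kap_def)
  then show ?thesis using t by (simp add: caputo_primitive_def del: scaleR_scaleR)
qed

lemma test_function_support:
  assumes "0 < T" "test_function T \<phi>"
  obtains S where "0 < S" "S < T" "\<And>t. S \<le> t \<Longrightarrow> \<phi> t = 0"
proof -
  \<comment> \<open>Inserting 0 keeps K nonempty and S positive even when the support is empty or
    lies on the negative axis.\<close>
  define K where "K = insert 0 (closure {x. \<phi> x \<noteq> 0})"
  have K: "compact K" "K \<subseteq> {..<T}" "K \<noteq> {}"
    using assms by (auto simp: K_def test_function_def)
  then obtain m where m: "m \<in> K" "\<And>x. x \<in> K \<Longrightarrow> x \<le> m" using compact_attains_sup by metis
  define S where "S = (m + T) / 2"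
  have "m < T" "0 \<le> m" using m K by (auto simp: K_def)
  then have S: "0 < S" "S < T" "m < S" using assms by (auto simp: S_def)
  have "\<phi> t = 0" if "S \<le> t" for t
  proof (rule ccontr)
    assume "\<phi> t \<noteq> 0"
    then have "t \<in> K" using closure_subset by (force simp: K_def)
    with m(2) S that show False by fastforce
  qed
  with S that show ?thesis by blast
qed

lemma test_function_deriv:
  assumes "test_function T \<phi>"
  shows "(\<phi> has_field_derivative deriv \<phi> x) (at x)" "continuous_on S (deriv \<phi>)"
proof -
  have d: "((deriv ^^ n) \<phi>) field_differentiable (at x)" for n x
    using assms by (simp add: test_function_def)
  show "(\<phi> has_field_derivative deriv \<phi> x) (at x)"
    using d[of 0] by (simp add: field_differentiable_derivI)
  show "continuous_on S (deriv \<phi>)"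
    using d[of 1] by (auto intro!: continuous_at_imp_continuous_on field_differentiable_imp_continuous_at)
qed

text \<open>If the two continuous functions differed at some t, their difference would have a
  positive component along a fixed direction on an interval around t. A test function whose
  derivative is minus a bump on that interval makes the weighted integral of this positive component
  vanish, a contradiction. Continuity of w is what turns the distributional identity into one at
  every t < T.\<close>

lemma caputo_deriv_primitive:
  fixes w g :: "real \<Rightarrow> 'a::{real_inner, banach, second_countable_topology}"
  assumes \<alpha>: "0 < \<alpha>" "\<alpha> < 1" and w: "continuous_on {0..T} w"
    and cap: "has_caputo_deriv \<alpha> T w0 w g" and t: "0 \<le> t" "t < T"
  shows "RL (1 - \<alpha>) (\<lambda>s. w s - w0) t = (LINT s:{0..t}|lebesgue. g s)"
proof -
  have T: "0 < T" using t by simp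
  have gi: "set_integrable lebesgue {0..S} g" if "S < T" for S
    using cap that by (auto simp: has_caputo_deriv_def L1loc_space_def)
  define W where "W = RL (1 - \<alpha>) (\<lambda>s. w s - w0)"
  define G where "G = (\<lambda>t. LINT s:{0..t}|lebesgue. g s)"
  have cw: "continuous_on {0..T} (\<lambda>s. w s - w0)" using w by (intro continuous_intros)
  then have "bounded ((\<lambda>s. w s - w0) ` {0..T})"
    by (intro compact_imp_bounded compact_continuous_image) auto
  then obtain B where B: "\<And>s. s \<in> {0..T} \<Longrightarrow> norm (w s - w0) \<le> B"
    unfolding bounded_iff by blast
  have cW: "continuous_on {0..T} W"
    unfolding W_def
  proof (rule RL_continuous)
    show "set_borel_measurable lebesgue {0..T} (\<lambda>s. w s - w0)"
      by (rule set_borel_measurable_continuous_Icc[OF cw])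
  qed (use \<alpha> B in auto)
  define S where "S = (t + T) / 2"
  have S: "t < S" "S < T" "0 < S" using t by (auto simp: S_def)
  have cG: "continuous_on {0..S} G"
    unfolding G_def by (rule continuous_on_primitive[OF gi[OF S(2)]])
  have "W t = G t"
  proof (rule ccontr)
    assume ne: "W t \<noteq> G t"
    \<comment> \<open>Pairing with the difference at t reduces the vector-valued comparison to the
      sign of a real function.\<close>
    define e where "e = W t - G t"
    have z: "W 0 = 0" "G 0 = 0"
    proof -
      show "W 0 = 0" unfolding W_def by (rule RL_0)
      show "G 0 = 0" unfolding G_def set_lebesgue_integral_def
        by (subst integral_discrete_difference[of "{0}" _ _ "\<lambda>_. 0"]) (auto simp: indicator_def)
    qed
    \<comment> \<open>Both functions vanish at 0, so t is interior and there is room for a bump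
      inside [0, T).\<close>
    then have t0: "0 < t" using ne t by (cases "t = 0") auto
    have "continuous_on {0..S} (\<lambda>r. (W r - G r) \<bullet> e)"
      by (intro continuous_intros cG continuous_on_subset[OF cW]) (use S in auto)
    then have "isCont (\<lambda>r. (W r - G r) \<bullet> e) t"
      by (rule continuous_on_interior) (use t0 S in auto)
    moreover have "0 < (W t - G t) \<bullet> e" using ne by (simp add: e_def)
    ultimately have "\<forall>\<^sub>F r in at t. 0 < (W r - G r) \<bullet> e"
      by (auto simp: isCont_def dest: order_tendstoD(1))
    then obtain d where d: "d > 0" "\<And>r. r \<noteq> t \<Longrightarrow> \<bar>r - t\<bar> < d \<Longrightarrow> 0 < (W r - G r) \<bullet> e"
      by (auto simp: eventually_at dist_real_def)
    define a b where "a = max 0 (t - d)" and "b = min S (t + d)"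
    have ab: "0 \<le> a" "a < b" "b \<le> S" "b < T" "a < t" "t < b" using d t0 S by (auto simp: a_def b_def)
    have pos: "0 < (W r - G r) \<bullet> e" if "r \<in> {a<..<b}" for r
      using that d(2)[of r] \<open>0 < (W t - G t) \<bullet> e\<close> by (cases "r = t") (auto simp: a_def b_def)
    obtain \<phi> where \<phi>: "test_function T \<phi>" "\<And>x. b < x \<Longrightarrow> \<phi> x = 0"
      "\<And>x. (\<phi> has_field_derivative (bump a b (x + T) - bump a b x)) (at x)"
      using test_function_bump_primitive[OF ab(1,2,4)] by blast
    define S' where "S' = (b + T) / 2"
    have S': "b < S'" "S' < T" "0 < S'" using ab by (auto simp: S'_def)
    have d\<phi>: "deriv \<phi> x = bump a b (x + T) - bump a b x" for x
      using \<phi>(3) by (rule DERIV_imp_deriv)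
    have cb: "continuous_on UNIV (\<lambda>x. bump a b (x + T) - bump a b x)"
      using test_function_deriv(2)[OF \<phi>(1), of UNIV] by (simp add: d\<phi>[abs_def])
    \<comment> \<open>The compensating copy is invisible on the positive axis, and on the negative
      axis the Caputo primitive is zero, so it drops out of both sides.\<close>
    have bT: "bump a b (x + T) = 0" if "0 \<le> x" for x using that ab by (simp add: bump_zero)
    have "(LINT r:{0..S'}|lebesgue. bump a b r *\<^sub>R W r) = - (LINT r:{..<T}|lebesgue. deriv \<phi> r *\<^sub>R caputo_primitive \<alpha> w0 w r)"
      unfolding set_lebesgue_integral_def integral_minus[symmetric]
    proof (rule Bochner_Integration.integral_cong[OF refl])
      fix r
      show "indicat_real {0..S'} r *\<^sub>R bump a b r *\<^sub>R W r =
         - (indicat_real {..<T} r *\<^sub>R deriv \<phi> r *\<^sub>R caputo_primitive \<alpha> w0 w r)"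
      proof (cases "0 \<le> r")
        case True
        then show ?thesis
          using S' bT[of r] bump_zero[of r a b]
          by (cases "b \<le> r") (auto simp: indicator_def W_def caputo_primitive_eq_RL d\<phi>)
      next
        case False
        then show ?thesis by (simp add: caputo_primitive_def)
      qed
    qed
    also have "\<dots> = (LINT r:{0<..<T}|lebesgue. \<phi> r *\<^sub>R g r)"
      using cap \<phi>(1) by (simp add: has_caputo_deriv_def)
    also have "\<dots> = (LINT r:{0..S'}|lebesgue. \<phi> r *\<^sub>R g r)"
      unfolding set_lebesgue_integral_def
      by (rule integral_discrete_difference[of "{0}"])
         (use \<phi>(2) S' in \<open>auto simp: indicator_def\<close>)
    also have "\<dots> = - (LINT r:{0..S'}|lebesgue. (bump a b (r + T) - bump a b r) *\<^sub>R G r)"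
      unfolding G_def using integral_by_parts_primitive[OF less_imp_le[OF S'(3)] gi[OF S'(2)] \<phi>(3) cb \<phi>(2)[OF S'(1)]]
      by simp
    also have "\<dots> = (LINT r:{0..S'}|lebesgue. bump a b r *\<^sub>R G r)"
      unfolding set_lebesgue_integral_def integral_minus[symmetric]
      by (rule Bochner_Integration.integral_cong) (auto simp: indicator_def bT)
    finally have eq: "(LINT r:{0..S'}|lebesgue. bump a b r *\<^sub>R W r) = (LINT r:{0..S'}|lebesgue. bump a b r *\<^sub>R G r)" .
    have ci: "set_integrable lebesgue {0..S'} (\<lambda>r. bump a b r *\<^sub>R Z r)" if "continuous_on {0..S} Z" for Z :: "real \<Rightarrow> 'a"
    proof -
      have "set_integrable lborel {0..S} (\<lambda>r. bump a b r *\<^sub>R Z r)"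
        by (rule borel_integrable_atLeastAtMost') (intro continuous_intros that)
      then have "set_integrable lebesgue {0..S} (\<lambda>r. bump a b r *\<^sub>R Z r)"
        by (simp add: set_integrable_def integrable_completion)
      also have "set_integrable lebesgue {0..S} (\<lambda>r. bump a b r *\<^sub>R Z r)
         \<longleftrightarrow> set_integrable lebesgue {0..S'} (\<lambda>r. bump a b r *\<^sub>R Z r)"
        unfolding set_integrable_def
      proof (rule Bochner_Integration.integrable_cong[OF refl])
        fix x
        show "indicat_real {0..S} x *\<^sub>R bump a b x *\<^sub>R Z x = indicat_real {0..S'} x *\<^sub>R bump a b x *\<^sub>R Z x"
          using ab S' bump_zero[of x a b] by (cases "b \<le> x") (auto simp: indicator_def)
      qed
      finally show ?thesis .
    qed
    have "set_integrable lebesgue {0..S'} (\<lambda>r. bump a b r *\<^sub>R W r - bump a b r *\<^sub>R G r)"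
      "(LINT r:{0..S'}|lebesgue. bump a b r *\<^sub>R W r - bump a b r *\<^sub>R G r) = 0"
      using set_integral_diff[OF ci[of W] ci[of G]] eq cG continuous_on_subset[OF cW, of "{0..S}"] S by auto
    then have i: "integrable lebesgue (\<lambda>r. indicator {0..S'} r *\<^sub>R (bump a b r *\<^sub>R W r - bump a b r *\<^sub>R G r))"
      and i0: "(LINT r|lebesgue. indicator {0..S'} r *\<^sub>R (bump a b r *\<^sub>R W r - bump a b r *\<^sub>R G r)) = 0"
      by (auto simp: set_integrable_def set_lebesgue_integral_def)
    define h where "h = (\<lambda>r. (indicator {0..S'} r *\<^sub>R (bump a b r *\<^sub>R W r - bump a b r *\<^sub>R G r)) \<bullet> e)"
    have h: "integrable lebesgue h" "(LINT r|lebesgue. h r) = 0"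
      unfolding h_def using i i0 integrable_inner_left[of e lebesgue, OF i] integral_inner_left[of e lebesgue, OF i]
      by (auto simp del: inner_scaleR_left)
    have h_eq: "h r = bump a b r * ((W r - G r) \<bullet> e)" if "r \<in> {a<..<b}" for r
      using that ab S' by (simp add: h_def inner_diff_left algebra_simps)
    have h0: "h r = 0" if "r \<notin> {a<..<b}" for r
      using that by (auto simp: h_def bump_zero)
    have nonneg: "0 \<le> h r" for r
      using h_eq[of r] h0[of r] pos[of r] bump_nonneg[of a b r] by (cases "r \<in> {a<..<b}") auto
    then have "AE r in lebesgue. h r = 0"
      using integral_nonneg_eq_0_iff_AE[OF h(1)] h(2) by simp
    then have "AE r\<in>{a<..<b} in lebesgue. r \<in> {}"
    proof eventually_elim
      case (elim r)
      then show ?case using h_eq[of r] pos[of r] bump_pos[of a r b] by auto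
    qed
    then have "t \<in> {}"
      by (rule mem_closed_if_AE_lebesgue_open[rotated 2]) (use ab in auto)
    then show False by simp
  qed
  then show ?thesis by (simp add: W_def G_def)
qed

text \<open>Converse direction: integration by parts up to some S < T beyond which the test function
  vanishes. It supplies the witness that makes the choice in \<open>caputo_deriv\<close> meaningful
  for \<open>Uhat\<close>.\<close>

lemma has_caputo_deriv_primitive:
  fixes w g :: "real \<Rightarrow> 'a::{real_inner, banach, second_countable_topology}"
  assumes T: "0 < T"
    and w: "\<And>S. S < T \<Longrightarrow> set_integrable lebesgue {0..S} w"
    and g: "\<And>S. S < T \<Longrightarrow> set_integrable lebesgue {0..S} g"
    and eq: "\<And>t. 0 \<le> t \<Longrightarrow> t < T \<Longrightarrow> RL (1 - \<alpha>) (\<lambda>s. w s - w0) t = (LINT s:{0..t}|lebesgue. g s)"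
  shows "has_caputo_deriv \<alpha> T w0 w g"
  unfolding has_caputo_deriv_def L1loc_space_def mem_Collect_eq
proof (intro conjI allI impI)
  fix \<phi> assume \<phi>: "test_function T \<phi>"
  obtain S where S: "0 < S" "S < T" "\<And>t. S \<le> t \<Longrightarrow> \<phi> t = 0"
    using test_function_support[OF T \<phi>] by blast
  have d0: "deriv \<phi> t = 0" if "S < t" for t
  proof (rule DERIV_imp_deriv)
    show "(\<phi> has_field_derivative 0) (at t)"
      by (rule has_field_derivative_transform_within_open[of "\<lambda>_. 0" _ _ "{S<..}"])
         (use S that in auto)
  qed
  have "(LINT t:{..<T}|lebesgue. deriv \<phi> t *\<^sub>R caputo_primitive \<alpha> w0 w t)
      = (LINT t:{0..S}|lebesgue. deriv \<phi> t *\<^sub>R (LINT s:{0..t}|lebesgue. g s))"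
    unfolding set_lebesgue_integral_def[of _ "{..<T}"] set_lebesgue_integral_def[of _ "{0..S}"]
  proof (rule Bochner_Integration.integral_cong[OF refl])
    fix t
    show "indicat_real {..<T} t *\<^sub>R deriv \<phi> t *\<^sub>R caputo_primitive \<alpha> w0 w t =
      indicat_real {0..S} t *\<^sub>R deriv \<phi> t *\<^sub>R (LINT s:{0..t}|lebesgue. g s)"
    proof (cases "t \<in> {0..S}")
      case True
      then show ?thesis using S eq[of t] by (simp add: caputo_primitive_eq_RL)
    next
      case False
      then show ?thesis using d0[of t] by (auto simp: caputo_primitive_def)
    qed
  qed
  also have "\<dots> = - (LINT t:{0..S}|lebesgue. \<phi> t *\<^sub>R g t)"
    by (rule integral_by_parts_primitive[OF less_imp_le[OF S(1)] g[OF S(2)]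
          test_function_deriv[OF \<phi>] S(3)]) simp
  also have "(LINT t:{0..S}|lebesgue. \<phi> t *\<^sub>R g t) = (LINT t:{0<..<T}|lebesgue. \<phi> t *\<^sub>R g t)"
    unfolding set_lebesgue_integral_def
  proof (rule integral_discrete_difference[of "{0}"])
    fix t assume "t \<notin> {0::real}"
    then show "indicat_real {0..S} t *\<^sub>R \<phi> t *\<^sub>R g t = indicat_real {0<..<T} t *\<^sub>R \<phi> t *\<^sub>R g t"
      using S(1,2) S(3)[of t] by (cases "S \<le> t") (auto simp: indicator_def)
  qed auto
  finally show "(LINT t:{..<T}|lebesgue. deriv \<phi> t *\<^sub>R caputo_primitive \<alpha> w0 w t)
      = - (LINT t:{0<..<T}|lebesgue. \<phi> t *\<^sub>R g t)" .
qed (use w g in auto)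

section \<open>The fractional chain inequality\<close>

text \<open>The difference of both sides is \<open>\<integral>\<^sub>0\<^sup>t kap b (t - s) F'(s) ds\<close> for \<open>F(s) = \<parallel>V(s) - V(t)\<parallel>\<^sup>2\<close>. The kernel
  increases in \<open>s\<close>, so the integrand is at most \<open>(kap b (t - s) F(s))'\<close>, and the boundary term at
  \<open>s = t\<close> vanishes because \<open>F\<close> is quadratic there.\<close>

lemma RL_inner_mono:
  fixes V V' :: "real \<Rightarrow> 'a::{real_inner, banach, second_countable_topology}"
  assumes b: "0 < b" "b < 1" and t: "0 \<le> t"
    and V: "\<And>s. s \<in> {0..t} \<Longrightarrow> (V has_vector_derivative V' s) (at s)" and V': "continuous_on {0..t} V'"
  shows "RL b (\<lambda>s. 2 * (V' s \<bullet> V s)) t \<le> 2 * (RL b V' t \<bullet> V t)"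
proof (cases "t = 0")
  case True
  then show ?thesis by (simp add: RL_0)
next
  case False
  with t have t0: "0 < t" by simp
  have cV: "continuous_on {0..t} V"
    using V by (meson continuous_at_imp_continuous_on has_vector_derivative_continuous)
  define F where "F = (\<lambda>s. (norm (V s - V t))\<^sup>2)"
  define F' where "F' = (\<lambda>s. 2 * (V' s \<bullet> (V s - V t)))"
  have cF': "continuous_on {0..t} F'" unfolding F'_def by (intro continuous_intros cV V')
  have F: "(F has_vector_derivative F' s) (at s)" if "s \<in> {0..t}" for s
  proof -
    have "((\<lambda>s. (V s - V t) \<bullet> (V s - V t)) has_derivative
        (\<lambda>h. (V s - V t) \<bullet> (h *\<^sub>R V' s) + (h *\<^sub>R V' s) \<bullet> (V s - V t))) (at s)"
      using V[OF that] unfolding has_vector_derivative_def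
      by (auto intro!: derivative_eq_intros)
    then show ?thesis
      by (simp add: has_vector_derivative_def F_def F'_def power2_norm_eq_inner inner_commute algebra_simps)
  qed
  have i: "set_integrable lebesgue {0..t} (\<lambda>s. kap b (t - s) * F' s)"
    using RL_integrable_continuous[OF b(1) cF', of t] by simp
  obtain L where L: "0 \<le> L" "\<And>s. s \<in> {0..t} \<Longrightarrow> norm (V' s) \<le> L"
    using continuous_on_Icc_norm_bounded[OF V'] by blast
  define J where "J = (\<lambda>r. LINT s:{0..r}|lebesgue. kap b (t - s) * F' s)"
  have J_le: "J r \<le> L\<^sup>2 * ((t - r) powr (b + 1) / Gamma b)" if r: "r \<in> {0..<t}" for r
  proof -
    \<comment> \<open>The derivative of s -> \<open>kap b (t - s)\<close>, nonnegative because b <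
      1. It is singular at s = t, hence the integration first stops at r < t.\<close>
    define k' where "k' = (\<lambda>s. (1 - b) * (t - s) powr (b - 2) / Gamma b)"
    define P where "P = (\<lambda>s. kap b (t - s) * F s)"
    define P' where "P' = (\<lambda>s. kap b (t - s) * F' s + k' s * F s)"
    have sub: "{0..r} \<subseteq> {0..t}" using r by auto
    have cF: "continuous_on {0..r} F" unfolding F_def
      by (intro continuous_intros continuous_on_subset[OF cV sub])
    have ck: "continuous_on {0..r} (\<lambda>s. kap b (t - s))"
    proof -
      have "continuous_on {0..r} (\<lambda>s. (t - s) powr (b - 1) / Gamma b)"
        using r by (intro continuous_intros) (auto simp: less_imp_neq[OF Gamma_real_pos[OF b(1)], symmetric])
      then show ?thesis
        by (rule continuous_on_cong[THEN iffD1, rotated 2]) (use r in \<open>auto simp: kap_def\<close>)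
    qed
    have ck': "continuous_on {0..r} k'"
      unfolding k'_def using r
      by (intro continuous_intros) (auto simp: less_imp_neq[OF Gamma_real_pos[OF b(1)], symmetric])
    have cP': "continuous_on {0..r} P'"
      unfolding P'_def by (intro continuous_intros ck ck' cF continuous_on_subset[OF cF' sub])
    have k: "((\<lambda>s. kap b (t - s)) has_field_derivative k' s) (at s)" if "s \<in> {0..r}" for s
    proof -
      have "((\<lambda>s. (t - s) powr (b - 1) / Gamma b) has_field_derivative k' s) (at s)"
        unfolding k'_def using that r Gamma_real_pos[OF b(1)]
        by (auto intro!: derivative_eq_intros simp: field_simps)
      then show ?thesis
        by (rule has_field_derivative_transform_within_open[of _ _ _ "{..<t}"])
           (use that r in \<open>auto simp: kap_def\<close>)
    qed
    have P: "(P has_vector_derivative P' s) (at s within {0..r})" if "s \<in> {0..r}" for s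
    proof -
      have "(F has_field_derivative F' s) (at s)"
        using F that r by (auto simp: has_real_derivative_iff_has_vector_derivative)
      from DERIV_mult[OF k[OF that] this] have "(P has_field_derivative P' s) (at s)"
        by (simp add: P_def P'_def algebra_simps)
      then show ?thesis
        by (simp add: has_real_derivative_iff_has_vector_derivative has_vector_derivative_at_within)
    qed
    have "J r \<le> (LINT s:{0..r}|lebesgue. P' s)"
      unfolding J_def
    proof (rule set_integral_mono)
      show "set_integrable lebesgue {0..r} (\<lambda>s. kap b (t - s) * F' s)"
        by (rule set_integrable_subset[OF i]) (use r in auto)
      show "set_integrable lebesgue {0..r} P'" by (rule set_integrable_continuous_Icc[OF cP'])
      fix s assume "s \<in> {0..r}"
      then show "kap b (t - s) * F' s \<le> P' s"
        using b Gamma_real_pos[OF b(1)] by (auto simp: P'_def k'_def F_def)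
    qed
    also have "\<dots> = P r - P 0"
    proof -
      have "(LINT s:{0..r}|lebesgue. P' s) = (LINT s|lborel. indicator {0..r} s *\<^sub>R P' s)"
        by (rule set_integral_continuous_lborel[OF cP'])
      also have "\<dots> = P r - P 0"
        using r P cP' by (intro integral_FTC_atLeastAtMost) auto
      finally show ?thesis .
    qed
    also have "\<dots> \<le> kap b (t - r) * F r"
      using kap_nonneg[OF b(1)] by (simp add: P_def F_def)
    also have "\<dots> \<le> kap b (t - r) * (L * (t - r))\<^sup>2"
    proof (rule mult_left_mono[OF _ kap_nonneg[OF b(1)]])
      have "\<exists>x\<in>{r<..<t}. norm (V t - V r) \<le> norm ((t - r) *\<^sub>R V' x)"
      proof (rule mvt_general)
        show "continuous_on {r..t} V" by (rule continuous_on_subset[OF cV]) (use r in auto)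
      qed (use r V in \<open>auto simp: has_vector_derivative_def\<close>)
      then obtain x where x: "x \<in> {r<..<t}" "norm (V t - V r) \<le> (t - r) * norm (V' x)" by auto
      have "norm (V r - V t) \<le> L * (t - r)"
      proof -
        have "norm (V r - V t) \<le> (t - r) * norm (V' x)" using x(2) by (simp add: norm_minus_commute)
        also have "\<dots> \<le> (t - r) * L" using L(2)[of x] x(1) r by (intro mult_left_mono) auto
        finally show ?thesis by (simp add: mult.commute)
      qed
      then show "F r \<le> (L * (t - r))\<^sup>2" unfolding F_def by (intro power_mono) auto
    qed
    also have "\<dots> = L\<^sup>2 * ((t - r) powr (b + 1) / Gamma b)"
    proof -
      have "(t - r) powr (b + 1) = (t - r) powr (b - 1) * (t - r)\<^sup>2"
        using r powr_add[of "t - r" "b - 1" 2] by (simp add: add.commute)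
      then show ?thesis using r by (simp add: kap_def power_mult_distrib)
    qed
    finally show ?thesis .
  qed
  have "J t \<le> 0"
  proof -
    have "continuous_on {0..t} J" unfolding J_def by (rule continuous_on_primitive[OF i])
    then have "(J \<longlongrightarrow> J t) (at t within {0..t})" using t by (simp add: continuous_on_def)
    then have "(J \<longlongrightarrow> J t) (at_left t)"
      by (rule filterlim_mono[OF _ order_refl])
        (use t0 in \<open>auto simp: at_within_Icc_at_left\<close>)
    moreover have "((\<lambda>r. (t - r) powr (b + 1)) \<longlongrightarrow> (t - t) powr (b + 1)) (at_left t)"
      by (rule tendsto_powr') (use b in \<open>auto intro!: tendsto_eq_intros eventually_at_leftI[of "t - 1"]\<close>)
    then have "((\<lambda>r. L\<^sup>2 * ((t - r) powr (b + 1) / Gamma b)) \<longlongrightarrow> L\<^sup>2 * ((t - t) powr (b + 1) / Gamma b)) (at_left t)"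
      using Gamma_real_pos[OF b(1)] by (intro tendsto_mult tendsto_divide tendsto_const) auto
    moreover have "\<forall>\<^sub>F r in at_left t. J r \<le> L\<^sup>2 * ((t - r) powr (b + 1) / Gamma b)"
      by (rule eventually_at_leftI[OF _ t0]) (use J_le in auto)
    ultimately have "J t \<le> L\<^sup>2 * ((t - t) powr (b + 1) / Gamma b)"
      by (intro tendsto_le[of "at_left t"]) auto
    then show ?thesis using b by simp
  qed
  have iV': "set_integrable lebesgue {0..t} (\<lambda>s. kap b (t - s) *\<^sub>R V' s)"
    using RL_integrable_continuous[OF b(1) V', of t] by simp
  have iVV: "set_integrable lebesgue {0..t} (\<lambda>s. kap b (t - s) * (2 * (V' s \<bullet> V s)))"
  proof -
    have "continuous_on {0..t} (\<lambda>s. 2 * (V' s \<bullet> V s))" by (intro continuous_intros cV V')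
    from RL_integrable_continuous[OF b(1) this, of t] show ?thesis by simp
  qed
  have iVt: "set_integrable lebesgue {0..t} (\<lambda>s. kap b (t - s) * (2 * (V' s \<bullet> V t)))"
  proof -
    have "continuous_on {0..t} (\<lambda>s. 2 * (V' s \<bullet> V t))" by (intro continuous_intros V')
    from RL_integrable_continuous[OF b(1) this, of t] show ?thesis by simp
  qed
  have e: "2 * (RL b V' t \<bullet> V t) = (LINT s:{0..t}|lebesgue. kap b (t - s) * (2 * (V' s \<bullet> V t)))"
  proof -
    have "RL b V' t \<bullet> V t = (LINT s|lebesgue. (indicator {0..t} s *\<^sub>R kap b (t - s) *\<^sub>R V' s) \<bullet> V t)"
      unfolding RL_def set_lebesgue_integral_def
      by (rule integral_inner_left[symmetric]) (use iV' in \<open>simp add: set_integrable_def\<close>)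
    then have "2 * (RL b V' t \<bullet> V t) = (LINT s|lebesgue. 2 * ((indicator {0..t} s *\<^sub>R kap b (t - s) *\<^sub>R V' s) \<bullet> V t))"
      by simp
    then show ?thesis by (simp add: set_lebesgue_integral_def ac_simps)
  qed
  have "RL b (\<lambda>s. 2 * (V' s \<bullet> V s)) t - 2 * (RL b V' t \<bullet> V t)
      = (LINT s:{0..t}|lebesgue. kap b (t - s) * (2 * (V' s \<bullet> V s)) - kap b (t - s) * (2 * (V' s \<bullet> V t)))"
    unfolding e unfolding RL_def using set_integral_diff(2)[OF iVV iVt] by simp
  also have "\<dots> = J t"
    unfolding J_def F'_def by (simp add: algebra_simps)
  finally show ?thesis using \<open>J t \<le> 0\<close> by simp
qed

text \<open>The increment of the squared norm is the integral of N' = 2 V' \<bullet> V, which splits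
  as I^\<alpha> applied to I^(1-\<alpha>) N'. Under the positive kernel of I^\<alpha> the inner
  factor is estimated by \<open>RL_inner_mono\<close> with b = 1 - \<alpha>.\<close>

lemma fractional_chain_C1:
  fixes V V' :: "real \<Rightarrow> 'a::{real_inner, banach, second_countable_topology}"
  assumes \<alpha>: "0 < \<alpha>" "\<alpha> < 1" and t: "0 \<le> t"
    and V: "\<And>s. s \<in> {0..t} \<Longrightarrow> (V has_vector_derivative V' s) (at s)" and V': "continuous_on {0..t} V'"
  shows "(norm (V t))\<^sup>2 - (norm (V 0))\<^sup>2 \<le> RL \<alpha> (\<lambda>s. 2 * (RL (1 - \<alpha>) V' s \<bullet> V s)) t"
proof -
  have cV: "continuous_on {0..t} V"
    using V by (meson continuous_at_imp_continuous_on has_vector_derivative_continuous)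
  define N' where "N' = (\<lambda>s. 2 * (V' s \<bullet> V s))"
  have cN': "continuous_on {0..t} N'" unfolding N'_def by (intro continuous_intros cV V')
  have N: "((\<lambda>s. (norm (V s))\<^sup>2) has_vector_derivative N' s) (at s)" if "s \<in> {0..t}" for s
  proof -
    have "((\<lambda>s. V s \<bullet> V s) has_derivative
        (\<lambda>h. V s \<bullet> (h *\<^sub>R V' s) + (h *\<^sub>R V' s) \<bullet> V s)) (at s)"
      using V[OF that] unfolding has_vector_derivative_def
      by (auto intro!: derivative_eq_intros)
    then show ?thesis
      by (simp add: has_vector_derivative_def N'_def power2_norm_eq_inner inner_commute algebra_simps)
  qed
  have i: "set_integrable lebesgue {0..t} N'" by (rule set_integrable_continuous_Icc[OF cN'])
  have "(norm (V t))\<^sup>2 - (norm (V 0))\<^sup>2 = (LINT s|lborel. indicator {0..t} s *\<^sub>R N' s)"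
    by (rule integral_FTC_atLeastAtMost[symmetric])
       (use t N cN' in \<open>auto intro: has_vector_derivative_at_within\<close>)
  also have "\<dots> = (LINT s:{0..t}|lebesgue. N' s)"
    by (rule set_integral_continuous_lborel[OF cN', symmetric])
  also have "\<dots> = RL 1 N' t" by (rule RL_1[symmetric])
  also have "\<dots> = RL \<alpha> (RL (1 - \<alpha>) N') t"
    using RL_RL[of \<alpha> "1 - \<alpha>" t N'] \<alpha> i by simp
  also have "\<dots> \<le> RL \<alpha> (\<lambda>s. 2 * (RL (1 - \<alpha>) V' s \<bullet> V s)) t"
    unfolding RL_def[of \<alpha>]
  proof (rule set_integral_mono)
    show "set_integrable lebesgue {0..t} (\<lambda>s. kap \<alpha> (t - s) *\<^sub>R RL (1 - \<alpha>) N' s)"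
      using RL_RL_integrable[of \<alpha> "1 - \<alpha>" t N'] \<alpha> i by simp
    show "set_integrable lebesgue {0..t} (\<lambda>s. kap \<alpha> (t - s) *\<^sub>R (2 * (RL (1 - \<alpha>) V' s \<bullet> V s)))"
      by (rule RL_integrable_continuous[OF \<alpha>(1), of t])
         (use \<alpha> in \<open>auto intro!: continuous_intros cV RL_continuous_continuous[OF _ _ V']\<close>)
    fix s assume s: "s \<in> {0..t}"
    have "RL (1 - \<alpha>) N' s \<le> 2 * (RL (1 - \<alpha>) V' s \<bullet> V s)"
      unfolding N'_def by (rule RL_inner_mono)
        (use \<alpha> s V continuous_on_subset[OF V', of "{0..s}"] in auto)
    then show "kap \<alpha> (t - s) *\<^sub>R RL (1 - \<alpha>) N' s \<le> kap \<alpha> (t - s) *\<^sub>R (2 * (RL (1 - \<alpha>) V' s \<bullet> V s))"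
      by (simp add: mult_left_mono kap_nonneg \<alpha>)
  qed
  finally show ?thesis .
qed

text \<open>Translation invariance of a causal convolution. It relies on x vanishing on the negative
  axis and on a delay e \<ge> 0, which is the reason for averaging over the past.\<close>

lemma RL_shift:
  fixes x :: "real \<Rightarrow> 'a::{banach, second_countable_topology}"
  assumes x: "continuous_on UNIV x" and x0: "\<And>s. s < 0 \<Longrightarrow> x s = 0" and e: "0 \<le> e"
  shows "RL b (\<lambda>s. x (s - e)) t = RL b x (t - e)"
proof -
  have [measurable]: "x \<in> borel_measurable borel" by (rule borel_measurable_continuous_onI[OF x])
  have "RL b (\<lambda>s. x (s - e)) t = (LINT s|lborel. indicat_real {0..t} s *\<^sub>R kap b (t - s) *\<^sub>R x (s - e))"
    unfolding RL_def set_lebesgue_integral_def by (rule integral_completion) measurable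
  also have "\<dots> = (LINT s|lborel. indicat_real {0..t} (e + s) *\<^sub>R kap b (t - (e + s)) *\<^sub>R x s)"
    by (subst lborel_integral_real_affine[where c=1 and t=e]) simp_all
  also have "\<dots> = (LINT s|lborel. indicat_real {0..t - e} s *\<^sub>R kap b (t - e - s) *\<^sub>R x s)"
  proof (rule Bochner_Integration.integral_cong[OF refl])
    fix s
    show "indicat_real {0..t} (e + s) *\<^sub>R kap b (t - (e + s)) *\<^sub>R x s =
        indicat_real {0..t - e} s *\<^sub>R kap b (t - e - s) *\<^sub>R x s"
      using x0[of s] e by (cases "s < 0") (auto simp: indicator_def algebra_simps)
  qed
  also have "\<dots> = RL b x (t - e)"
    unfolding RL_def set_lebesgue_integral_def by (rule integral_completion[symmetric]) measurable
  finally show ?thesis .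
qed

lemma integral_near_const:
  fixes f :: "real \<Rightarrow> 'a::banach"
  assumes "a \<le> b" "continuous_on {a..b} f" "\<And>t. t \<in> {a..b} \<Longrightarrow> norm (f t - z) \<le> d"
  shows "norm (integral {a..b} f - (b - a) *\<^sub>R z) \<le> d * (b - a)"
proof -
  have "integral {a..b} f - (b - a) *\<^sub>R z = integral {a..b} (\<lambda>t. f t - z)"
    using assms by (subst integral_diff) (auto intro!: integrable_continuous_real)
  also have "norm \<dots> \<le> d * (b - a)"
    using assms by (intro integral_bound continuous_intros) auto
  finally show ?thesis .
qed

text \<open>The Steklov mean over \<open>[t - e, t]\<close> of the extension of \<open>v\<close> by its boundary values. It is
  \<open>C\<^sup>1\<close> and takes the initial value of \<open>v\<close>, and the time difference of \<open>v\<close> is its derivative, so that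
  Riemann-Liouville integrals of the derivative are difference quotients.\<close>

definition ext_Icc :: "real \<Rightarrow> (real \<Rightarrow> 'a) \<Rightarrow> real \<Rightarrow> 'a" where
  "ext_Icc S v s = v (max 0 (min S s))"

definition steklov :: "real \<Rightarrow> (real \<Rightarrow> 'a::banach) \<Rightarrow> real \<Rightarrow> real \<Rightarrow> 'a" where
  "steklov S v e t = (1 / e) *\<^sub>R integral {t - e..t} (ext_Icc S v)"

lemma continuous_on_ext_Icc:
  assumes "continuous_on {0..S} v" "0 \<le> S"
  shows "continuous_on A (ext_Icc S v)"
  unfolding ext_Icc_def
  by (rule continuous_on_compose2[OF assms(1)]) (use assms(2) in \<open>auto intro!: continuous_intros\<close>)

lemma ext_Icc_eq: "s \<in> {0..S} \<Longrightarrow> ext_Icc S v s = v s"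
  by (simp add: ext_Icc_def)

lemma steklov_deriv:
  fixes v :: "real \<Rightarrow> 'a::banach"
  assumes v: "continuous_on {0..S} v" "0 \<le> S" and e: "0 < e"
  shows "(steklov S v e has_vector_derivative (1 / e) *\<^sub>R (ext_Icc S v t - ext_Icc S v (t - e))) (at t)"
proof -
  define P where "P = (\<lambda>r. integral {t - e - 2..r} (ext_Icc S v))"
  have P: "(P has_vector_derivative ext_Icc S v r) (at r)" if "r \<in> {t - e - 2<..<t + e + 2}" for r
  proof -
    have "(P has_vector_derivative ext_Icc S v r) (at r within {t - e - 2..t + e + 2})"
      unfolding P_def
      by (rule integral_has_vector_derivative) (use continuous_on_ext_Icc[OF v] that in auto)
    moreover have "at r within {t - e - 2..t + e + 2} = at r"
      by (rule at_within_interior) (use that in simp)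
    ultimately show ?thesis by simp
  qed
  have Pe: "((\<lambda>r. P (r - e)) has_vector_derivative ext_Icc S v (t - e)) (at t)"
  proof -
    have "((P \<circ> (\<lambda>r. r - e)) has_vector_derivative 1 *\<^sub>R ext_Icc S v (t - e)) (at t)"
      by (rule vector_diff_chain_at)
         (use e in \<open>auto intro!: derivative_eq_intros P\<close>)
    then show ?thesis by (simp add: comp_def)
  qed
  have eq: "(1 / e) *\<^sub>R (P r - P (r - e)) = steklov S v e r" if "r \<in> {t - 1<..<t + 1}" for r
  proof -
    have "integral {t - e - 2..r - e} (ext_Icc S v) + integral {r - e..r} (ext_Icc S v)
        = integral {t - e - 2..r} (ext_Icc S v)"
      using that e
      by (intro Henstock_Kurzweil_Integration.integral_combine integrable_continuous_real
          continuous_on_ext_Icc[OF v]) auto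
    then have "P r - P (r - e) = integral {r - e..r} (ext_Icc S v)"
      by (simp add: P_def algebra_simps)
    then show ?thesis by (simp add: steklov_def)
  qed
  have "((\<lambda>r. (1 / e) *\<^sub>R (P r - P (r - e))) has_vector_derivative
      (1 / e) *\<^sub>R (ext_Icc S v t - ext_Icc S v (t - e))) (at t)"
    using P[of t] Pe e by (auto intro!: derivative_eq_intros)
  then show ?thesis
    by (rule has_vector_derivative_transform_within_open[of _ _ _ "{t - 1<..<t + 1}"]) (use eq in auto)
qed

lemma steklov_near:
  fixes v :: "real \<Rightarrow> 'a::banach"
  assumes v: "continuous_on {0..S} v" "0 \<le> S" and e: "0 < e"
    and d: "\<And>r. r \<in> {t - e..t} \<Longrightarrow> norm (ext_Icc S v r - z) \<le> d"
  shows "norm (steklov S v e t - z) \<le> d"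
proof -
  have "steklov S v e t - z = (1 / e) *\<^sub>R (integral {t - e..t} (ext_Icc S v) - e *\<^sub>R z)"
    using e by (simp add: steklov_def scaleR_diff_right)
  also have "norm \<dots> \<le> (1 / e) * (d * e)"
    using integral_near_const[of "t - e" t "ext_Icc S v" z d] e d continuous_on_ext_Icc[OF v]
    by (simp add: pos_divide_le_eq)
  finally show ?thesis using e by simp
qed

lemma steklov_0:
  fixes v :: "real \<Rightarrow> 'a::banach"
  assumes v: "continuous_on {0..S} v" "0 \<le> S" and e: "0 < e"
  shows "steklov S v e 0 = v 0"
proof -
  have "ext_Icc S v r = v 0" if "r \<le> 0" for r
    using that v(2) by (simp add: ext_Icc_def)
  then have "norm (steklov S v e 0 - v 0) \<le> 0" by (intro steklov_near[OF v e]) auto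
  then show ?thesis by simp
qed

text \<open>The mean is allowed to be taken at any s within e of t: after the exchange of integrals,
  means at all points of a window of length e enter. Since the mean at s looks back by e, arguments
  up to 2e away from t occur, hence the half in the choice of e0.\<close>

lemma steklov_tendsto:
  fixes v :: "real \<Rightarrow> 'a::banach"
  assumes v: "continuous_on {0..S} v" "0 \<le> S" and t: "t \<in> {0..S}" and d: "0 < d"
  shows "\<exists>e0>0. \<forall>e s. 0 < e \<longrightarrow> e < e0 \<longrightarrow> \<bar>s - t\<bar> \<le> e \<longrightarrow> norm (steklov S v e s - v t) \<le> d"
proof -
  have "isCont (ext_Icc S v) t"
    using continuous_on_ext_Icc[OF v, of UNIV] by (simp add: continuous_on_eq_continuous_at)
  then obtain e1 where e1: "0 < e1" "\<And>r. \<bar>r - t\<bar> < e1 \<Longrightarrow> norm (ext_Icc S v r - v t) < d"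
    using d t unfolding continuous_at_eps_delta
    by (auto simp: dist_norm ext_Icc_eq)
  show ?thesis
  proof (intro exI[of _ "e1 / 2"] conjI allI impI)
    fix e s assume e: "0 < e" "e < e1 / 2" "\<bar>s - t\<bar> \<le> e"
    show "norm (steklov S v e s - v t) \<le> d"
    proof (rule steklov_near[OF v e(1)])
      fix r assume "r \<in> {s - e..s}"
      then have "\<bar>r - t\<bar> < e1" using e by auto
      then show "norm (ext_Icc S v r - v t) \<le> d" using e1(2)[of r] by simp
    qed
  qed (use e1 in simp)
qed


text \<open>The derivative of the mean is a difference of translates, and the fractional integral
  commutes with the translation. Thus the assumption on v turns directly into increments of the
  primitive of h, and h itself need not be differentiated or evaluated pointwise.\<close>

lemma RL_steklov_deriv:
  fixes v h :: "real \<Rightarrow> 'a::{banach, second_countable_topology}"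
  assumes v: "continuous_on {0..S} v" and e: "0 < e" and b: "0 < b"
    and h: "\<And>t. t \<in> {0..S} \<Longrightarrow> RL b (\<lambda>s. v s - v 0) t = (LINT s:{0..t}|lebesgue. h s)"
    and t: "t \<in> {0..S}"
  shows "RL b (\<lambda>s. (1 / e) *\<^sub>R (ext_Icc S v s - ext_Icc S v (s - e))) t
    = (1 / e) *\<^sub>R ((LINT s:{0..t}|lebesgue. h s) - (LINT s:{0..t - e}|lebesgue. h s))"
proof -
  have S: "0 \<le> S" using t by auto
  \<comment> \<open>Subtracting v(0) leaves the difference of translates unchanged and makes the
    extension vanish on the negative axis, as \<open>RL_shift\<close> requires.\<close>
  define x where "x = (\<lambda>s. ext_Icc S v s - v 0)"
  have x: "continuous_on A x" for A unfolding x_def by (intro continuous_intros continuous_on_ext_Icc[OF v S])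
  have x0: "x s = 0" if "s < 0" for s using that S by (simp add: x_def ext_Icc_def)
  have xe: "continuous_on A (\<lambda>s. x (s - e))" for A
    by (rule continuous_on_compose2[OF x[of UNIV]]) (auto intro!: continuous_intros)
  have h': "RL b x r = (LINT s:{0..r}|lebesgue. h s)" if "r \<le> S" for r
  proof (cases "0 \<le> r")
    case True
    have "RL b x r = RL b (\<lambda>s. v s - v 0) r"
      by (rule RL_cong) (use that in \<open>auto simp: x_def ext_Icc_eq\<close>)
    then show ?thesis using h[of r] True that by simp
  qed (simp add: RL_def set_lebesgue_integral_def)
  have "RL b (\<lambda>s. (1 / e) *\<^sub>R (ext_Icc S v s - ext_Icc S v (s - e))) t
      = (LINT s:{0..t}|lebesgue. (1 / e) *\<^sub>R (kap b (t - s) *\<^sub>R x s - kap b (t - s) *\<^sub>R x (s - e)))"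
    unfolding RL_def set_lebesgue_integral_def
    by (rule Bochner_Integration.integral_cong) (auto simp: x_def algebra_simps)
  also have "\<dots> = (1 / e) *\<^sub>R (LINT s:{0..t}|lebesgue. kap b (t - s) *\<^sub>R x s - kap b (t - s) *\<^sub>R x (s - e))"
    by (rule set_integral_scaleR_right)
  also have "\<dots> = (1 / e) *\<^sub>R (RL b x t - RL b (\<lambda>s. x (s - e)) t)"
    unfolding RL_def
    by (subst set_integral_diff(2)) (use RL_integrable_continuous[OF b x] RL_integrable_continuous[OF b xe] in auto)
  also have "\<dots> = (1 / e) *\<^sub>R (RL b x t - RL b x (t - e))"
    using RL_shift[OF x x0, of e b t] e by simp
  finally show ?thesis using h'[of t] h'[of "t - e"] t e by simp
qed

text \<open>Fubini moves the averaging from the merely integrable \<open>h\<close> to the continuous factor, where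
  pointwise convergence is clear.\<close>

lemma RL_steklov_pairing_tendsto:
  fixes v h :: "real \<Rightarrow> 'a::{real_inner, banach, second_countable_topology}"
  assumes v: "continuous_on {0..S} v" and \<alpha>: "0 < \<alpha>" and h: "set_integrable lebesgue {0..S} h"
    and b: "0 \<le> b" "b \<le> S" and e: "\<And>n. 0 < e n" "e \<longlonglongrightarrow> 0"
  shows "(\<lambda>n. RL (\<alpha> + 1) (\<lambda>s. ((1 / e n) *\<^sub>R ((LINT r:{0..s}|lebesgue. h r) - (LINT r:{0..s - e n}|lebesgue. h r)))
      \<bullet> steklov S v (e n) s) b) \<longlonglongrightarrow> RL (\<alpha> + 1) (\<lambda>s. h s \<bullet> v s) b"
proof -
  have S: "0 \<le> S" using b by simp
  define q where "q = (\<lambda>s. indicator {0..S} s *\<^sub>R h s)"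
  have q: "integrable lebesgue q" using h by (simp add: q_def set_integrable_def)
  then have q_m: "q \<in> borel_measurable lebesgue" by simp
  have q_m2[measurable]: "(\<lambda>z. q (snd z)) \<in> borel_measurable (lebesgue \<Otimes>\<^sub>M lebesgue)"
    by (rule measurable_compose[OF measurable_snd q_m])
  obtain B where B: "0 \<le> B" "\<And>s. s \<in> {0..S} \<Longrightarrow> norm (v s) \<le> B"
    using continuous_on_Icc_norm_bounded[OF v] by blast
  have cV: "continuous_on A (steklov S v (e n))" for A n
    using steklov_deriv[OF v S e(1)]
    by (meson continuous_at_imp_continuous_on has_vector_derivative_continuous)
  have [measurable]: "steklov S v (e n) \<in> borel_measurable borel" for n
    by (rule borel_measurable_continuous_onI[OF cV])
  have VB: "norm (steklov S v (e n) s) \<le> B" for n s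
  proof -
    have "norm (steklov S v (e n) s - 0) \<le> B"
      by (rule steklov_near[OF v S e(1)]) (use B S in \<open>auto simp: ext_Icc_def\<close>)
    then show ?thesis by simp
  qed
  \<comment> \<open>The kernel of the exponent \<alpha> + 1 on [0, b] is bounded, by C below; this
    boundedness is what permits dominated convergence for integrable h.\<close>
  define k where "k = (\<lambda>s. indicator {0..b} s * kap (\<alpha> + 1) (b - s))"
  have [measurable]: "k \<in> borel_measurable borel" unfolding k_def by measurable
  define C where "C = b powr \<alpha> / Gamma (\<alpha> + 1)"
  have C: "0 \<le> k s" "k s \<le> C" for s
    using kap_le[of "\<alpha> + 1" "b - s" b] \<alpha> b
    by (auto simp: k_def C_def indicator_def kap_nonneg intro!: divide_nonneg_pos Gamma_real_pos)
  then have C0: "0 \<le> C" by (meson order_trans)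
  \<comment> \<open>The increment of the primitive of h at s is the integral of h over (s - e, s].
    Seen from a fixed r, the constraint says that s runs through [r, r + e), so the inner integral
    after the exchange is an average over this window.\<close>
  define c where "c = (\<lambda>n s r. (1 / e n) * (if s - e n < r \<and> r \<le> s then k s else 0))"
  define F where "F = (\<lambda>n s r. c n s r * (q r \<bullet> steklov S v (e n) s))"
  have F_m: "(case_prod (F n)) \<in> borel_measurable (lebesgue \<Otimes>\<^sub>M lebesgue)" for n
    unfolding F_def c_def split_beta by measurable
  have bd_int: "has_bochner_integral lebesgue (\<lambda>s. (C * B / e n) * indicator {r..<r + e n} s) (C * B)" for n r
  proof -
    have "has_bochner_integral lebesgue (\<lambda>s. (C * B / e n) * indicator {r..<r + e n} s) ((C * B / e n) * measure lebesgue {r..<r + e n})"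
      using e(1)[of n] emeasure_lborel_Ico[of r "r + e n"]
      by (intro has_bochner_integral_mult_right has_bochner_integral_real_indicator) auto
    then show ?thesis using e(1)[of n] by simp
  qed
  have cB: "\<bar>c n s r\<bar> * norm (steklov S v (e n) s) \<le> (C * B / e n) * indicator {r..<r + e n} s" for n s r
  proof -
    have "\<bar>c n s r\<bar> * norm (steklov S v (e n) s) \<le> ((1 / e n) * (if s - e n < r \<and> r \<le> s then C else 0)) * B"
      using C[of s] e(1)[of n] VB B(1) by (intro mult_mono) (auto simp: c_def abs_mult divide_right_mono less_imp_le)
    then show ?thesis by (auto simp: indicator_def split: if_splits)
  qed
  have F_le: "norm (F n s r) \<le> (C * B / e n) * indicat_real {r..<r + e n} s * norm (q r)" for n s r
  proof -
    have "norm (F n s r) \<le> \<bar>c n s r\<bar> * (norm (q r) * norm (steklov S v (e n) s))"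
      unfolding F_def by (simp add: abs_mult mult_left_mono Cauchy_Schwarz_ineq2)
    also have "\<dots> = (\<bar>c n s r\<bar> * norm (steklov S v (e n) s)) * norm (q r)" by simp
    also have "\<dots> \<le> (C * B / e n) * indicat_real {r..<r + e n} s * norm (q r)"
      by (rule mult_right_mono[OF cB]) simp
    finally show ?thesis .
  qed
  have F_int: "integrable lebesgue (\<lambda>s. F n s r)" for n r
  proof (rule Bochner_Integration.integrable_bound)
    show "integrable lebesgue (\<lambda>s. ((C * B / e n) * indicator {r..<r + e n} s) * norm (q r))"
      using bd_int[of n r] by (intro integrable_mult_left) (auto simp: has_bochner_integral_iff)
    show "(\<lambda>s. F n s r) \<in> borel_measurable lebesgue"
      using measurable_compose[OF measurable_Pair2'[of r lebesgue lebesgue] F_m[of n]] by simp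
    show "AE s in lebesgue. norm (F n s r) \<le> norm (((C * B / e n) * indicator {r..<r + e n} s) * norm (q r))"
      by (rule AE_I2, rule order_trans[OF F_le]) (simp only: real_norm_def abs_ge_self)
  qed
  have intF: "integrable (lebesgue \<Otimes>\<^sub>M lebesgue) (case_prod (F n))" for n
  proof (rule integrable_pair_kernel[OF F_m])
    show "(\<lambda>(s, r). (C * B / e n) * indicat_real {r..<r + e n} s) \<in> borel_measurable (lebesgue \<Otimes>\<^sub>M lebesgue)"
      unfolding split_beta indicator_def of_bool_def atLeastLessThan_iff by measurable
    show "norm (F n s r) \<le> (C * B / e n) * indicat_real {r..<r + e n} s * norm (q r)" for s r
      by (rule F_le)
    show "0 \<le> (C * B / e n) * indicat_real {r..<r + e n} s" for s r
      using C0 B e(1)[of n] by simp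
    show "integrable lebesgue (\<lambda>s. norm (q s))" using q by simp
    fix r
    show "(\<integral>\<^sup>+ s. ennreal ((C * B / e n) * indicat_real {r..<r + e n} s) \<partial>lebesgue) \<le> ennreal (C * B)"
      using bd_int[of n r] C0 B e(1)[of n]
      by (subst nn_integral_eq_integral) (auto simp: has_bochner_integral_iff)
  qed simp
  have eq: "RL (\<alpha> + 1) (\<lambda>s. ((1 / e n) *\<^sub>R ((LINT r:{0..s}|lebesgue. h r) - (LINT r:{0..s - e n}|lebesgue. h r)))
      \<bullet> steklov S v (e n) s) b = (LINT r|lebesgue. LINT s|lebesgue. F n s r)" for n
  proof -
    have inner: "(LINT r|lebesgue. F n s r) = k s * (((1 / e n) *\<^sub>R ((LINT r:{0..s}|lebesgue. h r)
        - (LINT r:{0..s - e n}|lebesgue. h r))) \<bullet> steklov S v (e n) s)" if s: "s \<in> {0..b}" for s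
    proof -
      have hi: "set_integrable lebesgue {0..r} h" if "r \<le> S" for r
        by (rule set_integrable_subset[OF h]) (use that in auto)
      have "(LINT r:{0..s}|lebesgue. h r) - (LINT r:{0..s - e n}|lebesgue. h r)
          = (LINT r|lebesgue. (if s - e n < r \<and> r \<le> s then 1 else 0::real) *\<^sub>R q r)"
      proof -
        have "(LINT r:{0..s}|lebesgue. h r) - (LINT r:{0..s - e n}|lebesgue. h r)
          = (LINT r|lebesgue. indicator {0..s} r *\<^sub>R h r - indicator {0..s - e n} r *\<^sub>R h r)"
          unfolding set_lebesgue_integral_def
          using hi[of s] hi[of "s - e n"] s b e(1)[of n] by (subst Bochner_Integration.integral_diff) (auto simp: set_integrable_def)
        also have "\<dots> = (LINT r|lebesgue. (if s - e n < r \<and> r \<le> s then 1 else 0::real) *\<^sub>R q r)"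
          by (rule Bochner_Integration.integral_cong[OF refl])
             (use s b e(1)[of n] in \<open>auto simp: indicator_def q_def\<close>)
        finally show ?thesis .
      qed
      moreover have "integrable lebesgue (\<lambda>r. (if s - e n < r \<and> r \<le> s then 1 else 0::real) *\<^sub>R q r)"
      proof -
        have "integrable lebesgue (\<lambda>r. indicat_real {s - e n<..s} r *\<^sub>R q r)"
          by (rule integrable_mult_indicator[OF _ q]) simp
        then show ?thesis by (simp add: indicator_def of_bool_def)
      qed
      ultimately have "((LINT r:{0..s}|lebesgue. h r) - (LINT r:{0..s - e n}|lebesgue. h r)) \<bullet> steklov S v (e n) s
          = (LINT r|lebesgue. ((if s - e n < r \<and> r \<le> s then 1 else 0::real) *\<^sub>R q r) \<bullet> steklov S v (e n) s)"
        by (simp only: integral_inner_left)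
      moreover have "(LINT r|lebesgue. F n s r) = (LINT r|lebesgue. (k s / e n) *
          (((if s - e n < r \<and> r \<le> s then 1 else 0::real) *\<^sub>R q r) \<bullet> steklov S v (e n) s))"
        by (rule Bochner_Integration.integral_cong) (auto simp: F_def c_def)
      ultimately show ?thesis by simp
    qed
    have "RL (\<alpha> + 1) (\<lambda>s. ((1 / e n) *\<^sub>R ((LINT r:{0..s}|lebesgue. h r) - (LINT r:{0..s - e n}|lebesgue. h r)))
      \<bullet> steklov S v (e n) s) b = (LINT s|lebesgue. LINT r|lebesgue. F n s r)"
      unfolding RL_def set_lebesgue_integral_def[of _ "{0..b}"]
    proof (rule Bochner_Integration.integral_cong[OF refl])
      fix s
      show "indicat_real {0..b} s *\<^sub>R kap (\<alpha> + 1) (b - s) *\<^sub>R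
         (((1 / e n) *\<^sub>R ((LINT r:{0..s}|lebesgue. h r) - (LINT r:{0..s - e n}|lebesgue. h r))) \<bullet> steklov S v (e n) s)
         = (LINT r|lebesgue. F n s r)"
      proof (cases "s \<in> {0..b}")
        case True
        then show ?thesis using inner[OF True] by (simp add: k_def)
      next
        case False
        then have "F n s r = 0" for r by (simp add: F_def c_def k_def)
        then show ?thesis using False by simp
      qed
    qed
    also have "\<dots> = (LINT r|lebesgue. LINT s|lebesgue. F n s r)"
      by (rule leb_pair.Fubini_integral[symmetric, OF intF])
    finally show ?thesis .
  qed
  have "(\<lambda>n. LINT r|lebesgue. LINT s|lebesgue. F n s r) \<longlonglongrightarrow>
      (LINT r|lebesgue. k r * (q r \<bullet> v r))"
  proof (rule integral_dominated_convergence)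
    have vm: "(\<lambda>r. indicator {0..S} r *\<^sub>R v r) \<in> borel_measurable lebesgue"
      using set_borel_measurable_continuous_Icc[OF v] by (simp add: set_borel_measurable_def)
    have "(\<lambda>r. q r \<bullet> (indicator {0..S} r *\<^sub>R v r)) \<in> borel_measurable lebesgue"
      by (rule borel_measurable_inner[OF q_m vm])
    also have "(\<lambda>r. q r \<bullet> (indicator {0..S} r *\<^sub>R v r)) = (\<lambda>r. q r \<bullet> v r)"
      by (auto simp: q_def indicator_def)
    finally have qv: "(\<lambda>r. q r \<bullet> v r) \<in> borel_measurable lebesgue" .
    have "k \<in> borel_measurable lborel" by measurable
    then show "(\<lambda>r. k r * (q r \<bullet> v r)) \<in> borel_measurable lebesgue"
      by (rule borel_measurable_times[OF measurable_completion qv])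
    show "(\<lambda>r. LINT s|lebesgue. F n s r) \<in> borel_measurable lebesgue" for n
      using leb_pair.integrable_snd[OF intF] by (rule borel_measurable_integrable)
    show "integrable lebesgue (\<lambda>r. C * B * norm (q r))" using q by simp
    show "AE r in lebesgue. norm (LINT s|lebesgue. F n s r) \<le> C * B * norm (q r)" for n
    proof (rule AE_I2)
      fix r
      have i: "integrable lebesgue (\<lambda>s. ((C * B / e n) * indicator {r..<r + e n} s) * norm (q r))"
        using bd_int[of n r] by (intro integrable_mult_left) (auto simp: has_bochner_integral_iff)
      have le: "norm (F n s r) \<le> ((C * B / e n) * indicator {r..<r + e n} s) * norm (q r)" for s
        by (rule F_le)
      have "norm (LINT s|lebesgue. F n s r) \<le> (LINT s|lebesgue. ((C * B / e n) * indicator {r..<r + e n} s) * norm (q r))"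
        by (rule Bochner_Integration.integral_norm_bound_integral[OF F_int i le])
      also have "\<dots> = C * B * norm (q r)"
        by (rule has_bochner_integral_integral_eq[OF has_bochner_integral_mult_left[OF bd_int]])
      finally show "norm (LINT s|lebesgue. F n s r) \<le> C * B * norm (q r)" .
    qed
    have lim: "(\<lambda>n. LINT s|lebesgue. F n s r) \<longlonglongrightarrow> k r * (q r \<bullet> v r)" if r: "r \<noteq> b" for r
    proof (cases "0 \<le> r \<and> r < b")
      case False
      have "F n s r = 0" for n s
      proof (cases "r < 0")
        case True
        then show ?thesis by (simp add: F_def q_def)
      next
        case nn: False
        then have "b < r" using False r by simp
        then show ?thesis by (auto simp: F_def c_def k_def)
      qed
      moreover have z: "k r * (q r \<bullet> v r) = 0" using False r by (auto simp: k_def indicator_def)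
      ultimately show ?thesis unfolding z by simp
    next
      case True
      then have r: "0 \<le> r" "r < b" "r \<in> {0..S}" using b by auto
      show ?thesis
      proof (rule LIMSEQ_I)
        fix \<delta> :: real assume \<delta>: "0 < \<delta>"
        \<comment> \<open>Replacing k(s) by k(r) costs d times \<open>norm (q r)\<close> times B,
          and replacing the mean by v(r) costs C times \<open>norm (q r)\<close> times d. The
          summand 1 keeps m positive when the other term is zero.\<close>
        define m where "m = norm (q r) * (B + C) + 1"
        define d where "d = \<delta> / (2 * m)"
        have den: "0 < m" unfolding m_def using B C0 by (intro add_nonneg_pos mult_nonneg_nonneg) auto
        then have d0: "0 < d" using \<delta> unfolding d_def by (intro divide_pos_pos) auto
        have "m * d = \<delta> / 2" using den unfolding d_def by simp
        then have d: "0 < d" "norm (q r) * (B + C) * d < \<delta>"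
          using \<delta> d0 by (simp_all add: m_def distrib_right)
        obtain e0 where e0: "0 < e0" "\<And>e s. 0 < e \<Longrightarrow> e < e0 \<Longrightarrow> \<bar>s - r\<bar> \<le> e \<Longrightarrow> norm (steklov S v e s - v r) \<le> d"
          using steklov_tendsto[OF v S r(3) d(1)] by blast
        have "((\<lambda>s. (b - s) powr \<alpha> / Gamma (\<alpha> + 1)) \<longlongrightarrow> (b - r) powr \<alpha> / Gamma (\<alpha> + 1)) (at r)"
        proof -
          have "0 < Gamma (\<alpha> + 1)" by (rule Gamma_real_pos) (use \<alpha> in simp)
          then show ?thesis by (intro tendsto_intros) (use r in auto)
        qed
        then obtain e1 where e1: "0 < e1" "\<And>s. s \<noteq> r \<Longrightarrow> \<bar>s - r\<bar> < e1 \<Longrightarrow>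
            \<bar>(b - s) powr \<alpha> / Gamma (\<alpha> + 1) - (b - r) powr \<alpha> / Gamma (\<alpha> + 1)\<bar> < d"
          using d(1) by (fastforce simp: LIM_def dist_real_def)
        have kk: "k s = (b - s) powr \<alpha> / Gamma (\<alpha> + 1)" if "0 \<le> s" "s < b" for s
          using that by (simp add: k_def kap_def)
        have "\<forall>\<^sub>F n in sequentially. e n < min e0 (min e1 (b - r))"
          by (rule order_tendstoD(2)[OF e(2)]) (use e0 e1 r in auto)
        then obtain n0 where n0: "\<And>n. n \<ge> n0 \<Longrightarrow> e n < min e0 (min e1 (b - r))"
          by (auto simp: eventually_sequentially)
        show "\<exists>n0. \<forall>n\<ge>n0. norm ((LINT s|lebesgue. F n s r) - k r * (q r \<bullet> v r)) < \<delta>"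
        proof (intro exI allI impI)
          fix n assume "n0 \<le> n"
          then have en: "e n < e0" "e n < e1" "e n < b - r" using n0 by auto
          define z where "z = k r * (q r \<bullet> v r)"
          have iz: "has_bochner_integral lebesgue (\<lambda>s. (x / e n) * indicator {r..<r + e n} s) x" for x :: real
          proof -
            have "has_bochner_integral lebesgue (\<lambda>s. (x / e n) * indicator {r..<r + e n} s) ((x / e n) * measure lebesgue {r..<r + e n})"
              using e(1)[of n] emeasure_lborel_Ico[of r "r + e n"]
              by (intro has_bochner_integral_mult_right has_bochner_integral_real_indicator) auto
            then show ?thesis using e(1)[of n] by simp
          qed
          have "(LINT s|lebesgue. F n s r) - z = (LINT s|lebesgue. F n s r - (z / e n) * indicator {r..<r + e n} s)"
            using iz[of z] F_int by (simp add: has_bochner_integral_iff)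
          also have "norm \<dots> \<le> (LINT s|lebesgue. (norm (q r) * (B + C) * d / e n) * indicator {r..<r + e n} s)"
          proof (rule Bochner_Integration.integral_norm_bound_integral)
            show "integrable lebesgue (\<lambda>s. F n s r - (z / e n) * indicator {r..<r + e n} s)"
              using iz[of z] F_int by (simp add: has_bochner_integral_iff)
            show "integrable lebesgue (\<lambda>s. (norm (q r) * (B + C) * d / e n) * indicator {r..<r + e n} s)"
              using iz[of "norm (q r) * (B + C) * d"] by (simp add: has_bochner_integral_iff)
            fix s
            show "norm (F n s r - (z / e n) * indicator {r..<r + e n} s)
                \<le> (norm (q r) * (B + C) * d / e n) * indicator {r..<r + e n} s"
            proof (cases "s \<in> {r..<r + e n}")
              case s: True
              have V: "norm (steklov S v (e n) s - v r) \<le> d"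
                using e0(2)[of "e n" s] e(1)[of n] en s by auto
              have K: "\<bar>k s - k r\<bar> \<le> d"
                using e1(2)[of s] en s r d(1) by (cases "s = r") (auto simp: kk less_imp_le)
              have "F n s r - z / e n = (k s * (q r \<bullet> steklov S v (e n) s) - z) / e n"
                using s by (simp add: F_def c_def diff_divide_distrib)
              also have "k s * (q r \<bullet> steklov S v (e n) s) - z
                 = (k s - k r) * (q r \<bullet> steklov S v (e n) s) + k r * (q r \<bullet> (steklov S v (e n) s - v r))"
                by (simp add: z_def inner_diff_right algebra_simps)
              also have "\<bar>\<dots> / e n\<bar> \<le> (norm (q r) * (B + C) * d) / e n"
              proof -
                have "\<bar>(k s - k r) * (q r \<bullet> steklov S v (e n) s)\<bar> \<le> d * (norm (q r) * B)"
                  unfolding abs_mult using K VB[of n s]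
                  by (intro mult_mono) (auto intro!: order_trans[OF Cauchy_Schwarz_ineq2] mult_left_mono)
                moreover have "\<bar>k r * (q r \<bullet> (steklov S v (e n) s - v r))\<bar> \<le> C * (norm (q r) * d)"
                  unfolding abs_mult using C[of r] C0 V
                  by (intro mult_mono) (auto intro!: order_trans[OF Cauchy_Schwarz_ineq2] mult_left_mono)
                ultimately show ?thesis using e(1)[of n]
                  by (simp add: divide_right_mono algebra_simps abs_divide)
              qed
              finally show ?thesis using s by simp
            next
              case s: False
              then have "F n s r = 0" by (auto simp: F_def c_def)
              then show ?thesis using s by simp
            qed
          qed
          also have "\<dots> = norm (q r) * (B + C) * d"
            using iz[of "norm (q r) * (B + C) * d"] by (simp add: has_bochner_integral_iff)
          also have "\<dots> < \<delta>" by (rule d)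
          finally show "norm ((LINT s|lebesgue. F n s r) - k r * (q r \<bullet> v r)) < \<delta>" by (simp add: z_def)
        qed
      qed
    qed
    show "AE r in lebesgue. (\<lambda>n. LINT s|lebesgue. F n s r) \<longlonglongrightarrow> k r * (q r \<bullet> v r)"
      using AE_completion[OF AE_lborel_singleton[of b]] by (rule eventually_mono) (rule lim)
  qed
  also have "(LINT r|lebesgue. k r * (q r \<bullet> v r)) = RL (\<alpha> + 1) (\<lambda>s. h s \<bullet> v s) b"
    unfolding RL_def set_lebesgue_integral_def
    by (rule Bochner_Integration.integral_cong) (use b in \<open>auto simp: k_def q_def indicator_def\<close>)
  finally show ?thesis unfolding eq .
qed


text \<open>It says that |v|^2 - |v(0)|^2 - 2 I^\<alpha>(h \<bullet> v) has nonpositive integral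
  over [a, b]. The form with \<alpha> + 1 uses quantities that are defined at every time for
  integrable h and that converge along the Steklov means.\<close>

theorem fractional_chain_inequality:
  fixes v h :: "real \<Rightarrow> 'a::{real_inner, banach, second_countable_topology}"
  assumes \<alpha>: "0 < \<alpha>" "\<alpha> < 1" and v: "continuous_on {0..S} v" and h: "set_integrable lebesgue {0..S} h"
    and vh: "\<And>t. t \<in> {0..S} \<Longrightarrow> RL (1 - \<alpha>) (\<lambda>s. v s - v 0) t = (LINT s:{0..t}|lebesgue. h s)"
    and ab: "0 \<le> a" "a \<le> b" "b \<le> S"
  shows "RL 1 (\<lambda>s. (norm (v s))\<^sup>2 - (norm (v 0))\<^sup>2) b - 2 * RL (\<alpha> + 1) (\<lambda>s. h s \<bullet> v s) b
    \<le> RL 1 (\<lambda>s. (norm (v s))\<^sup>2 - (norm (v 0))\<^sup>2) a - 2 * RL (\<alpha> + 1) (\<lambda>s. h s \<bullet> v s) a"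
proof -
  have S: "0 \<le> S" using ab by simp
  define e where "e = (\<lambda>n. 1 / real (Suc n))"
  have e: "0 < e n" "e \<longlonglongrightarrow> 0" for n
    using LIMSEQ_inverse_real_of_nat by (auto simp: e_def inverse_eq_divide)
  define V where "V = (\<lambda>n. steklov S v (e n))"
  define V' where "V' = (\<lambda>n s. (1 / e n) *\<^sub>R (ext_Icc S v s - ext_Icc S v (s - e n)))"
  define H where "H = (\<lambda>n s. (1 / e n) *\<^sub>R ((LINT r:{0..s}|lebesgue. h r) - (LINT r:{0..s - e n}|lebesgue. h r)))"
  have V: "(V n has_vector_derivative V' n s) (at s)" for n s
    unfolding V_def V'_def by (rule steklov_deriv[OF v S e(1)])
  then have cV: "continuous_on A (V n)" for A n
    by (meson continuous_at_imp_continuous_on has_vector_derivative_continuous)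
  have cV': "continuous_on A (V' n)" for A n
    unfolding V'_def
    by (intro continuous_intros continuous_on_ext_Icc[OF v S]
        continuous_on_compose2[OF continuous_on_ext_Icc[OF v S, of UNIV]]) auto
  have V0: "V n 0 = v 0" for n unfolding V_def by (rule steklov_0[OF v S e(1)])
  have H: "RL (1 - \<alpha>) (V' n) t = H n t" if "t \<in> {0..S}" for n t
    unfolding V'_def H_def by (rule RL_steklov_deriv[OF v e(1) _ vh that]) (use \<alpha> in auto)
  obtain B where B: "0 \<le> B" "\<And>s. s \<in> {0..S} \<Longrightarrow> norm (v s) \<le> B"
    using continuous_on_Icc_norm_bounded[OF v] by blast
  have VB: "norm (V n s) \<le> B" for n s
  proof -
    have "norm (steklov S v (e n) s - 0) \<le> B"
      by (rule steklov_near[OF v S e(1)]) (use B S in \<open>auto simp: ext_Icc_def\<close>)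
    then show ?thesis by (simp add: V_def)
  qed
  have cH: "continuous_on {0..S} (\<lambda>s. RL (1 - \<alpha>) (V' n) s \<bullet> V n s)" for n
    by (intro continuous_intros cV RL_continuous_continuous[OF _ _ cV']) (use \<alpha> in auto)
  \<comment> \<open>The defect in the C^1 chain inequality of the n-th mean: continuous and
    nonpositive, so its primitive is nonincreasing, and this property survives the limit.\<close>
  define Y where "Y = (\<lambda>n s. (norm (V n s))\<^sup>2 - (norm (v 0))\<^sup>2 - 2 * RL \<alpha> (\<lambda>s. RL (1 - \<alpha>) (V' n) s \<bullet> V n s) s)"
  have Y: "Y n s \<le> 0" if "s \<in> {0..S}" for n s
  proof -
    have "(norm (V n s))\<^sup>2 - (norm (V n 0))\<^sup>2 \<le> RL \<alpha> (\<lambda>s. 2 * (RL (1 - \<alpha>) (V' n) s \<bullet> V n s)) s"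
      by (rule fractional_chain_C1) (use \<alpha> that V cV' in auto)
    also have "\<dots> = 2 * RL \<alpha> (\<lambda>s. RL (1 - \<alpha>) (V' n) s \<bullet> V n s) s"
      unfolding RL_def[of \<alpha>] set_lebesgue_integral_def by (simp add: algebra_simps)
    finally show ?thesis by (simp add: Y_def V0)
  qed
  have cY: "continuous_on {0..S} (Y n)" for n
    unfolding Y_def by (intro continuous_intros cV RL_continuous_continuous[OF _ _ cH]) (use \<alpha> in auto)
  have X_eq: "RL 1 (\<lambda>s. (norm (V n s))\<^sup>2 - (norm (v 0))\<^sup>2) t - 2 * RL (\<alpha> + 1) (\<lambda>s. H n s \<bullet> V n s) t
      = (LINT s:{0..t}|lebesgue. Y n s)" if t: "t \<in> {0..S}" for n t
  proof -
    have sub: "{0..t} \<subseteq> {0..S}" using t by auto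
    have "RL (\<alpha> + 1) (\<lambda>s. H n s \<bullet> V n s) t = RL (\<alpha> + 1) (\<lambda>s. RL (1 - \<alpha>) (V' n) s \<bullet> V n s) t"
      by (rule RL_cong) (use H t in auto)
    also have "\<dots> = RL 1 (RL \<alpha> (\<lambda>s. RL (1 - \<alpha>) (V' n) s \<bullet> V n s)) t"
      using RL_RL[of 1 \<alpha> t "\<lambda>s. RL (1 - \<alpha>) (V' n) s \<bullet> V n s"] \<alpha>
        set_integrable_continuous_Icc[OF continuous_on_subset[OF cH sub]] by (simp add: add.commute)
    finally have e: "RL (\<alpha> + 1) (\<lambda>s. H n s \<bullet> V n s) t
        = (LINT s:{0..t}|lebesgue. RL \<alpha> (\<lambda>s. RL (1 - \<alpha>) (V' n) s \<bullet> V n s) s)"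
      by (simp only: RL_1)
    have i1: "set_integrable lebesgue {0..t} (\<lambda>s. (norm (V n s))\<^sup>2 - (norm (v 0))\<^sup>2)"
      by (intro set_integrable_continuous_Icc continuous_intros cV)
    have i2: "set_integrable lebesgue {0..t} (\<lambda>s. 2 * RL \<alpha> (\<lambda>s. RL (1 - \<alpha>) (V' n) s \<bullet> V n s) s)"
      by (intro set_integrable_continuous_Icc continuous_intros continuous_on_subset[OF _ sub]
           RL_continuous_continuous[OF _ _ cH]) (use \<alpha> in auto)
    show ?thesis unfolding e RL_1 Y_def set_integral_diff(2)[OF i1 i2] by simp
  qed
  have Y_mono: "(LINT s:{0..b}|lebesgue. Y n s) \<le> (LINT s:{0..a}|lebesgue. Y n s)" for n
    unfolding set_lebesgue_integral_def
  proof (rule integral_mono)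
    show "integrable lebesgue (\<lambda>s. indicat_real {0..b} s *\<^sub>R Y n s)"
      "integrable lebesgue (\<lambda>s. indicat_real {0..a} s *\<^sub>R Y n s)"
      using set_integrable_continuous_Icc[OF continuous_on_subset[OF cY, of "{0..b}" n]]
        set_integrable_continuous_Icc[OF continuous_on_subset[OF cY, of "{0..a}" n]] ab
      by (auto simp: set_integrable_def)
    show "indicat_real {0..b} s *\<^sub>R Y n s \<le> indicat_real {0..a} s *\<^sub>R Y n s" for s
      using Y[of s n] ab by (auto simp: indicator_def)
  qed
  have lim1: "(\<lambda>n. RL 1 (\<lambda>s. (norm (V n s))\<^sup>2 - (norm (v 0))\<^sup>2) t) \<longlonglongrightarrow> RL 1 (\<lambda>s. (norm (v s))\<^sup>2 - (norm (v 0))\<^sup>2) t"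
    if t: "t \<in> {0..S}" for t
    unfolding RL_1 set_lebesgue_integral_def
  proof (rule integral_dominated_convergence)
    have "set_integrable lebesgue {0..t} (\<lambda>s. (norm (v s))\<^sup>2 - (norm (v 0))\<^sup>2)"
      by (intro set_integrable_continuous_Icc continuous_intros continuous_on_subset[OF v]) (use t in auto)
    then show "(\<lambda>s. indicat_real {0..t} s *\<^sub>R ((norm (v s))\<^sup>2 - (norm (v 0))\<^sup>2)) \<in> borel_measurable lebesgue"
      by (simp add: set_integrable_def borel_measurable_integrable)
    have "set_integrable lebesgue {0..t} (\<lambda>s. (norm (V n s))\<^sup>2 - (norm (v 0))\<^sup>2)" for n
      by (intro set_integrable_continuous_Icc continuous_intros cV)
    then show "(\<lambda>s. indicat_real {0..t} s *\<^sub>R ((norm (V n s))\<^sup>2 - (norm (v 0))\<^sup>2)) \<in> borel_measurable lebesgue" for n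
      by (simp add: set_integrable_def borel_measurable_integrable)
    have "set_integrable lebesgue {0..t} (\<lambda>s. 2 * B\<^sup>2)"
      by (intro set_integrable_continuous_Icc continuous_intros)
    then show "integrable lebesgue (\<lambda>s. indicat_real {0..t} s *\<^sub>R (2 * B\<^sup>2))"
      by (simp add: set_integrable_def)
    show "AE s in lebesgue. norm (indicat_real {0..t} s *\<^sub>R ((norm (V n s))\<^sup>2 - (norm (v 0))\<^sup>2))
        \<le> indicat_real {0..t} s *\<^sub>R (2 * B\<^sup>2)" for n
    proof (rule AE_I2)
      fix s
      have "(norm (V n s))\<^sup>2 \<le> B\<^sup>2" "(norm (v 0))\<^sup>2 \<le> B\<^sup>2"
        using VB[of n s] B(2)[of 0] S by (auto intro!: power_mono)
      moreover have "0 \<le> (norm (V n s))\<^sup>2" "0 \<le> (norm (v 0))\<^sup>2" by simp_all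
      ultimately have "\<bar>(norm (V n s))\<^sup>2 - (norm (v 0))\<^sup>2\<bar> \<le> 2 * B\<^sup>2" by linarith
      then show "norm (indicat_real {0..t} s *\<^sub>R ((norm (V n s))\<^sup>2 - (norm (v 0))\<^sup>2)) \<le> indicat_real {0..t} s *\<^sub>R (2 * B\<^sup>2)"
        by (simp add: indicator_def)
    qed
    have "(\<lambda>n. V n s) \<longlonglongrightarrow> v s" if s: "s \<in> {0..S}" for s
    proof (rule LIMSEQ_I)
      fix d :: real assume d: "0 < d"
      then obtain e0 where e0: "0 < e0" "\<And>e r. 0 < e \<Longrightarrow> e < e0 \<Longrightarrow> \<bar>r - s\<bar> \<le> e \<Longrightarrow> norm (steklov S v e r - v s) \<le> d / 2"
        using steklov_tendsto[OF v S s, of "d / 2"] by auto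
      have "\<forall>\<^sub>F n in sequentially. e n < e0" by (rule order_tendstoD(2)[OF e(2) e0(1)])
      then obtain n0 where n0: "\<And>n. n \<ge> n0 \<Longrightarrow> e n < e0" by (auto simp: eventually_sequentially)
      show "\<exists>n0. \<forall>n\<ge>n0. norm (V n s - v s) < d"
      proof (intro exI allI impI)
        fix n assume "n0 \<le> n"
        then have "norm (V n s - v s) \<le> d / 2"
          unfolding V_def using e0(2)[of "e n" s] n0 e(1)[of n] by simp
        then show "norm (V n s - v s) < d" using d by simp
      qed
    qed
    then have "(\<lambda>n. indicat_real {0..t} s *\<^sub>R ((norm (V n s))\<^sup>2 - (norm (v 0))\<^sup>2))
        \<longlonglongrightarrow> indicat_real {0..t} s *\<^sub>R ((norm (v s))\<^sup>2 - (norm (v 0))\<^sup>2)" for s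
      using t by (cases "s \<in> {0..t}") (auto intro!: tendsto_intros)
    then show "AE s in lebesgue. (\<lambda>n. indicat_real {0..t} s *\<^sub>R ((norm (V n s))\<^sup>2 - (norm (v 0))\<^sup>2))
        \<longlonglongrightarrow> indicat_real {0..t} s *\<^sub>R ((norm (v s))\<^sup>2 - (norm (v 0))\<^sup>2)"
      by (intro AE_I2)
  qed
  have lim: "(\<lambda>n. (LINT s:{0..t}|lebesgue. Y n s)) \<longlonglongrightarrow>
      RL 1 (\<lambda>s. (norm (v s))\<^sup>2 - (norm (v 0))\<^sup>2) t - 2 * RL (\<alpha> + 1) (\<lambda>s. h s \<bullet> v s) t"
    if t: "t \<in> {0..S}" for t
    unfolding X_eq[OF t, symmetric]
    using RL_steklov_pairing_tendsto[OF v \<alpha>(1) h _ _ e, of t] t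
    by (intro tendsto_intros lim1[OF t]) (simp add: H_def V_def)
  show ?thesis
    by (rule LIMSEQ_le[OF lim lim]) (use ab Y_mono in auto)
qed

section \<open>Energy solutions solve the inclusion almost everywhere\<close>

lemma countable_dense_subset:
  fixes S :: "'a::second_countable_topology set"
  obtains D where "countable D" "D \<subseteq> S" "S \<subseteq> closure D"
proof -
  obtain B :: "'a set set" where B: "countable B" "topological_basis B"
    using ex_countable_basis by blast
  define p where "p = (\<lambda>b. SOME x. x \<in> b \<inter> S)"
  have p: "p b \<in> b \<inter> S" if "b \<inter> S \<noteq> {}" for b
    unfolding p_def by (rule someI_ex) (use that in blast)
  define D where "D = p ` {b \<in> B. b \<inter> S \<noteq> {}}"
  have "countable D" unfolding D_def by (rule countable_image, rule countable_subset[OF _ B(1)]) auto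
  moreover have "D \<subseteq> S" using p by (auto simp: D_def)
  moreover have "S \<subseteq> closure D"
  proof
    fix x assume x: "x \<in> S"
    show "x \<in> closure D"
      unfolding closure_iff_nhds_not_empty
    proof (intro allI impI)
      fix A U assume "x \<in> U" "U \<subseteq> A" "open U"
      then obtain b where b: "b \<in> B" "x \<in> b" "b \<subseteq> U"
        using topological_basisE[OF B(2)] by metis
      then have "b \<inter> S \<noteq> {}" using x by auto
      then have "p b \<in> D" "p b \<in> A" using b p \<open>U \<subseteq> A\<close> by (auto simp: D_def)
      then show "D \<inter> A \<noteq> {}" by auto
    qed
  qed
  ultimately show ?thesis using that by blast
qed

lemma lower_semicont_measurable:
  fixes \<Phi> :: "'a::topological_space \<Rightarrow> ereal"
  assumes "lower_semicont \<Phi>"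
  shows "\<Phi> \<in> borel_measurable borel"
proof (rule borel_measurableI_greater)
  fix y
  have "open {x. y < \<Phi> x}"
  proof (subst open_subopen, intro ballI)
    fix x assume x: "x \<in> {x. y < \<Phi> x}"
    then have "y < Liminf (at x) \<Phi>"
      using assms by (auto simp: lower_semicont_def intro: less_le_trans)
    then have "\<forall>\<^sub>F z in at x. y < \<Phi> z" by (rule less_LiminfD)
    then obtain S where S: "open S" "x \<in> S" "\<And>z. z \<in> S \<Longrightarrow> z \<noteq> x \<Longrightarrow> y < \<Phi> z"
      unfolding eventually_at_topological by blast
    show "\<exists>T. open T \<and> x \<in> T \<and> T \<subseteq> {x. y < \<Phi> x}"
      by (rule exI[of _ S]) (use S x in auto)
  qed
  then show "{x \<in> space borel. y < \<Phi> x} \<in> sets borel" by simp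
qed

lemma L2_space_iff:
  "w \<in> L2_space T \<longleftrightarrow> set_borel_measurable lebesgue {0<..<T} w \<and> set_integrable lebesgue {0<..<T} (\<lambda>t. (norm (w t))\<^sup>2)"
proof -
  have m: "w \<in> borel_measurable (lebesgue_on {0<..<T}) \<longleftrightarrow> set_borel_measurable lebesgue {0<..<T} w"
    by (simp add: borel_measurable_restrict_space_iff set_borel_measurable_def)
  have "(\<integral>\<^sup>+ s\<in>{0<..<T}. ennreal ((norm (w s))\<^sup>2) \<partial>lebesgue) < top
      \<longleftrightarrow> set_integrable lebesgue {0<..<T} (\<lambda>t. (norm (w t))\<^sup>2)" if w: "set_borel_measurable lebesgue {0<..<T} w"
  proof -
    have "(\<lambda>s. (norm (indicator {0<..<T} s *\<^sub>R w s))\<^sup>2) \<in> borel_measurable lebesgue"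
      using w unfolding set_borel_measurable_def by measurable
    also have "(\<lambda>s. (norm (indicator {0<..<T} s *\<^sub>R w s))\<^sup>2) = (\<lambda>s. indicator {0<..<T} s *\<^sub>R (norm (w s))\<^sup>2)"
      by (auto simp: indicator_def)
    finally have *: "(\<lambda>s. indicator {0<..<T} s *\<^sub>R (norm (w s))\<^sup>2) \<in> borel_measurable lebesgue" .
    have "(\<integral>\<^sup>+ s\<in>{0<..<T}. ennreal ((norm (w s))\<^sup>2) \<partial>lebesgue)
        = (\<integral>\<^sup>+ s. ennreal (norm (indicator {0<..<T} s *\<^sub>R (norm (w s))\<^sup>2)) \<partial>lebesgue)"
      by (intro nn_integral_cong) (auto simp: indicator_def)
    then show ?thesis
      using * by (simp add: set_integrable_def integrable_iff_bounded del: scaleR_conv_of_real real_scaleR_def)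
  qed
  with m show ?thesis by (auto simp: L2_space_def)
qed

lemma L2_inner_integrable:
  fixes a b :: "real \<Rightarrow> 'a::{real_inner, second_countable_topology}"
  assumes "a \<in> L2_space T" "b \<in> L2_space T"
  shows "set_integrable lebesgue {0<..<T} (\<lambda>t. a t \<bullet> b t)"
  unfolding set_integrable_def
proof (rule Bochner_Integration.integrable_bound)
  show "integrable lebesgue (\<lambda>t. indicator {0<..<T} t *\<^sub>R (norm (a t))\<^sup>2 + indicator {0<..<T} t *\<^sub>R (norm (b t))\<^sup>2)"
    using assms by (intro Bochner_Integration.integrable_add) (auto simp: L2_space_iff set_integrable_def)
  have "(\<lambda>t. (indicator {0<..<T} t *\<^sub>R a t) \<bullet> (indicator {0<..<T} t *\<^sub>R b t)) \<in> borel_measurable lebesgue"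
    using assms by (intro borel_measurable_inner) (auto simp: L2_space_iff set_borel_measurable_def)
  also have "(\<lambda>t. (indicator {0<..<T} t *\<^sub>R a t) \<bullet> (indicator {0<..<T} t *\<^sub>R b t)) = (\<lambda>t. indicator {0<..<T} t *\<^sub>R (a t \<bullet> b t))"
    by (auto simp: indicator_def)
  finally show "(\<lambda>t. indicator {0<..<T} t *\<^sub>R (a t \<bullet> b t)) \<in> borel_measurable lebesgue" .
  have "\<bar>x \<bullet> y\<bar> \<le> (norm x)\<^sup>2 + (norm y)\<^sup>2" for x y :: 'a
  proof -
    have "\<bar>x \<bullet> y\<bar> \<le> norm x * norm y" by (rule Cauchy_Schwarz_ineq2)
    also have "\<dots> \<le> (norm x)\<^sup>2 + (norm y)\<^sup>2"
    proof -
      have "0 \<le> norm x * norm y" by simp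
      then show ?thesis using sum_squares_bound[of "norm x" "norm y"] by linarith
    qed
    finally show ?thesis .
  qed
  then show "AE t in lebesgue. norm (indicator {0<..<T} t *\<^sub>R (a t \<bullet> b t))
      \<le> norm (indicator {0<..<T} t *\<^sub>R (norm (a t))\<^sup>2 + indicator {0<..<T} t *\<^sub>R (norm (b t))\<^sup>2)"
    by (intro AE_I2) (auto simp: indicator_def intro: order_trans[OF _ abs_ge_self])
qed

lemma L2_diff:
  fixes a b :: "real \<Rightarrow> 'a::{real_inner, second_countable_topology}"
  assumes "a \<in> L2_space T" "b \<in> L2_space T"
  shows "(\<lambda>t. a t - b t) \<in> L2_space T"
  unfolding L2_space_iff
proof
  have "(\<lambda>t. (indicator {0<..<T} t *\<^sub>R a t) - (indicator {0<..<T} t *\<^sub>R b t)) \<in> borel_measurable lebesgue"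
    using assms by (intro borel_measurable_diff) (auto simp: L2_space_iff set_borel_measurable_def)
  then show "set_borel_measurable lebesgue {0<..<T} (\<lambda>t. a t - b t)"
    by (simp add: set_borel_measurable_def scaleR_diff_right)
  have "set_integrable lebesgue {0<..<T} (\<lambda>t. (norm (a t))\<^sup>2 - 2 * (a t \<bullet> b t) + (norm (b t))\<^sup>2)"
    using assms L2_inner_integrable[OF assms] by (auto simp: L2_space_iff)
  then show "set_integrable lebesgue {0<..<T} (\<lambda>t. (norm (a t - b t))\<^sup>2)"
    by (simp add: power2_norm_eq_inner inner_diff_left inner_diff_right inner_commute algebra_simps)
qed

lemma L2_piecewise_const:
  fixes u :: "real \<Rightarrow> 'a::{real_inner, second_countable_topology}"
  assumes u: "u \<in> L2_space T" and A: "A \<in> sets lebesgue"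
  shows "(\<lambda>t. if t \<in> A then z else u t) \<in> L2_space T"
  unfolding L2_space_iff
proof
  have um: "(\<lambda>t. indicator {0<..<T} t *\<^sub>R u t) \<in> borel_measurable lebesgue"
    using u by (simp add: L2_space_iff set_borel_measurable_def)
  have "(\<lambda>t. if t \<in> A then indicator {0<..<T} t *\<^sub>R z else indicator {0<..<T} t *\<^sub>R u t) \<in> borel_measurable lebesgue"
    using A by (intro measurable_If_set um) (auto intro!: borel_measurable_scaleR borel_measurable_indicator)
  also have "(\<lambda>t. if t \<in> A then indicator {0<..<T} t *\<^sub>R z else indicator {0<..<T} t *\<^sub>R u t)
      = (\<lambda>t. indicator {0<..<T} t *\<^sub>R (if t \<in> A then z else u t))" by auto
  finally show m: "set_borel_measurable lebesgue {0<..<T} (\<lambda>t. if t \<in> A then z else u t)"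
    by (simp add: set_borel_measurable_def)
  show "set_integrable lebesgue {0<..<T} (\<lambda>t. (norm (if t \<in> A then z else u t))\<^sup>2)"
    unfolding set_integrable_def
  proof (rule Bochner_Integration.integrable_bound)
    have "set_integrable lebesgue {0<..<T} (\<lambda>t. (norm z)\<^sup>2)"
      by (rule set_integrable_subset[OF set_integrable_continuous_Icc[of 0 T]]) (auto intro!: continuous_intros)
    then show "integrable lebesgue (\<lambda>t. indicator {0<..<T} t *\<^sub>R (norm z)\<^sup>2 + indicator {0<..<T} t *\<^sub>R (norm (u t))\<^sup>2)"
      using u by (intro Bochner_Integration.integrable_add) (auto simp: L2_space_iff set_integrable_def)
    have "(\<lambda>t. (norm (indicator {0<..<T} t *\<^sub>R (if t \<in> A then z else u t)))\<^sup>2) \<in> borel_measurable lebesgue"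
      using m unfolding set_borel_measurable_def by measurable
    also have "(\<lambda>t. (norm (indicator {0<..<T} t *\<^sub>R (if t \<in> A then z else u t)))\<^sup>2)
        = (\<lambda>t. indicator {0<..<T} t *\<^sub>R (norm (if t \<in> A then z else u t))\<^sup>2)"
      by (auto simp: indicator_def)
    finally show "(\<lambda>t. indicator {0<..<T} t *\<^sub>R (norm (if t \<in> A then z else u t))\<^sup>2) \<in> borel_measurable lebesgue" .
  qed (auto simp: indicator_def intro!: AE_I2)
qed

lemma ext_integral_eq_integral:
  assumes q: "AE t in lebesgue. t \<in> {0<..<T} \<longrightarrow> q t = ereal (r t)"
    and r: "set_integrable lebesgue {0<..<T} r"
  shows "ext_integral T q = ereal (LINT t:{0<..<T}|lebesgue. r t)"
proof -
  define R where "R = (\<lambda>t. indicator {0<..<T} t *\<^sub>R r t)"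
  have R: "integrable lebesgue R" using r by (simp add: R_def set_integrable_def)
  have "(\<integral>\<^sup>+ t\<in>{0<..<T}. e2ennreal (q t) \<partial>lebesgue) = (\<integral>\<^sup>+ t. ennreal (R t) \<partial>lebesgue)"
    by (rule nn_integral_cong_AE) (use q in \<open>eventually_elim, auto simp: R_def indicator_def\<close>)
  moreover have "(\<integral>\<^sup>+ t\<in>{0<..<T}. e2ennreal (- q t) \<partial>lebesgue) = (\<integral>\<^sup>+ t. ennreal (- R t) \<partial>lebesgue)"
    by (rule nn_integral_cong_AE) (use q in \<open>eventually_elim, auto simp: R_def indicator_def\<close>)
  moreover have "(\<integral>\<^sup>+ t. ennreal (R t) \<partial>lebesgue) < \<infinity>" "(\<integral>\<^sup>+ t. ennreal (- R t) \<partial>lebesgue) < \<infinity>"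
    using R by (auto simp: real_integrable_def less_top)
  moreover have fin: "enn2ereal x = ereal (enn2real x)" if "x < \<infinity>" for x
    using that by (cases x) auto
  ultimately show ?thesis
    unfolding ext_integral_def set_lebesgue_integral_def R_def[symmetric]
    by (simp add: real_lebesgue_integral_def[OF R] fin)
qed

text \<open>On a bounded interval the lower bound c makes the integral of the negative part finite.
  Finiteness of the difference then forces that of the positive part, without any ambiguity of the
  form infinity minus infinity.\<close>

lemma ext_integral_finite:
  assumes T: "0 < T" and q: "(\<lambda>t. indicator {0<..<T} t * q t) \<in> borel_measurable lebesgue"
    and c: "\<And>t. ereal c \<le> q t" and fin: "ext_integral T q < \<infinity>"
  shows "AE t in lebesgue. t \<in> {0<..<T} \<longrightarrow> q t \<noteq> \<infinity>"
    and "set_integrable lebesgue {0<..<T} (\<lambda>t. real_of_ereal (q t))"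
proof -
  define I where "I = (\<integral>\<^sup>+ t\<in>{0<..<T}. e2ennreal (q t) \<partial>lebesgue)"
  define J where "J = (\<integral>\<^sup>+ t\<in>{0<..<T}. e2ennreal (- q t) \<partial>lebesgue)"
  have "J \<le> (\<integral>\<^sup>+ t. ennreal \<bar>c\<bar> * indicator {0<..<T} t \<partial>lebesgue)"
    unfolding J_def
  proof (rule nn_integral_mono)
    fix t
    have "- q t \<le> ereal \<bar>c\<bar>" using c[of t] by (cases "q t") auto
    then have "e2ennreal (- q t) \<le> ennreal \<bar>c\<bar>" using e2ennreal_mono by fastforce
    then show "e2ennreal (- q t) * indicator {0<..<T} t \<le> ennreal \<bar>c\<bar> * indicator {0<..<T} t"
      by (rule mult_right_mono) simp
  qed
  also have "\<dots> < \<infinity>" using T by (simp add: nn_integral_cmult_indicator ennreal_mult_less_top)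
  finally have J: "J < \<infinity>" .
  then have "enn2ereal J \<noteq> \<infinity>" by (simp add: less_top)
  then have "enn2ereal I \<noteq> \<infinity>"
    using fin unfolding ext_integral_def I_def[symmetric] J_def[symmetric]
    by (cases "enn2ereal J"; cases "enn2ereal I") simp_all
  then have I: "I < \<infinity>" by (simp add: less_top)
  have qm: "(\<lambda>t. e2ennreal (q t) * indicator {0<..<T} t) \<in> borel_measurable lebesgue"
  proof -
    have "(\<lambda>t. e2ennreal (indicator {0<..<T} t * q t)) \<in> borel_measurable lebesgue"
      using q by measurable
    also have "(\<lambda>t. e2ennreal (indicator {0<..<T} t * q t)) = (\<lambda>t. e2ennreal (q t) * indicator {0<..<T} t)"
      by (rule ext) (simp add: indicator_def e2ennreal_neg)
    finally show ?thesis .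
  qed
  have "AE t in lebesgue. e2ennreal (q t) * indicator {0<..<T} t \<noteq> \<infinity>"
    by (rule nn_integral_PInf_AE[OF qm]) (use I in \<open>simp add: I_def\<close>)
  then show "AE t in lebesgue. t \<in> {0<..<T} \<longrightarrow> q t \<noteq> \<infinity>"
    by eventually_elim auto
  show "set_integrable lebesgue {0<..<T} (\<lambda>t. real_of_ereal (q t))"
    unfolding set_integrable_def
  proof (rule integrableI_bounded)
    have "(\<lambda>t. real_of_ereal (indicator {0<..<T} t * q t)) \<in> borel_measurable lebesgue"
      using q by measurable
    also have "(\<lambda>t. real_of_ereal (indicator {0<..<T} t * q t)) = (\<lambda>t. indicator {0<..<T} t *\<^sub>R real_of_ereal (q t))"
      by (auto simp: indicator_def)
    finally show "(\<lambda>t. indicator {0<..<T} t *\<^sub>R real_of_ereal (q t)) \<in> borel_measurable lebesgue" .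
    have "(\<integral>\<^sup>+ t. ennreal (norm (indicator {0<..<T} t *\<^sub>R real_of_ereal (q t))) \<partial>lebesgue)
        \<le> (\<integral>\<^sup>+ t. e2ennreal (q t) * indicator {0<..<T} t + ennreal \<bar>c\<bar> * indicator {0<..<T} t \<partial>lebesgue)"
    proof (rule nn_integral_mono)
      fix t
      show "ennreal (norm (indicator {0<..<T} t *\<^sub>R real_of_ereal (q t)))
          \<le> e2ennreal (q t) * indicator {0<..<T} t + ennreal \<bar>c\<bar> * indicator {0<..<T} t"
      proof (cases "q t")
        case (real r)
        then have "c \<le> r" using c[of t] by simp
        then have "\<bar>r\<bar> \<le> max 0 r + \<bar>c\<bar>" by linarith
        then have "ennreal \<bar>r\<bar> \<le> ennreal (max 0 r) + ennreal \<bar>c\<bar>"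
          using ennreal_leI[of "\<bar>r\<bar>" "max 0 r + \<bar>c\<bar>"] by (simp only: ennreal_plus[of "max 0 r" "\<bar>c\<bar>"] max.cobounded1 abs_ge_zero)
        then show ?thesis using real by (simp add: indicator_def ennreal_max_0)
      next
        case MInf
        then show ?thesis using c[of t] by simp
      qed (simp add: indicator_def)
    qed
    also have "\<dots> = I + (\<integral>\<^sup>+ t. ennreal \<bar>c\<bar> * indicator {0<..<T} t \<partial>lebesgue)"
      unfolding I_def
      by (rule nn_integral_add[OF qm]) (intro measurable_completion, measurable)
    also have "\<dots> < \<infinity>" using I T by (simp add: nn_integral_cmult_indicator ennreal_mult_less_top)
    finally show "(\<integral>\<^sup>+ t. ennreal (norm (indicator {0<..<T} t *\<^sub>R real_of_ereal (q t))) \<partial>lebesgue) < \<infinity>" .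
  qed
qed


lemma subdiff_dom:
  assumes "\<xi> \<in> subdiff \<Phi> w" "z \<in> effdom \<Phi>" "\<And>v. ereal c \<le> \<Phi> v"
  shows "\<Phi> w < \<infinity>"
proof -
  have "ereal (\<xi> \<bullet> (z - w)) \<le> \<Phi> z - \<Phi> w" using assms(1) by (simp add: subdiff_def)
  then show ?thesis
    using assms(2) assms(3)[of z] by (cases "\<Phi> w"; cases "\<Phi> z") (auto simp: effdom_def)
qed

text \<open>The variational inequality is localised by testing with \<open>u\<close> off and \<open>z\<close> on a measurable set. The
  exceptional null set is made independent of \<open>z\<close> by a countable dense subset of the graph of \<open>\<Phi>\<close>
  (not of its domain, since \<open>\<Phi>\<close> is only lower semicontinuous).\<close>

lemma energy_solution_subdiff:
  fixes \<Phi> :: "'a::{real_inner, banach, second_countable_topology} \<Rightarrow> ereal"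
  assumes T: "0 < T" and lsc: "lower_semicont \<Phi>" and c: "\<And>w. ereal c \<le> \<Phi> w"
    and u0: "u0 \<in> effdom \<Phi>" and f: "f \<in> L2_space T" and sol: "energy_solution \<alpha> T \<Phi> f u0 u"
  defines "g \<equiv> caputo_deriv \<alpha> T u0 u"
  shows "AE t in lebesgue. t \<in> {0<..<T} \<longrightarrow> f t - g t \<in> subdiff \<Phi> (u t)"
proof -
  have u: "u \<in> L2_space T" and g: "g \<in> L2_space T"
    and VI: "\<And>w. w \<in> L2_space T \<Longrightarrow>
        ereal (LINT t:{0<..<T}|lebesgue. g t \<bullet> (u t - w t)) + ext_integral T (\<lambda>t. \<Phi> (u t))
        \<le> ereal (LINT t:{0<..<T}|lebesgue. f t \<bullet> (u t - w t)) + ext_integral T (\<lambda>t. \<Phi> (w t))"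
    using sol by (auto simp: energy_solution_def g_def)
  have \<Phi>m: "\<Phi> \<in> borel_measurable borel" by (rule lower_semicont_measurable[OF lsc])
  define \<phi> where "\<phi> = (\<lambda>w. real_of_ereal (\<Phi> w))"
  have fin: "\<Phi> w = ereal (\<phi> w)" if "\<Phi> w \<noteq> \<infinity>" for w
    using that c[of w] by (cases "\<Phi> w") (auto simp: \<phi>_def)
  have const: "set_integrable lebesgue {0<..<T} (\<lambda>t. x)" for x :: real
    by (rule set_integrable_subset[OF set_integrable_continuous_Icc[of 0 T]]) (auto intro!: continuous_intros)
  \<comment> \<open>The constant function u0 has finite energy; as a competitor it shows that the
    energy of u has finite integral.\<close>
  have fin_u: "ext_integral T (\<lambda>t. \<Phi> (u t)) < \<infinity>"
  proof -
    have "(\<lambda>t. if t \<in> UNIV then u0 else u t) \<in> L2_space T" by (rule L2_piecewise_const[OF u]) simp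
    then have "(\<lambda>t. u0) \<in> L2_space T" by simp
    moreover have "ext_integral T (\<lambda>t. \<Phi> u0) = ereal (LINT t:{0<..<T}|lebesgue. \<phi> u0)"
      by (rule ext_integral_eq_integral[OF _ const]) (use u0 fin[of u0] in \<open>auto simp: effdom_def\<close>)
    ultimately have "ereal (LINT t:{0<..<T}|lebesgue. g t \<bullet> (u t - u0)) + ext_integral T (\<lambda>t. \<Phi> (u t)) < \<infinity>"
      using VI[of "\<lambda>t. u0"] by (auto intro: le_less_trans)
    then show ?thesis by (cases "ext_integral T (\<lambda>t. \<Phi> (u t))") auto
  qed
  have \<Phi>um: "(\<lambda>t. indicator {0<..<T} t * \<Phi> (u t)) \<in> borel_measurable lebesgue"
  proof -
    have "(\<lambda>t. indicator {0<..<T} t *\<^sub>R u t) \<in> borel_measurable lebesgue"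
      using u by (simp add: L2_space_iff set_borel_measurable_def)
    then have "(\<lambda>t. \<Phi> (indicator {0<..<T} t *\<^sub>R u t)) \<in> borel_measurable lebesgue"
      by (rule measurable_compose) (rule \<Phi>m)
    then have "(\<lambda>t. indicator {0<..<T} t * \<Phi> (indicator {0<..<T} t *\<^sub>R u t)) \<in> borel_measurable lebesgue"
      by (intro borel_measurable_ereal_times borel_measurable_indicator) auto
    also have "(\<lambda>t. indicator {0<..<T} t * \<Phi> (indicator {0<..<T} t *\<^sub>R u t)) = (\<lambda>t. indicator {0<..<T} t * \<Phi> (u t))"
      by (auto simp: indicator_def)
    finally show ?thesis .
  qed
  have u_fin: "AE t in lebesgue. t \<in> {0<..<T} \<longrightarrow> \<Phi> (u t) \<noteq> \<infinity>"
    and \<phi>u: "set_integrable lebesgue {0<..<T} (\<lambda>t. \<phi> (u t))"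
    using ext_integral_finite[OF T \<Phi>um c fin_u] unfolding \<phi>_def by auto
  have ext_u: "ext_integral T (\<lambda>t. \<Phi> (u t)) = ereal (LINT t:{0<..<T}|lebesgue. \<phi> (u t))"
    by (rule ext_integral_eq_integral[OF eventually_mono[OF u_fin] \<phi>u]) (use fin in auto)
  have VI_z: "AE t in lebesgue. t \<in> {0<..<T} \<longrightarrow> \<phi> (u t) + (g t - f t) \<bullet> (u t - z) \<le> \<phi> z"
    if z: "z \<in> effdom \<Phi>" for z
  proof -
    have uz: "(\<lambda>t. u t - z) \<in> L2_space T"
    proof -
      have "(\<lambda>t. if t \<in> UNIV then z else u t) \<in> L2_space T" by (rule L2_piecewise_const[OF u]) simp
      then show ?thesis using L2_diff[OF u] by simp
    qed
    define d where "d = (\<lambda>t. (g t - f t) \<bullet> (u t - z) + \<phi> (u t) - \<phi> z)"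
    have d: "set_integrable lebesgue {0<..<T} d"
      unfolding d_def using L2_inner_integrable[OF L2_diff[OF g f] uz] \<phi>u const
      by (intro set_integral_add set_integral_diff) auto
    \<comment> \<open>The set on which the desired inequality fails. With z on A and u elsewhere as
      competitor, the difference of the two sides is nonnegative pointwise, while the variational
      inequality makes its integral nonpositive.\<close>
    define A where "A = {t \<in> space lebesgue. 0 < indicator {0<..<T} t *\<^sub>R d t}"
    have dm: "(\<lambda>t. indicator {0<..<T} t *\<^sub>R d t) \<in> borel_measurable lebesgue"
      using d by (simp add: set_integrable_def borel_measurable_integrable)
    have A: "A \<in> sets lebesgue"
      unfolding A_def by (rule borel_measurable_less[OF _ dm]) simp
    define w where "w = (\<lambda>t. if t \<in> A then z else u t)"
    have w: "w \<in> L2_space T" unfolding w_def by (rule L2_piecewise_const[OF u A])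
    have uw: "(\<lambda>t. u t - w t) \<in> L2_space T" by (rule L2_diff[OF u w])
    have \<phi>w: "set_integrable lebesgue {0<..<T} (\<lambda>t. \<phi> (w t))"
    proof -
      have *: "indicator {0<..<T} t *\<^sub>R \<phi> (w t) = indicator A t *\<^sub>R (indicator {0<..<T} t *\<^sub>R \<phi> z)
          + indicator (- A) t *\<^sub>R (indicator {0<..<T} t *\<^sub>R \<phi> (u t))" for t
        by (simp add: w_def indicator_def)
      have A': "- A \<in> sets lebesgue" using sets.compl_sets[OF A] by (simp add: Compl_eq_Diff_UNIV)
      show ?thesis
        unfolding set_integrable_def *
        by (rule Bochner_Integration.integrable_add[OF
              integrable_mult_indicator[OF A const[of "\<phi> z", unfolded set_integrable_def]]
              integrable_mult_indicator[OF A' \<phi>u[unfolded set_integrable_def]]])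
    qed
    have ext_w: "ext_integral T (\<lambda>t. \<Phi> (w t)) = ereal (LINT t:{0<..<T}|lebesgue. \<phi> (w t))"
      by (rule ext_integral_eq_integral[OF eventually_mono[OF u_fin] \<phi>w])
         (use fin z in \<open>auto simp: w_def effdom_def\<close>)
    have gi: "set_integrable lebesgue {0<..<T} (\<lambda>t. g t \<bullet> (u t - w t))"
      and fi: "set_integrable lebesgue {0<..<T} (\<lambda>t. f t \<bullet> (u t - w t))"
      by (rule L2_inner_integrable[OF g uw], rule L2_inner_integrable[OF f uw])
    have le: "(LINT t:{0<..<T}|lebesgue. g t \<bullet> (u t - w t)) + (LINT t:{0<..<T}|lebesgue. \<phi> (u t))
        \<le> (LINT t:{0<..<T}|lebesgue. f t \<bullet> (u t - w t)) + (LINT t:{0<..<T}|lebesgue. \<phi> (w t))"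
      using VI[OF w] unfolding ext_u ext_w by simp
    define P where "P = (\<lambda>t. indicator {0<..<T} t *\<^sub>R (g t \<bullet> (u t - w t)) + indicator {0<..<T} t *\<^sub>R \<phi> (u t)
        - (indicator {0<..<T} t *\<^sub>R (f t \<bullet> (u t - w t)) + indicator {0<..<T} t *\<^sub>R \<phi> (w t)))"
    have P_int: "integrable lebesgue P"
      unfolding P_def using gi fi \<phi>u \<phi>w
      by (intro Bochner_Integration.integrable_add Bochner_Integration.integrable_diff) (auto simp: set_integrable_def)
    have P_le: "(LINT t|lebesgue. P t) \<le> 0"
      using le gi fi \<phi>u \<phi>w unfolding P_def set_lebesgue_integral_def set_integrable_def by simp
    have P_eq: "P t = (if t \<in> A then indicator {0<..<T} t *\<^sub>R d t else 0)" for t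
      by (simp add: P_def w_def d_def indicator_def algebra_simps inner_diff_left)
    have P_nonneg: "0 \<le> P t" for t unfolding P_eq by (auto simp: A_def)
    have "(LINT t|lebesgue. P t) = 0" using P_le Bochner_Integration.integral_nonneg[of lebesgue P] P_nonneg by (simp add: order_antisym)
    then have "AE t in lebesgue. P t = 0"
      using integral_nonneg_eq_0_iff_AE[OF P_int] P_nonneg by simp
    then show ?thesis
    proof eventually_elim
      case (elim t)
      show ?case
      proof
        assume t: "t \<in> {0<..<T}"
        have "\<not> 0 < d t"
          using elim t unfolding P_eq by (auto simp: A_def split: if_splits)
        then show "\<phi> (u t) + (g t - f t) \<bullet> (u t - z) \<le> \<phi> z" by (simp add: d_def)
      qed
    qed
  qed
  define G where "G = (\<lambda>z. (z, \<phi> z)) ` effdom \<Phi>"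
  obtain D where D: "countable D" "D \<subseteq> G" "G \<subseteq> closure D" by (rule countable_dense_subset)
  have "AE t in lebesgue. \<forall>p\<in>D. t \<in> {0<..<T} \<longrightarrow> \<phi> (u t) + (g t - f t) \<bullet> (u t - fst p) \<le> snd p"
  proof (subst AE_ball_countable[OF D(1)], intro ballI)
    fix p assume "p \<in> D"
    then obtain z where "z \<in> effdom \<Phi>" "p = (z, \<phi> z)" using D(2) by (auto simp: G_def)
    then show "AE t in lebesgue. t \<in> {0<..<T} \<longrightarrow> \<phi> (u t) + (g t - f t) \<bullet> (u t - fst p) \<le> snd p"
      using VI_z[of z] by simp
  qed
  with u_fin show ?thesis
  proof eventually_elim
    case (elim t)
    show ?case
    proof
      assume t: "t \<in> {0<..<T}"
      \<comment> \<open>At a fixed time the inequality is a closed condition on the pair of z and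
        its energy, so it extends from D to the whole graph.\<close>
      define C where "C = {p. \<phi> (u t) + (g t - f t) \<bullet> (u t - fst p) \<le> snd p}"
      have "closed C" unfolding C_def by (intro closed_Collect_le continuous_intros)
      moreover have "D \<subseteq> C" using elim t by (auto simp: C_def)
      ultimately have GC: "G \<subseteq> C" using D(3) closure_minimal[of D C] by blast
      have ut: "\<Phi> (u t) = ereal (\<phi> (u t))" using fin elim t by auto
      show "f t - g t \<in> subdiff \<Phi> (u t)"
        unfolding subdiff_def mem_Collect_eq
      proof
        fix v
        show "ereal ((f t - g t) \<bullet> (v - u t)) \<le> \<Phi> v - \<Phi> (u t)"
        proof (cases "\<Phi> v = \<infinity>")
          case False
          then have "(v, \<phi> v) \<in> G" by (auto simp: G_def effdom_def)
          then have "\<phi> (u t) + (g t - f t) \<bullet> (u t - v) \<le> \<phi> v" using GC by (auto simp: C_def)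
          moreover have "(g t - f t) \<bullet> (u t - v) = (f t - g t) \<bullet> (v - u t)"
            by (simp add: inner_diff_left inner_diff_right)
          ultimately show ?thesis using fin[OF False] ut by simp
        qed (simp add: ut)
      qed
    qed
  qed
qed

text \<open>For \<alpha> < 1 the weight at t = T is at least T^(\<alpha>-1) on (0, T), so the
  weighted norm controls the plain one.\<close>

lemma Lpa_space_2_L2:
  fixes f :: "real \<Rightarrow> 'a::{real_normed_vector, second_countable_topology}"
  assumes T: "0 < T" and \<alpha>: "\<alpha> < 1" and f: "f \<in> Lpa_space 2 \<alpha> T"
  shows "f \<in> L2_space T"
proof -
  have fm: "f \<in> borel_measurable (lebesgue_on {0<..<T})" and fin: "Lpa_norm 2 \<alpha> T f < top"
    using f by (auto simp: Lpa_space_def)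
  define X where "X = weighted_int \<alpha> (\<lambda>s. ennreal_powr (ennreal (norm (f s))) 2) T"
  have "ennreal_powr X (1 / 2) \<le> Lpa_norm 2 \<alpha> T f"
    unfolding Lpa_norm_ext_def X_def by (rule SUP_upper) (use T in simp)
  then have X: "X < top" using fin by (auto simp: ennreal_powr_def less_top split: if_splits)
  have i: "(\<lambda>s. ennreal ((norm (f s))\<^sup>2) * indicator {0<..<T} s) \<in> borel_measurable lebesgue"
  proof -
    have "(\<lambda>s. indicator {0<..<T} s *\<^sub>R f s) \<in> borel_measurable lebesgue"
      using fm by (simp add: borel_measurable_restrict_space_iff)
    then have "(\<lambda>s. ennreal ((norm (indicator {0<..<T} s *\<^sub>R f s))\<^sup>2)) \<in> borel_measurable lebesgue"
      by measurable
    also have "(\<lambda>s. ennreal ((norm (indicator {0<..<T} s *\<^sub>R f s))\<^sup>2)) = (\<lambda>s. ennreal ((norm (f s))\<^sup>2) * indicator {0<..<T} s)"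
      by (auto simp: indicator_def)
    finally show ?thesis .
  qed
  have "ennreal (T powr (\<alpha> - 1)) * (\<integral>\<^sup>+ s\<in>{0<..<T}. ennreal ((norm (f s))\<^sup>2) \<partial>lebesgue)
     = (\<integral>\<^sup>+ s. ennreal (T powr (\<alpha> - 1)) * (ennreal ((norm (f s))\<^sup>2) * indicator {0<..<T} s) \<partial>lebesgue)"
    by (rule nn_integral_cmult[OF i, symmetric])
  also have "\<dots> \<le> X"
    unfolding X_def weighted_int_def
  proof (rule nn_integral_mono)
    fix s
    show "ennreal (T powr (\<alpha> - 1)) * (ennreal ((norm (f s))\<^sup>2) * indicator {0<..<T} s)
        \<le> ennreal ((T - s) powr (\<alpha> - 1)) * ennreal_powr (ennreal (norm (f s))) 2 * indicator {0..T} s"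
    proof (cases "s \<in> {0<..<T}")
      case True
      have "T powr (\<alpha> - 1) \<le> (T - s) powr (\<alpha> - 1)"
        using True \<alpha> by (intro powr_mono2') auto
      then have "ennreal (T powr (\<alpha> - 1)) * ennreal ((norm (f s))\<^sup>2) \<le> ennreal ((T - s) powr (\<alpha> - 1)) * ennreal ((norm (f s))\<^sup>2)"
        by (intro mult_right_mono ennreal_leI) auto
      then show ?thesis using True by (cases "f s = 0") (auto simp: ennreal_powr_def)
    qed simp
  qed
  also have "X < top" by (rule X)
  finally have "(\<integral>\<^sup>+ s\<in>{0<..<T}. ennreal ((norm (f s))\<^sup>2) \<partial>lebesgue) < top"
    using T by (auto simp: ennreal_mult_less_top)
  with fm show ?thesis by (simp add: L2_space_def)
qed

section \<open>Fractional energy bounds\<close>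

text \<open>Extracts pointwise information from the once integrated inequality: y cannot be positive
  almost everywhere in (a, b). The point can moreover be taken in a set Q of full measure, later the
  set of times at which fractional integrals exist.\<close>

lemma ex_point_nonpos:
  fixes y :: "real \<Rightarrow> real"
  assumes y: "set_integrable lebesgue {0..S} y" and ab: "0 \<le> a" "a < b" "b \<le> S"
    and le: "(LINT s:{0..b}|lebesgue. y s) \<le> (LINT s:{0..a}|lebesgue. y s)"
    and Q: "AE s in lebesgue. Q s"
  shows "\<exists>s\<in>{a<..<b}. Q s \<and> y s \<le> 0"
proof (rule ccontr)
  assume "\<not> ?thesis"
  then have pos: "0 < y s" if "s \<in> {a<..<b}" "Q s" for s using that by force
  define z where "z = (\<lambda>s. indicator {0..b} s *\<^sub>R y s - indicator {0..a} s *\<^sub>R y s)"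
  have i: "integrable lebesgue (\<lambda>s. indicator {0..b} s *\<^sub>R y s)" "integrable lebesgue (\<lambda>s. indicator {0..a} s *\<^sub>R y s)"
    using set_integrable_subset[OF y, of "{0..b}"] set_integrable_subset[OF y, of "{0..a}"] ab
    by (auto simp: set_integrable_def)
  have z: "integrable lebesgue z" unfolding z_def using i by simp
  have z_int: "(LINT s|lebesgue. z s) \<le> 0"
    using le i unfolding z_def set_lebesgue_integral_def by simp
  have z_eq: "z s = (if a < s \<and> s \<le> b then y s else 0)" for s
    using ab by (auto simp: z_def indicator_def)
  have nn: "AE s in lebesgue. 0 \<le> z s"
    using Q AE_completion[OF AE_lborel_singleton[of b]]
    by eventually_elim (use pos in \<open>force simp: z_eq less_imp_le\<close>)
  then have "(LINT s|lebesgue. z s) = 0"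
    using z_int integral_nonneg_AE[OF nn] by simp
  then have "AE s in lebesgue. z s = 0"
    using integral_nonneg_eq_0_iff_AE[OF z nn] by simp
  with Q have "AE s\<in>{a<..<b} in lebesgue. s \<in> {}"
    by eventually_elim (use pos in \<open>force simp: z_eq\<close>)
  then have "(a + b) / 2 \<in> {}"
    by (rule mem_closed_if_AE_lebesgue_open[rotated 2]) (use ab in auto)
  then show False by simp
qed

text \<open>The integral I^\<alpha> with values in [0, \<infinity>]. Unlike \<open>RL\<close>, it
  carries information at every time, including those at which the integrand fails to be integrable
  and \<open>RL\<close> would return 0.\<close>

definition frac_nn :: "real \<Rightarrow> (real \<Rightarrow> ennreal) \<Rightarrow> real \<Rightarrow> ennreal" where
  "frac_nn \<alpha> g t = (\<integral>\<^sup>+ s\<in>{0..t}. ennreal (kap \<alpha> (t - s)) * g s \<partial>lebesgue)"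

lemma frac_nn_eq:
  assumes "t \<le> T"
  shows "frac_nn \<alpha> g t = (\<integral>\<^sup>+ s. ennreal (kap \<alpha> (t - s)) * (g s * indicator {0..T} s) \<partial>lebesgue)"
  unfolding frac_nn_def
  by (rule nn_integral_cong) (use assms in \<open>auto simp: indicator_def kap_def\<close>)

lemma measurable_kap_diff: "(\<lambda>s. ennreal (kap \<alpha> (t - s))) \<in> borel_measurable lebesgue"
  by (rule measurable_completion) measurable

text \<open>Fatou's lemma makes a fractional integral of a nonnegative function lower semicontinuous, which
  turns bounds at almost every time into bounds at every time.\<close>

lemma frac_nn_limit:
  assumes g: "(\<lambda>s. g s * indicator {0..T} s) \<in> borel_measurable lebesgue"
    and x: "\<And>k::nat. x k \<in> {0..T}" "x \<longlonglongrightarrow> t" and t: "t \<in> {0..T}"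
    and c: "c \<longlonglongrightarrow> c0" and le: "\<And>k. frac_nn \<alpha> g (x k) \<le> ennreal (c k)"
  shows "frac_nn \<alpha> g t \<le> ennreal c0"
proof -
  define G where "G = (\<lambda>s. g s * indicator {0..T} s)"
  have "frac_nn \<alpha> g t = (\<integral>\<^sup>+ s. ennreal (kap \<alpha> (t - s)) * G s \<partial>lebesgue)"
    unfolding G_def by (rule frac_nn_eq) (use t in auto)
  also have "\<dots> \<le> (\<integral>\<^sup>+ s. liminf (\<lambda>k. ennreal (kap \<alpha> (x k - s)) * G s) \<partial>lebesgue)"
  proof (rule nn_integral_mono_AE)
    have "ennreal (kap \<alpha> (t - s)) * G s \<le> liminf (\<lambda>k. ennreal (kap \<alpha> (x k - s)) * G s)" if s: "s \<noteq> t" for s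
    proof -
      have "(\<lambda>k. kap \<alpha> (x k - s)) \<longlonglongrightarrow> kap \<alpha> (t - s)"
      proof (cases "s < t")
        case True
        have l: "(\<lambda>k. x k - s) \<longlonglongrightarrow> t - s" using x(2) by (intro tendsto_intros)
        have "(\<lambda>k. (x k - s) powr (\<alpha> - 1) * (1 / Gamma \<alpha>)) \<longlonglongrightarrow> (t - s) powr (\<alpha> - 1) * (1 / Gamma \<alpha>)"
          by (intro tendsto_intros l) (use True in auto)
        moreover have "\<forall>\<^sub>F k in sequentially. (x k - s) powr (\<alpha> - 1) * (1 / Gamma \<alpha>) = kap \<alpha> (x k - s)"
          using order_tendstoD(1)[OF l, of 0] True by (auto elim!: eventually_mono simp: kap_def)
        ultimately have "(\<lambda>k. kap \<alpha> (x k - s)) \<longlonglongrightarrow> (t - s) powr (\<alpha> - 1) * (1 / Gamma \<alpha>)"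
          by (rule Lim_transform_eventually)
        then show ?thesis using True by (simp add: kap_def)
      next
        case False
        then have "t < s" using s by simp
        have "\<forall>\<^sub>F k in sequentially. kap \<alpha> (x k - s) = 0"
          using order_tendstoD(2)[OF x(2) \<open>t < s\<close>] by eventually_elim (simp add: kap_def)
        then show ?thesis using \<open>t < s\<close> by (simp add: kap_def tendsto_eventually)
      qed
      then have l: "(\<lambda>k. ennreal (kap \<alpha> (x k - s))) \<longlonglongrightarrow> ennreal (kap \<alpha> (t - s))"
        by (rule tendsto_ennrealI)
      show ?thesis
      \<comment> \<open>A vanishing limit kernel is treated apart to avoid a product of 0 and
        infinity in the limit.\<close>
      proof (cases "kap \<alpha> (t - s) \<le> 0")
        case True
        then show ?thesis by (simp add: ennreal_neg)
      next
        case False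
        then have "(\<lambda>k. ennreal (kap \<alpha> (x k - s)) * G s) \<longlonglongrightarrow> ennreal (kap \<alpha> (t - s)) * G s"
          by (intro tendsto_mult_ennreal l tendsto_const) auto
        then have "liminf (\<lambda>k. ennreal (kap \<alpha> (x k - s)) * G s) = ennreal (kap \<alpha> (t - s)) * G s"
          by (intro lim_imp_Liminf) auto
        then show ?thesis by simp
      qed
    qed
    note lim = this
    show "AE s in lebesgue. ennreal (kap \<alpha> (t - s)) * G s \<le> liminf (\<lambda>k. ennreal (kap \<alpha> (x k - s)) * G s)"
      using AE_completion[OF AE_lborel_singleton[of t]] by (rule eventually_mono) (rule lim)
  qed
  also have "\<dots> \<le> liminf (\<lambda>k. \<integral>\<^sup>+ s. ennreal (kap \<alpha> (x k - s)) * G s \<partial>lebesgue)"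
    by (rule nn_integral_liminf)
       (rule borel_measurable_times_ennreal[OF measurable_kap_diff g[folded G_def]])
  also have "\<dots> = liminf (\<lambda>k. frac_nn \<alpha> g (x k))"
    unfolding G_def using x(1) by (subst frac_nn_eq[of _ T]) auto
  also have "\<dots> \<le> liminf (\<lambda>k. ennreal (c k))"
    by (rule Liminf_mono) (use le in auto)
  also have "\<dots> = ennreal c0"
    by (rule lim_imp_Liminf) (auto intro!: tendsto_ennrealI c)
  finally show ?thesis .
qed

lemma set_integrable_inner_continuous:
  fixes v h :: "real \<Rightarrow> 'a::{real_inner, banach, second_countable_topology}"
  assumes v: "continuous_on {a..b} v" and h: "set_integrable lebesgue {a..b} h"
  shows "set_integrable lebesgue {a..b} (\<lambda>s. h s \<bullet> v s)"
proof -
  obtain B where B: "0 \<le> B" "\<And>s. s \<in> {a..b} \<Longrightarrow> norm (v s) \<le> B"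
    using continuous_on_Icc_norm_bounded[OF v] by blast
  show ?thesis
    unfolding set_integrable_def
  proof (rule Bochner_Integration.integrable_bound)
    show "integrable lebesgue (\<lambda>s. norm (indicator {a..b} s *\<^sub>R h s) * B)"
      using h unfolding set_integrable_def by (intro integrable_mult_left integrable_norm)
    have "(\<lambda>s. (indicator {a..b} s *\<^sub>R h s) \<bullet> (indicator {a..b} s *\<^sub>R v s)) \<in> borel_measurable lebesgue"
      using set_borel_measurable_continuous_Icc[OF v] h
      by (intro borel_measurable_inner) (auto simp: set_borel_measurable_def set_integrable_def)
    also have "(\<lambda>s. (indicator {a..b} s *\<^sub>R h s) \<bullet> (indicator {a..b} s *\<^sub>R v s)) = (\<lambda>s. indicator {a..b} s *\<^sub>R (h s \<bullet> v s))"
      by (auto simp: indicator_def)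
    finally show "(\<lambda>s. indicator {a..b} s *\<^sub>R (h s \<bullet> v s)) \<in> borel_measurable lebesgue" .
    show "AE s in lebesgue. norm (indicator {a..b} s *\<^sub>R (h s \<bullet> v s)) \<le> norm (norm (indicator {a..b} s *\<^sub>R h s) * B)"
    proof (rule AE_I2)
      fix s
      have "\<bar>h s \<bullet> v s\<bar> \<le> norm (h s) * B" if "s \<in> {a..b}"
        using Cauchy_Schwarz_ineq2[of "h s" "v s"] mult_left_mono[OF B(2)[OF that], of "norm (h s)"] by simp
      then show "norm (indicator {a..b} s *\<^sub>R (h s \<bullet> v s)) \<le> norm (norm (indicator {a..b} s *\<^sub>R h s) * B)"
        using B(1) by (simp add: indicator_def)
    qed
  qed
qed

text \<open>Here p majorises h \<bullet> v, and the slack p - h \<bullet> v is what later dominates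
  the coercivity moduli. Arbitrarily close to t there are times s at which the chain inequality
  holds pointwise and the fractional integrals exist; there the slack can be split off from
  I^\<alpha> p. Continuity of v and Fatou carry the bound to t. The times s stay below T, where the
  primitive of h is known, so t = T is reached from the left.\<close>

lemma fractional_energy_bound:
  fixes v h :: "real \<Rightarrow> 'a::{real_inner, banach, second_countable_topology}" and p :: "real \<Rightarrow> real"
  assumes \<alpha>: "0 < \<alpha>" "\<alpha> < 1" and T: "0 < T" and v: "continuous_on {0..T} v"
    and h: "set_integrable lebesgue {0..T} h" and p: "set_integrable lebesgue {0..T} p"
    and vh: "\<And>t. 0 \<le> t \<Longrightarrow> t < T \<Longrightarrow> RL (1 - \<alpha>) (\<lambda>s. v s - v 0) t = (LINT s:{0..t}|lebesgue. h s)"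
    and R: "AE s in lebesgue. s \<in> {0<..<T} \<longrightarrow> h s \<bullet> v s \<le> p s"
    and C: "\<And>t. 0 \<le> t \<Longrightarrow> t < T \<Longrightarrow> set_integrable lebesgue {0..t} (\<lambda>s. kap \<alpha> (t - s) * p s) \<Longrightarrow>
        (norm (v 0))\<^sup>2 + 2 * RL \<alpha> p t \<le> C"
    and t: "t \<in> {0..T}"
  shows "ennreal ((norm (v t))\<^sup>2) + 2 * frac_nn \<alpha> (\<lambda>s. ennreal (p s - h s \<bullet> v s)) t \<le> ennreal C"
proof -
  define r where "r = (\<lambda>s. p s - h s \<bullet> v s)"
  have hv: "set_integrable lebesgue {0..T} (\<lambda>s. h s \<bullet> v s)"
    by (rule set_integrable_inner_continuous[OF v h])
  have ri: "set_integrable lebesgue {0..T} r"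
    unfolding r_def using p hv by (rule set_integral_diff)
  have good: "\<exists>s\<in>{a<..<b}. frac_nn \<alpha> (\<lambda>s. ennreal (r s)) s \<le> ennreal ((C - (norm (v s))\<^sup>2) / 2) \<and> (norm (v s))\<^sup>2 \<le> C"
    if ab: "0 \<le> a" "a < b" "b < T" for a b
  proof -
    define y where "y = (\<lambda>s. (norm (v s))\<^sup>2 - (norm (v 0))\<^sup>2 - 2 * RL \<alpha> (\<lambda>s. h s \<bullet> v s) s)"
    have sub: "{0..b} \<subseteq> {0..T}" using ab by auto
    have vb: "continuous_on {0..b} v" and hb: "set_integrable lebesgue {0..b} h"
      and hvb: "set_integrable lebesgue {0..b} (\<lambda>s. h s \<bullet> v s)" and pb: "set_integrable lebesgue {0..b} p"
      using continuous_on_subset[OF v sub] set_integrable_subset[OF h _ sub] set_integrable_subset[OF hv _ sub]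
        set_integrable_subset[OF p _ sub] by auto
    have i1: "set_integrable lebesgue {0..b} (\<lambda>s. (norm (v s))\<^sup>2 - (norm (v 0))\<^sup>2)"
      by (intro set_integrable_continuous_Icc continuous_intros vb)
    have i2: "set_integrable lebesgue {0..b} (\<lambda>s. 2 * RL \<alpha> (\<lambda>s. h s \<bullet> v s) s)"
    proof -
      have "set_integrable lebesgue {0..b} (\<lambda>s. kap 1 (b - s) *\<^sub>R RL \<alpha> (\<lambda>s. h s \<bullet> v s) s)"
        by (rule RL_RL_integrable[OF _ \<alpha>(1) _ hvb]) (use \<alpha> in auto)
      also have "set_integrable lebesgue {0..b} (\<lambda>s. kap 1 (b - s) *\<^sub>R RL \<alpha> (\<lambda>s. h s \<bullet> v s) s)
          = set_integrable lebesgue {0..b} (RL \<alpha> (\<lambda>s. h s \<bullet> v s))"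
        unfolding set_integrable_def
        by (rule integrable_discrete_difference[of "{b}"]) (auto simp: kap_1 indicator_def)
      finally show ?thesis by simp
    qed
    have y: "set_integrable lebesgue {0..b} y" unfolding y_def using i1 i2 by (rule set_integral_diff)
    have X: "RL 1 (\<lambda>s. (norm (v s))\<^sup>2 - (norm (v 0))\<^sup>2) t - 2 * RL (\<alpha> + 1) (\<lambda>s. h s \<bullet> v s) t = (LINT s:{0..t}|lebesgue. y s)"
      if t: "0 \<le> t" "t \<le> b" for t
    proof -
      have sub: "{0..t} \<subseteq> {0..b}" using t by auto
      have "RL (\<alpha> + 1) (\<lambda>s. h s \<bullet> v s) t = RL 1 (RL \<alpha> (\<lambda>s. h s \<bullet> v s)) t"
        using RL_RL[of 1 \<alpha> t "\<lambda>s. h s \<bullet> v s"] \<alpha> set_integrable_subset[OF hvb _ sub] by (simp add: add.commute)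
      then show ?thesis
        unfolding RL_1 y_def
        using set_integral_diff(2)[OF set_integrable_subset[OF i1 _ sub] set_integrable_subset[OF i2 _ sub]] by simp
    qed
    have "RL 1 (\<lambda>s. (norm (v s))\<^sup>2 - (norm (v 0))\<^sup>2) b - 2 * RL (\<alpha> + 1) (\<lambda>s. h s \<bullet> v s) b
      \<le> RL 1 (\<lambda>s. (norm (v s))\<^sup>2 - (norm (v 0))\<^sup>2) a - 2 * RL (\<alpha> + 1) (\<lambda>s. h s \<bullet> v s) a"
      by (rule fractional_chain_inequality[OF \<alpha> vb hb]) (use vh ab in auto)
    then have le: "(LINT s:{0..b}|lebesgue. y s) \<le> (LINT s:{0..a}|lebesgue. y s)"
      using X[of a] X[of b] ab by simp
    \<comment> \<open>Fractional integrals exist at almost every time before S; with S > b this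
      covers the whole interval (a, b).\<close>
    define S where "S = (b + T) / 2"
    have S: "b < S" "S < T" using ab by (auto simp: S_def)
    have subS: "{0..S} \<subseteq> {0..T}" using S by auto
    have pS: "set_integrable lebesgue {0..S} p" and hvS: "set_integrable lebesgue {0..S} (\<lambda>s. h s \<bullet> v s)"
      using set_integrable_subset[OF p _ subS] set_integrable_subset[OF hv _ subS] by auto
    have "AE s in lebesgue. (s < S \<longrightarrow> set_integrable lebesgue {0..s} (\<lambda>q. kap \<alpha> (s - q) *\<^sub>R p q))
        \<and> (s < S \<longrightarrow> set_integrable lebesgue {0..s} (\<lambda>q. kap \<alpha> (s - q) *\<^sub>R (h q \<bullet> v q)))"
      using AE_RL_integrable[of 1 \<alpha> S p] AE_RL_integrable[of 1 \<alpha> S "\<lambda>s. h s \<bullet> v s"] \<alpha> pS hvS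
      by (intro AE_conjI) auto
    from ex_point_nonpos[OF y ab(1,2) order_refl le this]
    obtain s where s: "a < s" "s < b" "y s \<le> 0"
      and ip: "set_integrable lebesgue {0..s} (\<lambda>q. kap \<alpha> (s - q) *\<^sub>R p q)"
      and ihv: "set_integrable lebesgue {0..s} (\<lambda>q. kap \<alpha> (s - q) *\<^sub>R (h q \<bullet> v q))"
      using S by auto
    have s0: "0 \<le> s" "s < T" using s ab by auto
    have ir: "set_integrable lebesgue {0..s} (\<lambda>q. kap \<alpha> (s - q) * r q)"
      using set_integral_diff(1)[OF ip ihv] by (simp add: r_def algebra_simps)
    have RLr: "RL \<alpha> r s = RL \<alpha> p s - RL \<alpha> (\<lambda>s. h s \<bullet> v s) s"
      unfolding RL_def r_def using set_integral_diff(2)[OF ip ihv] by (simp add: algebra_simps)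
    have nn: "AE q in lebesgue. 0 \<le> indicator {0..s} q * (kap \<alpha> (s - q) * r q)"
      using R AE_completion[OF AE_lborel_singleton[of 0]]
    proof eventually_elim
      case (elim q)
      show ?case
      proof (cases "q \<in> {0..s}")
        case True
        then have "0 \<le> r q" using elim s0 by (auto simp: r_def)
        then show ?thesis using kap_nonneg[OF \<alpha>(1)] by simp
      qed simp
    qed
    have frac: "frac_nn \<alpha> (\<lambda>s. ennreal (r s)) s = ennreal (RL \<alpha> r s)"
    proof -
      have "frac_nn \<alpha> (\<lambda>s. ennreal (r s)) s = (\<integral>\<^sup>+ q. ennreal (indicator {0..s} q * (kap \<alpha> (s - q) * r q)) \<partial>lebesgue)"
        unfolding frac_nn_def
        by (rule nn_integral_cong) (auto simp: indicator_def ennreal_mult' kap_nonneg \<alpha>)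
      also have "\<dots> = ennreal (LINT q|lebesgue. indicator {0..s} q * (kap \<alpha> (s - q) * r q))"
        by (rule nn_integral_eq_integral[OF _ nn]) (use ir in \<open>simp add: set_integrable_def\<close>)
      finally show ?thesis by (simp add: RL_def set_lebesgue_integral_def)
    qed
    have RLr0: "0 \<le> RL \<alpha> r s"
      using integral_nonneg_AE[OF nn] by (simp add: RL_def set_lebesgue_integral_def)
    have "(norm (v s))\<^sup>2 + 2 * RL \<alpha> r s \<le> (norm (v 0))\<^sup>2 + 2 * RL \<alpha> p s"
      using s(3) by (simp add: y_def RLr)
    also have "\<dots> \<le> C" using C[OF s0] ip by simp
    finally have "(norm (v s))\<^sup>2 + 2 * RL \<alpha> r s \<le> C" .
    then have "RL \<alpha> r s \<le> (C - (norm (v s))\<^sup>2) / 2" "(norm (v s))\<^sup>2 \<le> C" using RLr0 by auto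
    then show ?thesis using s unfolding frac[symmetric]
      by (intro bexI[of _ s]) (auto simp: frac intro: ennreal_leI)
  qed
  \<comment> \<open>Disjointness from T dictates the windows: they approach t from the left if t > 0
    and from the right if t = 0. The shift from k + 2 to k + 3 keeps each window nonempty.\<close>
  define lo where "lo = (\<lambda>k::nat. if t = 0 then 0 else t - t / real (k + 2))"
  define hi where "hi = (\<lambda>k::nat. if t = 0 then T / real (k + 2) else t - t / real (k + 3))"
  have lohi: "0 \<le> lo k" "lo k < hi k" "hi k < T" for k
  proof -
    have q: "1 / real (k + 3) < 1 / real (k + 2)" "1 / real (k + 2) < 1" "0 < 1 / real (k + 3)"
      by (auto intro!: divide_strict_left_mono)
    have hiT: "t - t / (real k + 3) < T" if "t \<noteq> 0"
    proof -
      have "0 < t / (real k + 3)" using that t by (intro divide_pos_pos) auto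
      then show ?thesis using t by auto
    qed
    show "0 \<le> lo k" "lo k < hi k" "hi k < T"
      using t T mult_strict_left_mono[OF q(1), of t] mult_strict_left_mono[OF q(2), of t]
        mult_strict_left_mono[OF q(2), of T]
      by (auto simp: lo_def hi_def intro!: hiT)
  qed
  have "\<exists>s. \<forall>k. s k \<in> {lo k<..<hi k} \<and> frac_nn \<alpha> (\<lambda>s. ennreal (r s)) (s k) \<le> ennreal ((C - (norm (v (s k)))\<^sup>2) / 2) \<and> (norm (v (s k)))\<^sup>2 \<le> C"
    using good[OF lohi] by (intro choice) blast
  then obtain s where s: "\<And>k. s k \<in> {lo k<..<hi k}"
    "\<And>k. frac_nn \<alpha> (\<lambda>s. ennreal (r s)) (s k) \<le> ennreal ((C - (norm (v (s k)))\<^sup>2) / 2)"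
    "\<And>k. (norm (v (s k)))\<^sup>2 \<le> C" by blast
  have sT: "s k \<in> {0..T}" for k using s(1)[of k] lohi[of k] by auto
  have inv: "(\<lambda>k. c / real (k + m)) \<longlonglongrightarrow> 0" for c :: real and m
    using LIMSEQ_ignore_initial_segment[OF lim_const_over_n[of c], of m] by simp
  have lim: "s \<longlonglongrightarrow> t"
  proof (rule tendsto_sandwich[of lo _ _ hi])
    show "lo \<longlonglongrightarrow> t" "hi \<longlonglongrightarrow> t"
      using tendsto_diff[OF tendsto_const inv, of t t 2] tendsto_diff[OF tendsto_const inv, of t t 3] inv[of T 2]
      by (cases "t = 0"; simp add: lo_def hi_def)+
  qed (use s(1) in \<open>auto intro!: always_eventually less_imp_le\<close>)
  have lim_v: "(\<lambda>k. (norm (v (s k)))\<^sup>2) \<longlonglongrightarrow> (norm (v t))\<^sup>2"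
    by (intro tendsto_intros continuous_on_tendsto_compose[OF v lim t]) (use sT in auto)
  have vC: "(norm (v t))\<^sup>2 \<le> C"
    by (rule LIMSEQ_le_const2[OF lim_v]) (use s(3) in auto)
  have rm: "(\<lambda>s. ennreal (r s) * indicator {0..T} s) \<in> borel_measurable lebesgue"
  proof -
    have "(\<lambda>s. ennreal (indicator {0..T} s *\<^sub>R r s)) \<in> borel_measurable lebesgue"
      using ri unfolding set_integrable_def by measurable
    also have "(\<lambda>s. ennreal (indicator {0..T} s *\<^sub>R r s)) = (\<lambda>s. ennreal (r s) * indicator {0..T} s)"
      by (auto simp: indicator_def)
    finally show ?thesis .
  qed
  have "frac_nn \<alpha> (\<lambda>s. ennreal (r s)) t \<le> ennreal ((C - (norm (v t))\<^sup>2) / 2)"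
    by (rule frac_nn_limit[OF rm sT lim t _ s(2)]) (intro tendsto_intros lim_v, simp)
  then have "2 * frac_nn \<alpha> (\<lambda>s. ennreal (r s)) t \<le> 2 * ennreal ((C - (norm (v t))\<^sup>2) / 2)"
    by (rule mult_left_mono) simp
  also have "\<dots> = ennreal (C - (norm (v t))\<^sup>2)"
  proof -
    have e: "2 * ((C - (norm (v t))\<^sup>2) / 2) = C - (norm (v t))\<^sup>2" by simp
    have "ennreal (2 * ((C - (norm (v t))\<^sup>2) / 2)) = 2 * ennreal ((C - (norm (v t))\<^sup>2) / 2)"
      using vC by (subst ennreal_mult) simp_all
    then show ?thesis unfolding e by (rule sym)
  qed
  finally have "ennreal ((norm (v t))\<^sup>2) + 2 * frac_nn \<alpha> (\<lambda>s. ennreal (r s)) t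
      \<le> ennreal ((norm (v t))\<^sup>2) + ennreal (C - (norm (v t))\<^sup>2)"
    by (rule add_left_mono)
  also have "\<dots> = ennreal C" using vC by (subst ennreal_plus[symmetric]) auto
  finally show ?thesis by (simp add: r_def)
qed

section \<open>The discrete solution\<close>

lemma partition_less:
  assumes "is_partition T N P" "m < n" "n \<le> N"
  shows "P m < P n"
  using assms(2,3)
proof (induction n)
  case (Suc n)
  have "P n < P (Suc n)" using assms(1) Suc.prems by (simp add: is_partition_def)
  then show ?case using Suc by (cases "m = n") (auto intro: less_trans)
qed simp

lemma interval_index_eq:
  assumes P: "is_partition T N P" and n: "n \<in> {1..N}" "t \<in> {P (n - 1)<..P n}"
  shows "interval_index N P t = n"
  unfolding interval_index_def
proof (rule the_equality)
  fix m assume m: "m \<in> {1..N} \<and> t \<in> {P (m - 1)<..P m}"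
  have le: "P i \<le> P j" if "i \<le> j" "j \<le> N" for i j
    using partition_less[OF P, of i j] that by (cases "i = j") auto
  show "m = n"
  proof (rule ccontr)
    assume "m \<noteq> n"
    then consider "m \<le> n - 1" | "n \<le> m - 1" by linarith
    then show False
    proof cases
      case 1
      have "n - 1 \<le> N" using n by auto
      then show False using le[OF 1] n m by auto
    next
      case 2
      have "m - 1 \<le> N" using m by auto
      then show False using le[OF 2] n m by auto
    qed
  qed
qed (use n in auto)

lemma interval_index_works:
  assumes P: "is_partition T N P" and t: "0 < t" "t \<le> T"
  shows "interval_index N P t \<in> {1..N}"
    and "t \<in> {P (interval_index N P t - 1)<..P (interval_index N P t)}"
proof -
  define n where "n = (LEAST n. t \<le> P n)"
  have PN: "t \<le> P N" "P 0 < t" using P t by (auto simp: is_partition_def)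
  have n: "t \<le> P n" unfolding n_def by (rule LeastI) (rule PN)
  have nN: "n \<le> N" unfolding n_def by (rule Least_le) (rule PN)
  have n1: "1 \<le> n" using n PN by (cases n) auto
  have "\<not> t \<le> P (n - 1)" unfolding n_def[symmetric] using n1 not_less_Least[of "n - 1" "\<lambda>n. t \<le> P n"] by (simp add: n_def)
  then have *: "n \<in> {1..N}" "t \<in> {P (n - 1)<..P n}" using n nN n1 by auto
  with interval_index_eq[OF P *]
  show "interval_index N P t \<in> {1..N}" "t \<in> {P (interval_index N P t - 1)<..P (interval_index N P t)}" by auto
qed

text \<open>A representative of the piecewise constant interpolants that is Borel and bounded on the
  whole line, whereas \<open>interval_index\<close> is specified on (0, T] only.\<close>

definition step_fun :: "nat \<Rightarrow> (nat \<Rightarrow> real) \<Rightarrow> (nat \<Rightarrow> 'a::real_normed_vector) \<Rightarrow> real \<Rightarrow> 'a" where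
  "step_fun N P W t = (\<Sum>n=1..N. indicator {P (n - 1)<..P n} t *\<^sub>R W n)"

lemma step_fun_eq:
  assumes P: "is_partition T N P" and t: "0 < t" "t \<le> T"
  shows "step_fun N P W t = W (interval_index N P t)"
proof -
  let ?m = "interval_index N P t"
  have "step_fun N P W t = (\<Sum>n=1..N. if n = ?m then W ?m else 0)"
    unfolding step_fun_def
  proof (rule sum.cong[OF refl])
    fix n assume n: "n \<in> {1..N}"
    have "t \<in> {P (n - 1)<..P n} \<longleftrightarrow> n = ?m"
      using interval_index_eq[OF P n] interval_index_works(2)[OF P t] by metis
    then show "indicator {P (n - 1)<..P n} t *\<^sub>R W n = (if n = ?m then W ?m else 0)"
      by (cases "n = ?m") (simp_all add: indicator_def)
  qed
  also have "\<dots> = W ?m" using interval_index_works(1)[OF P t] by (simp add: sum.delta)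
  finally show ?thesis .
qed

lemma step_fun_measurable [measurable]:
  fixes W :: "nat \<Rightarrow> 'a::{real_normed_vector, second_countable_topology}"
  shows "step_fun N P W \<in> borel_measurable borel"
  unfolding step_fun_def by measurable

lemma step_fun_bounded: "norm (step_fun N P W t) \<le> (\<Sum>n=1..N. norm (W n))"
  unfolding step_fun_def
proof (rule order_trans[OF norm_sum], rule sum_mono)
  show "norm (indicat_real {P (n - 1)<..P n} t *\<^sub>R W n) \<le> norm (W n)" for n
    by (simp add: indicator_def)
qed

lemma step_fun_set_measurable:
  fixes W :: "nat \<Rightarrow> 'a::{banach, second_countable_topology}"
  shows "set_borel_measurable lebesgue {a..b} (step_fun N P W)"
  unfolding set_borel_measurable_def by (rule measurable_completion) measurable

lemma step_fun_integrable:
  fixes W :: "nat \<Rightarrow> 'a::{banach, second_countable_topology}"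
  shows "set_integrable lebesgue {a..b} (step_fun N P W)"
proof (rule set_integrable_bound)
  show "set_integrable lebesgue {a..b} (\<lambda>_. \<Sum>n=1..N. norm (W n))"
    by (intro set_integrable_continuous_Icc continuous_intros)
  show "AE x in lebesgue. x \<in> {a..b} \<longrightarrow> norm (step_fun N P W x) \<le> norm (\<Sum>n=1..N. norm (W n))"
    by (intro AE_I2 impI order_trans[OF step_fun_bounded]) (simp only: real_norm_def abs_ge_self)
qed (rule step_fun_set_measurable)

context
  fixes \<alpha> T :: real and N :: nat and P :: "nat \<Rightarrow> real"
    and U :: "nat \<Rightarrow> 'a::{real_inner, banach, second_countable_topology}"
  assumes \<alpha>: "0 < \<alpha>" "\<alpha> < 1" and T: "0 < T" and P: "is_partition T N P"
begin

lemma Uhat_eq_RL: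
  assumes "t \<le> T"
  shows "Uhat \<alpha> N P U t = U 0 + RL \<alpha> (step_fun N P (discrete_caputo \<alpha> N P U)) t"
proof -
  have "RL \<alpha> (step_fun N P (discrete_caputo \<alpha> N P U)) t
      = RL \<alpha> (\<lambda>s. discrete_caputo \<alpha> N P U (interval_index N P s)) t"
    by (rule RL_cong) (use assms in \<open>auto intro: step_fun_eq[OF P]\<close>)
  also have "\<dots> = (LINT s:{0..t}|lebesgue. (1 / Gamma \<alpha>) *\<^sub>R
      ((t - s) powr (\<alpha> - 1) *\<^sub>R discrete_caputo \<alpha> N P U (interval_index N P s)))"
    unfolding RL_def set_lebesgue_integral_def
    by (rule Bochner_Integration.integral_cong) (auto simp: indicator_def kap_def)
  finally show ?thesis by (simp add: Uhat_def del: scaleR_scaleR)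
qed

lemma continuous_on_Uhat: "continuous_on {0..T} (Uhat \<alpha> N P U)"
proof -
  have "continuous_on {0..T} (\<lambda>t. U 0 + RL \<alpha> (step_fun N P (discrete_caputo \<alpha> N P U)) t)"
    by (intro continuous_intros RL_continuous[OF _ _ step_fun_set_measurable step_fun_bounded]) (use \<alpha> in auto)
  then show ?thesis
    by (rule continuous_on_cong[THEN iffD1, rotated 2]) (auto simp: Uhat_eq_RL)
qed

lemma Uhat_0: "Uhat \<alpha> N P U 0 = U 0"
  using T by (simp add: Uhat_eq_RL RL_0)

text \<open>\<open>Uhat\<close> minus its initial value is I^\<alpha> of the discrete derivative by
  construction, so a further I^(1-\<alpha>) produces the plain primitive.\<close>

lemma RL_Uhat:
  assumes t: "t \<le> T"
  shows "RL (1 - \<alpha>) (\<lambda>s. Uhat \<alpha> N P U s - U 0) t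
    = (LINT s:{0..t}|lebesgue. step_fun N P (discrete_caputo \<alpha> N P U) s)"
proof -
  have "RL (1 - \<alpha>) (\<lambda>s. Uhat \<alpha> N P U s - U 0) t = RL (1 - \<alpha>) (RL \<alpha> (step_fun N P (discrete_caputo \<alpha> N P U))) t"
    by (rule RL_cong) (use t in \<open>auto simp: Uhat_eq_RL\<close>)
  also have "\<dots> = RL 1 (step_fun N P (discrete_caputo \<alpha> N P U)) t"
    using RL_RL[of "1 - \<alpha>" \<alpha> t, OF _ _ _ step_fun_integrable] \<alpha> by simp
  finally show ?thesis by (simp only: RL_1)
qed

text \<open>The step function is one Caputo derivative of \<open>Uhat\<close>, so the chosen
  representative is a derivative as well. Both have the same primitive and therefore agree almost
  everywhere.\<close>

lemma caputo_deriv_Uhat: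
  "AE t in lebesgue. 0 \<le> t \<and> t < T \<longrightarrow>
     caputo_deriv \<alpha> T (U 0) (Uhat \<alpha> N P U) t = step_fun N P (discrete_caputo \<alpha> N P U) t"
proof (rule AE_eq_if_primitive_eq)
  have ui: "set_integrable lebesgue {0..S} (Uhat \<alpha> N P U)" if "S < T" for S
    by (rule set_integrable_continuous_Icc, rule continuous_on_subset[OF continuous_on_Uhat]) (use that in auto)
  have "has_caputo_deriv \<alpha> T (U 0) (Uhat \<alpha> N P U) (step_fun N P (discrete_caputo \<alpha> N P U))"
    by (rule has_caputo_deriv_primitive[OF T]) (use ui RL_Uhat in \<open>auto intro: step_fun_integrable\<close>)
  then have cap: "has_caputo_deriv \<alpha> T (U 0) (Uhat \<alpha> N P U) (caputo_deriv \<alpha> T (U 0) (Uhat \<alpha> N P U))"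
    unfolding caputo_deriv_def
    by (rule someI[where P = "has_caputo_deriv \<alpha> T (U 0) (Uhat \<alpha> N P U)"])
  then show "set_integrable lebesgue {0..S} (caputo_deriv \<alpha> T (U 0) (Uhat \<alpha> N P U))" if "S < T" for S
    using that by (auto simp: has_caputo_deriv_def L1loc_space_def)
  show "set_integrable lebesgue {0..S} (step_fun N P (discrete_caputo \<alpha> N P U))" for S
    by (rule step_fun_integrable)
  show "(LINT s:{0..t}|lebesgue. caputo_deriv \<alpha> T (U 0) (Uhat \<alpha> N P U) s)
      = (LINT s:{0..t}|lebesgue. step_fun N P (discrete_caputo \<alpha> N P U) s)" if "0 \<le> t" "t < T" for t
    using caputo_deriv_primitive[OF \<alpha> continuous_on_Uhat cap that] RL_Uhat[of t] that by simp
qed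

end

text \<open>An energy solution attains u0 only in the mean. For continuous u the means of |u - u0|^2
  over [0, t] converge to its value at 0, which must then be zero.\<close>

lemma energy_solution_initial:
  fixes u :: "real \<Rightarrow> 'a::{real_inner, banach, second_countable_topology}"
  assumes T: "0 < T" and sol: "energy_solution \<alpha> T \<Phi> f u0 u" and u: "continuous_on {0..T} u"
  shows "u 0 = u0"
proof -
  define q where "q = (\<lambda>s. (norm (u s - u0))\<^sup>2)"
  have cq: "continuous_on {0..T} q" unfolding q_def by (intro continuous_intros u)
  have lim: "((\<lambda>t. (1 / t) * (LINT s:{0..t}|lebesgue. q s)) \<longlongrightarrow> 0) (at_right 0)"
    using sol by (simp add: energy_solution_def q_def)
  have d: "((\<lambda>t. integral {0..t} q) has_vector_derivative q 0) (at 0 within {0..T})"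
    by (rule integral_has_vector_derivative[OF cq]) (use T in auto)
  then have "((\<lambda>t. (integral {0..t} q - 0) / (t - 0)) \<longlongrightarrow> q 0) (at 0 within {0..T})"
    by (simp add: has_real_derivative_iff_has_vector_derivative[symmetric] has_field_derivative_iff)
  then have "((\<lambda>t. (integral {0..t} q - 0) / (t - 0)) \<longlongrightarrow> q 0) (at_right 0)"
    using T by (simp add: at_within_Icc_at_right)
  moreover have "\<forall>\<^sub>F t in at_right 0. (integral {0..t} q - 0) / (t - 0) = (1 / t) * (LINT s:{0..t}|lebesgue. q s)"
  proof (rule eventually_at_rightI[OF _ T])
    fix t assume "t \<in> {0<..<T}"
    then have "set_integrable lebesgue {0..t} q"
      by (intro set_integrable_continuous_Icc continuous_on_subset[OF cq]) auto
    then show "(integral {0..t} q - 0) / (t - 0) = (1 / t) * (LINT s:{0..t}|lebesgue. q s)"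
      by (simp add: set_lebesgue_integral_eq_integral(2))
  qed
  ultimately have "((\<lambda>t. (1 / t) * (LINT s:{0..t}|lebesgue. q s)) \<longlongrightarrow> q 0) (at_right 0)"
    by (rule Lim_transform_eventually)
  then have "q 0 = 0" using tendsto_unique[OF _ _ lim] by simp
  then show ?thesis by (simp add: q_def)
qed

section \<open>The error bound\<close>

lemma ennreal_powr_half_square: "(ennreal_powr x (1 / 2))\<^sup>2 = x"
proof (cases "x = top")
  case False
  then have "(ennreal (enn2real x powr (1 / 2)))\<^sup>2 = ennreal ((sqrt (enn2real x))\<^sup>2)"
    by (simp add: powr_half_sqrt ennreal_power)
  then show ?thesis using False by (simp add: ennreal_powr_def less_top)
qed (simp add: ennreal_powr_def power2_eq_square)

lemma ennreal_powr_1: "ennreal_powr x 1 = x"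
  by (cases "x = top") (auto simp: ennreal_powr_def less_top powr_one)

lemma ennreal_powr_half: "0 \<le> x \<Longrightarrow> ennreal_powr (ennreal x) (1 / 2) = ennreal (sqrt x)"
  by (simp add: ennreal_powr_def powr_half_sqrt)

lemma Lpa_norm_ext_1: "Lpa_norm_ext 1 \<alpha> T g = (SUP t\<in>{0..T}. weighted_int \<alpha> g t)"
  by (simp add: Lpa_norm_ext_def ennreal_powr_1)

lemma weighted_int_mono_AE:
  assumes "AE s in lebesgue. s \<in> {0<..<T} \<longrightarrow> g s \<le> g' s" and "t \<le> T"
  shows "weighted_int \<alpha> g t \<le> weighted_int \<alpha> g' t"
  unfolding weighted_int_def
proof (rule nn_integral_mono_AE)
  show "AE s in lebesgue. ennreal ((t - s) powr (\<alpha> - 1)) * g s * indicator {0..t} s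
      \<le> ennreal ((t - s) powr (\<alpha> - 1)) * g' s * indicator {0..t} s"
    using assms(1) AE_completion[OF AE_lborel_singleton[of 0]] AE_completion[OF AE_lborel_singleton[of T]]
  proof eventually_elim
    case (elim s)
    then show ?case using assms(2) by (auto simp: indicator_def intro!: mult_left_mono)
  qed
qed

lemma weighted_int_cong_AE:
  assumes "AE s in lebesgue. s \<in> {0<..<T} \<longrightarrow> g s = g' s" and "t \<le> T"
  shows "weighted_int \<alpha> g t = weighted_int \<alpha> g' t"
proof (rule antisym)
  show "weighted_int \<alpha> g t \<le> weighted_int \<alpha> g' t"
    by (rule weighted_int_mono_AE[OF _ assms(2)]) (use assms(1) in \<open>eventually_elim, auto\<close>)
  show "weighted_int \<alpha> g' t \<le> weighted_int \<alpha> g t"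
    by (rule weighted_int_mono_AE[OF _ assms(2)]) (use assms(1) in \<open>eventually_elim, auto\<close>)
qed

text \<open>The kernel \<open>kap\<close> contains the factor 1 / Gamma(\<alpha>) that
  \<open>weighted_int\<close> omits; this is the source of the constant in the error bound.\<close>

lemma frac_nn_weighted_int:
  assumes \<alpha>: "0 < \<alpha>" and t: "t \<le> T" and g: "(\<lambda>s. g s * indicator {0..T} s) \<in> borel_measurable lebesgue"
  shows "2 * frac_nn \<alpha> g t = ennreal (2 / Gamma \<alpha>) * weighted_int \<alpha> g t"
proof -
  have G: "0 < Gamma \<alpha>" using \<alpha> by (rule Gamma_real_pos)
  have "weighted_int \<alpha> g t = (\<integral>\<^sup>+ s. ennreal (Gamma \<alpha>) * (ennreal (kap \<alpha> (t - s)) * (g s * indicator {0..T} s)) \<partial>lebesgue)"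
    unfolding weighted_int_def
  proof (rule nn_integral_cong)
    fix s
    have "ennreal (Gamma \<alpha>) * ennreal (kap \<alpha> (t - s)) = ennreal ((t - s) powr (\<alpha> - 1))" if "s \<le> t"
    proof -
      \<comment> \<open>At s = t both sides are 0, since \<open>powr\<close> with base 0 yields
        0.\<close>
      have "Gamma \<alpha> * kap \<alpha> (t - s) = (t - s) powr (\<alpha> - 1)"
        using that G by (simp add: kap_def)
      then show ?thesis using G kap_nonneg[OF \<alpha>] by (simp add: ennreal_mult[symmetric])
    qed
    then show "ennreal ((t - s) powr (\<alpha> - 1)) * g s * indicator {0..t} s
        = ennreal (Gamma \<alpha>) * (ennreal (kap \<alpha> (t - s)) * (g s * indicator {0..T} s))"
      using t by (cases "s \<le> t") (auto simp: indicator_def kap_def mult.assoc[symmetric])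
  qed
  also have "\<dots> = ennreal (Gamma \<alpha>) * frac_nn \<alpha> g t"
    unfolding frac_nn_eq[OF t]
    by (rule nn_integral_cmult) (rule borel_measurable_times_ennreal[OF measurable_kap_diff g])
  finally have "ennreal (2 / Gamma \<alpha>) * weighted_int \<alpha> g t = (ennreal (2 / Gamma \<alpha>) * ennreal (Gamma \<alpha>)) * frac_nn \<alpha> g t"
    by (simp add: mult.assoc)
  also have "ennreal (2 / Gamma \<alpha>) * ennreal (Gamma \<alpha>) = 2"
    using G by (simp add: ennreal_mult[symmetric])
  finally show ?thesis by simp
qed

text \<open>The weight is bounded below by T^(\<alpha>-1) on [0, T). At s = T, where
  \<open>powr\<close> yields 0, this fails, but a single point is null.\<close>

lemma weighted_int_integrable:
  fixes w :: "real \<Rightarrow> 'a::{banach, second_countable_topology}"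
  assumes T: "0 < T" and \<alpha>: "\<alpha> < 1" and w: "set_borel_measurable lebesgue {0..T} w"
    and fin: "weighted_int \<alpha> (\<lambda>s. ennreal (norm (w s))) T < top"
  shows "set_integrable lebesgue {0..T} w"
  unfolding set_integrable_def
proof (rule integrableI_bounded)
  show m: "(\<lambda>s. indicator {0..T} s *\<^sub>R w s) \<in> borel_measurable lebesgue"
    using w by (simp add: set_borel_measurable_def)
  have "ennreal (T powr (\<alpha> - 1)) * (\<integral>\<^sup>+ s. ennreal (norm (indicator {0..T} s *\<^sub>R w s)) \<partial>lebesgue)
      = (\<integral>\<^sup>+ s. ennreal (T powr (\<alpha> - 1)) * ennreal (norm (indicator {0..T} s *\<^sub>R w s)) \<partial>lebesgue)"
    by (rule nn_integral_cmult[symmetric]) (use m in measurable)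
  also have "\<dots> \<le> weighted_int \<alpha> (\<lambda>s. ennreal (norm (w s))) T"
    unfolding weighted_int_def
  proof (rule nn_integral_mono_AE)
    show "AE s in lebesgue. ennreal (T powr (\<alpha> - 1)) * ennreal (norm (indicator {0..T} s *\<^sub>R w s))
        \<le> ennreal ((T - s) powr (\<alpha> - 1)) * ennreal (norm (w s)) * indicator {0..T} s"
      using AE_completion[OF AE_lborel_singleton[of T]]
    proof eventually_elim
      case (elim s)
      show ?case
      proof (cases "s \<in> {0..T}")
        case True
        then have "T powr (\<alpha> - 1) \<le> (T - s) powr (\<alpha> - 1)"
          using elim \<alpha> by (intro powr_mono2') auto
        then show ?thesis using True by (simp add: mult_right_mono ennreal_leI)
      qed simp
    qed
  qed
  finally have "ennreal (T powr (\<alpha> - 1)) * (\<integral>\<^sup>+ s. ennreal (norm (indicator {0..T} s *\<^sub>R w s)) \<partial>lebesgue) < top"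
    using fin by (rule le_less_trans)
  then show "(\<integral>\<^sup>+ s. ennreal (norm (indicator {0..T} s *\<^sub>R w s)) \<partial>lebesgue) < \<infinity>"
    using T by (auto simp: ennreal_mult_less_top)
qed

lemma L2_space_integrable:
  fixes w :: "real \<Rightarrow> 'a::{real_inner, banach, second_countable_topology}"
  assumes "w \<in> L2_space T"
  shows "set_integrable lebesgue {0..T} w"
proof -
  have "set_integrable lebesgue {0<..<T} w"
  proof (rule set_integrable_bound)
    have "set_integrable lebesgue {0<..<T} (\<lambda>t. 1::real)"
      by (rule set_integrable_subset[OF set_integrable_continuous_Icc[of 0 T]]) (auto intro!: continuous_intros)
    then show "set_integrable lebesgue {0<..<T} (\<lambda>t. 1 + (norm (w t))\<^sup>2)"
      using assms by (intro set_integral_add) (auto simp: L2_space_iff)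
    show "set_borel_measurable lebesgue {0<..<T} w" using assms by (simp add: L2_space_iff)
    show "AE t in lebesgue. t \<in> {0<..<T} \<longrightarrow> norm (w t) \<le> norm (1 + (norm (w t))\<^sup>2)"
    proof (intro AE_I2 impI)
      fix t
      have "0 \<le> (norm (w t) - 1)\<^sup>2" by simp
      then have "2 * norm (w t) \<le> 1 + (norm (w t))\<^sup>2" unfolding power2_diff by simp
      moreover have "0 \<le> norm (w t)" by simp
      ultimately have "norm (w t) \<le> 1 + (norm (w t))\<^sup>2" by linarith
      then show "norm (w t) \<le> norm (1 + (norm (w t))\<^sup>2)" by simp
    qed
  qed
  then show ?thesis
    unfolding set_integrable_def
    by (rule integrable_discrete_difference[of "{0, T}", THEN iffD1, rotated 4])
       (auto simp: indicator_def)
qed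

lemma subdiff_slack_nonneg:
  assumes "\<xi> \<in> subdiff \<Phi> w1" "\<Phi> w1 = ereal a" "\<Phi> w2 = ereal b"
  shows "0 \<le> b - a - \<xi> \<bullet> (w2 - w1)"
proof -
  have "ereal (\<xi> \<bullet> (w2 - w1)) \<le> \<Phi> w2 - \<Phi> w1" using assms(1) by (simp add: subdiff_def)
  then show ?thesis using assms(2,3) by simp
qed

text \<open>The modulus subtracts a supremum over all subgradients, so each particular one gives an
  upper bound. The subgradients used later are those provided by the equation and by the
  scheme.\<close>

lemma coerc_mod_le:
  assumes "\<xi> \<in> subdiff \<Phi> w1" "\<Phi> w1 = ereal a" "\<Phi> w2 = ereal b"
  shows "coerc_mod \<Phi> w1 w2 \<le> ereal (b - a - \<xi> \<bullet> (w2 - w1))"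
proof -
  have "ereal (\<xi> \<bullet> (w2 - w1)) \<le> (SUP \<xi>\<in>subdiff \<Phi> w1. ereal (\<xi> \<bullet> (w2 - w1)))"
    using assms(1) by (rule SUP_upper)
  then have "ereal (b - a) - (SUP \<xi>\<in>subdiff \<Phi> w1. ereal (\<xi> \<bullet> (w2 - w1))) \<le> ereal (b - a) - ereal (\<xi> \<bullet> (w2 - w1))"
    by (rule ereal_minus_mono[OF order_refl])
  then show ?thesis using assms(2,3) by (simp add: coerc_mod_def)
qed

text \<open>Bounds the right-hand side of the energy estimate by the weighted norms of the estimator
  er and of the data error d; c will be the maximal norm of u - \<open>Uhat\<close>.\<close>

lemma RL_le_of_norm_le:
  fixes p er d :: "real \<Rightarrow> real"
  assumes \<alpha>: "0 < \<alpha>" and t: "t \<le> T" and c: "0 \<le> c"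
    and er: "set_borel_measurable lebesgue {0..T} er" and d: "set_borel_measurable lebesgue {0..T} d"
    and p: "\<And>s. s \<in> {0..t} \<Longrightarrow> \<bar>p s\<bar> \<le> \<bar>er s\<bar> + c * \<bar>d s\<bar>"
    and i: "set_integrable lebesgue {0..t} (\<lambda>s. kap \<alpha> (t - s) * p s)"
    and A: "ennreal (2 / Gamma \<alpha>) * weighted_int \<alpha> (\<lambda>s. ennreal \<bar>er s\<bar>) t \<le> ennreal A" "0 \<le> A"
    and B: "ennreal (2 / Gamma \<alpha>) * weighted_int \<alpha> (\<lambda>s. ennreal \<bar>d s\<bar>) t \<le> ennreal B" "0 \<le> B"
  shows "2 * RL \<alpha> p t \<le> A + B * c"
proof -
  have m: "(\<lambda>s. ennreal \<bar>w s\<bar> * indicator {0..T} s) \<in> borel_measurable lebesgue"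
    if "set_borel_measurable lebesgue {0..T} w" for w :: "real \<Rightarrow> real"
  proof -
    have "(\<lambda>s. ennreal \<bar>indicator {0..T} s *\<^sub>R w s\<bar>) \<in> borel_measurable lebesgue"
      using that unfolding set_borel_measurable_def by measurable
    also have "(\<lambda>s. ennreal \<bar>indicator {0..T} s *\<^sub>R w s\<bar>) = (\<lambda>s. ennreal \<bar>w s\<bar> * indicator {0..T} s)"
      by (auto simp: indicator_def)
    finally show ?thesis .
  qed
  have m1: "(\<lambda>s. ennreal (kap \<alpha> (t - s)) * (ennreal \<bar>er s\<bar> * indicator {0..T} s)) \<in> borel_measurable lebesgue"
    and m2: "(\<lambda>s. ennreal (kap \<alpha> (t - s)) * (ennreal \<bar>d s\<bar> * indicator {0..T} s)) \<in> borel_measurable lebesgue"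
    by (rule borel_measurable_times_ennreal[OF measurable_kap_diff m[OF er]],
        rule borel_measurable_times_ennreal[OF measurable_kap_diff m[OF d]])
  have "ennreal \<bar>RL \<alpha> p t\<bar> \<le> (\<integral>\<^sup>+ s. ennreal (norm (indicator {0..t} s *\<^sub>R (kap \<alpha> (t - s) * p s))) \<partial>lebesgue)"
    using integral_norm_bound_ennreal[OF i[unfolded set_integrable_def]]
    by (simp add: RL_def set_lebesgue_integral_def)
  also have "\<dots> \<le> (\<integral>\<^sup>+ s. ennreal (kap \<alpha> (t - s)) * (ennreal \<bar>er s\<bar> * indicator {0..T} s)
      + ennreal c * (ennreal (kap \<alpha> (t - s)) * (ennreal \<bar>d s\<bar> * indicator {0..T} s)) \<partial>lebesgue)"
  proof (rule nn_integral_mono)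
    fix s
    have k: "0 \<le> kap \<alpha> (t - s)" using \<alpha> by (rule kap_nonneg)
    show "ennreal (norm (indicator {0..t} s *\<^sub>R (kap \<alpha> (t - s) * p s)))
        \<le> ennreal (kap \<alpha> (t - s)) * (ennreal \<bar>er s\<bar> * indicator {0..T} s)
          + ennreal c * (ennreal (kap \<alpha> (t - s)) * (ennreal \<bar>d s\<bar> * indicator {0..T} s))"
    proof (cases "s \<in> {0..t}")
      case True
      have "kap \<alpha> (t - s) * \<bar>p s\<bar> \<le> kap \<alpha> (t - s) * (\<bar>er s\<bar> + c * \<bar>d s\<bar>)"
        by (rule mult_left_mono[OF p[OF True] k])
      then have "kap \<alpha> (t - s) * \<bar>p s\<bar> \<le> kap \<alpha> (t - s) * \<bar>er s\<bar> + c * (kap \<alpha> (t - s) * \<bar>d s\<bar>)"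
        by (simp add: algebra_simps)
      then have "ennreal (kap \<alpha> (t - s) * \<bar>p s\<bar>) \<le> ennreal (kap \<alpha> (t - s) * \<bar>er s\<bar> + c * (kap \<alpha> (t - s) * \<bar>d s\<bar>))"
        by (rule ennreal_leI)
      also have "\<dots> = ennreal (kap \<alpha> (t - s)) * ennreal \<bar>er s\<bar> + ennreal c * (ennreal (kap \<alpha> (t - s)) * ennreal \<bar>d s\<bar>)"
        using k c by (simp add: ennreal_plus ennreal_mult)
      finally show ?thesis using True t k by (simp add: abs_mult)
    qed simp
  qed
  also have "\<dots> = frac_nn \<alpha> (\<lambda>s. ennreal \<bar>er s\<bar>) t + ennreal c * frac_nn \<alpha> (\<lambda>s. ennreal \<bar>d s\<bar>) t"
    unfolding frac_nn_eq[OF t]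
    by (subst nn_integral_add[OF m1 borel_measurable_times_ennreal[OF borel_measurable_const m2]])
       (simp add: nn_integral_cmult[OF m2])
  finally have "2 * ennreal \<bar>RL \<alpha> p t\<bar> \<le> 2 * (frac_nn \<alpha> (\<lambda>s. ennreal \<bar>er s\<bar>) t + ennreal c * frac_nn \<alpha> (\<lambda>s. ennreal \<bar>d s\<bar>) t)"
    by (rule mult_left_mono) simp
  also have "\<dots> = 2 * frac_nn \<alpha> (\<lambda>s. ennreal \<bar>er s\<bar>) t + ennreal c * (2 * frac_nn \<alpha> (\<lambda>s. ennreal \<bar>d s\<bar>) t)"
    by (simp add: distrib_left mult.left_commute)
  also have "\<dots> \<le> ennreal A + ennreal c * ennreal B"
    unfolding frac_nn_weighted_int[OF \<alpha> t m[OF er]] frac_nn_weighted_int[OF \<alpha> t m[OF d]]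
    by (intro add_mono mult_left_mono A B) simp
  also have "\<dots> = ennreal (A + B * c)"
    using A(2) B(2) c by (simp add: ennreal_mult ennreal_plus mult.commute)
  also have "2 * ennreal \<bar>RL \<alpha> p t\<bar> = ennreal (2 * \<bar>RL \<alpha> p t\<bar>)" by (simp add: ennreal_mult)
  finally have "2 * \<bar>RL \<alpha> p t\<bar> \<le> A + B * c"
    using A(2) B(2) c by (subst (asm) ennreal_le_iff) auto
  then show ?thesis by linarith
qed

text \<open>With x = sqrt(m) the hypothesis reads x (x - b) \<le> a. If x exceeded sqrt(a) + b, then
  x and x - b would both exceed sqrt(a).\<close>

lemma sqrt_le_of_quadratic:
  fixes m a b :: real
  assumes "0 \<le> m" "0 \<le> a" "0 \<le> b" "m \<le> a + b * sqrt m"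
  shows "sqrt m \<le> sqrt a + b"
proof (rule ccontr)
  assume "\<not> ?thesis"
  then have lt: "sqrt a + b < sqrt m" by simp
  have "sqrt a < sqrt m" "sqrt a < sqrt m - b" "0 \<le> sqrt a"
    using lt assms(3) real_sqrt_ge_zero[OF assms(2)] by linarith+
  then have "sqrt a * sqrt a < sqrt m * (sqrt m - b)"
    by (intro mult_strict_mono')
  then show False using assms by (simp add: algebra_simps)
qed

theorem theorem5p3:
  fixes T \<alpha> :: real
    and \<Phi> :: "'a::{real_inner, banach, second_countable_topology} \<Rightarrow> ereal"
    and f u :: "real \<Rightarrow> 'a" and u0 :: 'a
    and N :: nat and P :: "nat \<Rightarrow> real" and U :: "nat \<Rightarrow> 'a"
  assumes "0 < T" and "0 < \<alpha>" and "\<alpha> < 1"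
    and "convex_ext \<Phi>" and "lower_semicont \<Phi>" and "effdom \<Phi> \<noteq> {}" and "bounded_from_below \<Phi>"
    and "u0 \<in> effdom \<Phi>"
    and "f \<in> Lpa_space 2 \<alpha> T"
    and "energy_solution \<alpha> T \<Phi> f u0 u"
    and continuous_representative: "continuous_on {0..T} u"
    and "is_partition T N P"
    and "U 0 \<in> effdom \<Phi>"
    and "discrete_solution \<alpha> N P \<Phi> f U"
  shows "total_err \<alpha> T N P \<Phi> u U
    \<le> ennreal_powr
         (ennreal ((norm (u0 - U 0))\<^sup>2)
          + ennreal (2 / Gamma \<alpha>) * Lpa_norm_ext 1 \<alpha> T (\<lambda>t. e2ennreal \<bar>estimator \<alpha> T N P \<Phi> f U t\<bar>))
         (1 / 2)
      + ennreal (2 / Gamma \<alpha>) * Lpa_norm 1 \<alpha> T (\<lambda>t. f t - Fbar N P f t)"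
proof -
  note T = assms(1) and \<alpha> = assms(2,3) and lsc = assms(5) and u0 = assms(8) and sol = assms(10)
    and u = assms(11) and P = assms(12) and U0 = assms(13) and dsol = assms(14)
  obtain c where c: "\<And>w. ereal c \<le> \<Phi> w" using assms(7) by (auto simp: bounded_from_below_def)
  define k where "k = 2 / Gamma \<alpha>"
  have k: "0 < k" using \<alpha> by (simp add: k_def Gamma_real_pos)
  define est where "est = (\<lambda>t. e2ennreal \<bar>estimator \<alpha> T N P \<Phi> f U t\<bar>)"
  define EE where "EE = Lpa_norm_ext 1 \<alpha> T est"
  define FF where "FF = Lpa_norm 1 \<alpha> T (\<lambda>t. f t - Fbar N P f t)"
  have goal: "total_err \<alpha> T N P \<Phi> u U
      \<le> ennreal_powr (ennreal ((norm (u0 - U 0))\<^sup>2) + ennreal k * EE) (1 / 2) + ennreal k * FF"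
  \<comment> \<open>An infinite right-hand side leaves nothing to prove. Otherwise the finite norm
    of the estimator gives finite energy of \<open>Uhat\<close> almost everywhere.\<close>
  proof (cases "EE = top \<or> FF = top")
    case True
    then show ?thesis
      using k by (auto simp: ennreal_mult_top ennreal_powr_def)
  next
    case False
    then have EE: "EE < top" and FF: "FF < top" by (auto simp: less_top)
    define eA where "eA = enn2real (ennreal k * EE)"
    define b where "b = enn2real (ennreal k * FF)"
    have eA: "ennreal k * EE = ennreal eA" "0 \<le> eA"
      using EE by (auto simp: eA_def ennreal_mult_less_top)
    have b: "ennreal k * FF = ennreal b" "0 \<le> b"
      using FF by (auto simp: b_def ennreal_mult_less_top)

    \<comment> \<open>Measurable representatives and the difference of the two solutions\<close>
    define Dc where "Dc = discrete_caputo \<alpha> N P U"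
    define D where "D = step_fun N P Dc"
    define F where "F = step_fun N P (avg_rhs P f)"
    define Ub where "Ub = step_fun N P U"
    define Uh where "Uh = Uhat \<alpha> N P U"
    define v where "v = (\<lambda>t. u t - Uh t)"
    define g where "g = caputo_deriv \<alpha> T u0 u"
    define h where "h = (\<lambda>t. g t - D t)"
    define d where "d = (\<lambda>t. f t - F t)"
    define \<phi> where "\<phi> = (\<lambda>w. real_of_ereal (\<Phi> w))"
    \<comment> \<open>The estimator with real values, the Caputo derivative of \<open>Uhat\<close>
      being replaced by the step function D.\<close>
    define er where "er = (\<lambda>t. (D t - F t) \<bullet> (Uh t - Ub t) + \<phi> (Uh t) - \<phi> (Ub t))"
    define p where "p = (\<lambda>t. er t + d t \<bullet> v t)"
    have fin: "\<Phi> w = ereal (\<phi> w)" if "\<Phi> w < \<infinity>" for w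
      using that c[of w] by (cases "\<Phi> w") (auto simp: \<phi>_def)
    have \<Phi>m: "\<Phi> \<in> borel_measurable borel" by (rule lower_semicont_measurable[OF lsc])
    have \<phi>m: "\<phi> \<in> borel_measurable borel" unfolding \<phi>_def using \<Phi>m by measurable
    have cUh: "continuous_on {0..T} Uh" unfolding Uh_def by (rule continuous_on_Uhat[OF \<alpha> T P])
    have cv: "continuous_on {0..T} v" unfolding v_def by (intro continuous_intros u cUh)
    have v0: "v 0 = u0 - U 0"
      using energy_solution_initial[OF T sol u] Uhat_0[OF \<alpha> T P] by (simp add: v_def Uh_def)
    \<comment> \<open>The maximal norm of v is the factor that Cauchy-Schwarz puts in front of the
      data error.\<close>
    obtain tm where tm: "tm \<in> {0..T}" "\<And>s. s \<in> {0..T} \<Longrightarrow> norm (v s) \<le> norm (v tm)"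
      using continuous_attains_sup[OF compact_Icc _ continuous_on_norm[OF cv]] T by auto

    \<comment> \<open>Integrability and the Caputo derivative of the difference\<close>
    have fL2: "f \<in> L2_space T" by (rule Lpa_space_2_L2[OF T \<alpha>(2) assms(9)])
    have gL2: "g \<in> L2_space T" using sol by (simp add: energy_solution_def g_def)
    have Di: "set_integrable lebesgue {0..S} D" "set_integrable lebesgue {0..S} F" for S
      unfolding D_def F_def by (rule step_fun_integrable)+
    have h: "set_integrable lebesgue {0..T} h"
      unfolding h_def using L2_space_integrable[OF gL2] Di by (intro set_integral_diff) auto
    have d: "set_integrable lebesgue {0..T} d"
      unfolding d_def using L2_space_integrable[OF fL2] Di by (intro set_integral_diff) auto
    have cap_u: "has_caputo_deriv \<alpha> T u0 u g"
      using sol unfolding energy_solution_def g_def caputo_deriv_def by (metis someI_ex)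
    have vh: "RL (1 - \<alpha>) (\<lambda>s. v s - v 0) t = (LINT s:{0..t}|lebesgue. h s)" if t: "0 \<le> t" "t < T" for t
    proof -
      have sub: "{0..t} \<subseteq> {0..T}" using t by auto
      have c1: "continuous_on {0..t} (\<lambda>s. u s - u0)" and c2: "continuous_on {0..t} (\<lambda>s. Uh s - U 0)"
        by (rule continuous_on_diff[OF continuous_on_subset[OF u sub] continuous_on_const],
            rule continuous_on_diff[OF continuous_on_subset[OF cUh sub] continuous_on_const])
      have a1: "0 < 1 - \<alpha>" using \<alpha> by simp
      note i1 = RL_integrable_continuous[OF a1 c1 order_refl]
        and i2 = RL_integrable_continuous[OF a1 c2 order_refl]
      have "RL (1 - \<alpha>) (\<lambda>s. v s - v 0) t = RL (1 - \<alpha>) (\<lambda>s. u s - u0) t - RL (1 - \<alpha>) (\<lambda>s. Uh s - U 0) t"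
      proof -
        have "kap (1 - \<alpha>) (t - s) *\<^sub>R (u s - u0) - kap (1 - \<alpha>) (t - s) *\<^sub>R (Uh s - U 0)
            = kap (1 - \<alpha>) (t - s) *\<^sub>R (u s - Uh s - (u0 - U 0))" for s
          by (simp add: algebra_simps)
        then show ?thesis
          unfolding RL_def set_integral_diff(2)[OF i1 i2, symmetric] v0 by (simp only: v_def)
      qed
      also have "\<dots> = (LINT s:{0..t}|lebesgue. g s) - (LINT s:{0..t}|lebesgue. D s)"
        using caputo_deriv_primitive[OF \<alpha> u cap_u t] RL_Uhat[OF \<alpha> T P, of t U] t
        by (simp add: Uh_def D_def Dc_def)
      also have "\<dots> = (LINT s:{0..t}|lebesgue. h s)"
        unfolding h_def
        using set_integral_diff(2)[OF set_integrable_subset[OF L2_space_integrable[OF gL2] _ sub] Di(1)] by simp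
      finally show ?thesis .
    qed

    \<comment> \<open>Subgradient inclusions of the equation and of the scheme\<close>
    have sub_u: "AE t in lebesgue. t \<in> {0<..<T} \<longrightarrow> f t - g t \<in> subdiff \<Phi> (u t)"
      unfolding g_def by (rule energy_solution_subdiff[OF T lsc c u0 fL2 sol])
    have sub_U: "F t - D t \<in> subdiff \<Phi> (Ub t)" if t: "t \<in> {0<..<T}" for t
    proof -
      have t': "0 < t" "t \<le> T" using t by auto
      show ?thesis
        using dsol interval_index_works(1)[OF P t']
        unfolding F_def D_def Ub_def Dc_def step_fun_eq[OF P t'] discrete_solution_def by blast
    qed
    have \<Phi>Ub: "\<Phi> (Ub t) = ereal (\<phi> (Ub t))" if "t \<in> {0<..<T}" for t
      by (rule fin, rule subdiff_dom[OF sub_U[OF that] u0 c])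

    \<comment> \<open>Finiteness and integrability of the estimator\<close>
    have est_eq: "AE t in lebesgue. t \<in> {0<..<T} \<longrightarrow>
        est t = e2ennreal \<bar>ereal ((D t - F t) \<bullet> (Uh t - Ub t)) + \<Phi> (Uh t) - \<Phi> (Ub t)\<bar>"
      using caputo_deriv_Uhat[OF \<alpha> T P, of U]
    proof eventually_elim
      case (elim t)
      show ?case
      proof
        assume t: "t \<in> {0<..<T}"
        then have t': "0 < t" "t \<le> T" by auto
        show "est t = e2ennreal \<bar>ereal ((D t - F t) \<bullet> (Uh t - Ub t)) + \<Phi> (Uh t) - \<Phi> (Ub t)\<bar>"
          using elim t unfolding est_def estimator_def F_def D_def Ub_def Dc_def Uh_def Fbar_def Ubar_def
          by (simp add: step_fun_eq[OF P t'])
      qed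
    qed
    have wE: "weighted_int \<alpha> est t \<le> EE" if "t \<in> {0..T}" for t
      unfolding EE_def Lpa_norm_ext_1 by (rule SUP_upper[OF that])
    have Uhm: "(\<lambda>t. indicator {0..T} t *\<^sub>R Uh t) \<in> borel_measurable lebesgue"
      using set_borel_measurable_continuous_Icc[OF cUh] by (simp add: set_borel_measurable_def)
    define B where "B = {t \<in> {0<..<T}. \<Phi> (Uh t) = \<infinity>}"
    have B: "B \<in> sets lebesgue"
    proof -
      have "(\<lambda>t. \<Phi> (indicator {0..T} t *\<^sub>R Uh t)) \<in> borel_measurable lebesgue"
        by (rule measurable_compose[OF Uhm \<Phi>m])
      then have "{t \<in> space lebesgue. \<Phi> (indicator {0..T} t *\<^sub>R Uh t) = \<infinity>} \<in> sets lebesgue"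
        by (intro borel_measurable_eq) auto
      then have "{0<..<T} \<inter> {t \<in> space lebesgue. \<Phi> (indicator {0..T} t *\<^sub>R Uh t) = \<infinity>} \<in> sets lebesgue"
        by (intro sets.Int) auto
      also have "{0<..<T} \<inter> {t \<in> space lebesgue. \<Phi> (indicator {0..T} t *\<^sub>R Uh t) = \<infinity>} = B"
        by (auto simp: B_def)
      finally show ?thesis .
    qed
    \<comment> \<open>On B the estimator is infinite, because the energy of \<open>Ub\<close> is
      finite there. A finite weighted norm with a positive weight therefore forces B to be
      null.\<close>
    have Uh_fin: "AE t in lebesgue. t \<in> {0<..<T} \<longrightarrow> \<Phi> (Uh t) < \<infinity>"
    proof -
      have "weighted_int \<alpha> (\<lambda>t. top * indicator B t) T \<le> weighted_int \<alpha> est T"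
      proof (rule weighted_int_mono_AE[OF _ order_refl])
        show "AE t in lebesgue. t \<in> {0<..<T} \<longrightarrow> top * indicator B t \<le> est t"
          using est_eq by eventually_elim (auto simp: B_def indicator_def \<Phi>Ub)
      qed
      also have "\<dots> < \<infinity>" using wE[of T] EE T by (auto intro: le_less_trans)
      finally have lt: "(\<integral>\<^sup>+ s. ennreal ((T - s) powr (\<alpha> - 1)) * (top * indicator B s) * indicator {0..T} s \<partial>lebesgue) \<noteq> \<infinity>"
        by (simp add: weighted_int_def)
      have "(\<lambda>s. ennreal ((T - s) powr (\<alpha> - 1))) \<in> borel_measurable lebesgue"
        by (rule measurable_completion) measurable
      then have "AE s in lebesgue. ennreal ((T - s) powr (\<alpha> - 1)) * (top * indicator B s) * indicator {0..T} s \<noteq> \<infinity>"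
        using B by (intro nn_integral_PInf_AE[OF _ lt] borel_measurable_times_ennreal borel_measurable_indicator) auto
      then show ?thesis
      proof eventually_elim
        case (elim s)
        show ?case
        proof (rule impI, rule ccontr)
          assume s: "s \<in> {0<..<T}" and "\<not> \<Phi> (Uh s) < \<infinity>"
          then have "s \<in> B" by (auto simp: B_def)
          moreover have "0 < (T - s) powr (\<alpha> - 1)" using s by simp
          ultimately show False using elim s by (auto simp: ennreal_mult_top)
        qed
      qed
    qed
    have est_er: "AE t in lebesgue. t \<in> {0<..<T} \<longrightarrow> est t = ennreal \<bar>er t\<bar>"
      using est_eq Uh_fin
    proof eventually_elim
      case (elim t)
      show ?case
      proof
        assume t: "t \<in> {0<..<T}"
        have "ereal ((D t - F t) \<bullet> (Uh t - Ub t)) + \<Phi> (Uh t) - \<Phi> (Ub t) = ereal (er t)"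
          using fin[of "Uh t"] elim t \<Phi>Ub[OF t] by (simp add: er_def)
        then show "est t = ennreal \<bar>er t\<bar>" using elim t by simp
      qed
    qed
    have er_m: "set_borel_measurable lebesgue {0..T} er"
    proof -
      have m: "D \<in> borel_measurable lebesgue" "F \<in> borel_measurable lebesgue" "Ub \<in> borel_measurable lebesgue"
        unfolding D_def F_def Ub_def by (intro measurable_completion, measurable)+
      have "(\<lambda>t. indicator {0..T} t *\<^sub>R ((D t - F t) \<bullet> (indicator {0..T} t *\<^sub>R Uh t - Ub t)
          + \<phi> (indicator {0..T} t *\<^sub>R Uh t) - \<phi> (Ub t))) \<in> borel_measurable lebesgue"
        by (intro borel_measurable_scaleR borel_measurable_indicator borel_measurable_diff borel_measurable_add
            borel_measurable_inner m Uhm measurable_compose[OF Uhm \<phi>m] measurable_compose[OF m(3) \<phi>m]) auto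
      also have "(\<lambda>t. indicator {0..T} t *\<^sub>R ((D t - F t) \<bullet> (indicator {0..T} t *\<^sub>R Uh t - Ub t)
          + \<phi> (indicator {0..T} t *\<^sub>R Uh t) - \<phi> (Ub t))) = (\<lambda>t. indicator {0..T} t *\<^sub>R er t)"
        by (auto simp: indicator_def er_def)
      finally show ?thesis by (simp add: set_borel_measurable_def)
    qed
    have w_er: "weighted_int \<alpha> (\<lambda>s. ennreal \<bar>er s\<bar>) t \<le> EE" if "t \<in> {0..T}" for t
      using wE[OF that] weighted_int_cong_AE[OF est_er, of t \<alpha>] that by simp
    have er: "set_integrable lebesgue {0..T} er"
      by (rule weighted_int_integrable[OF T \<alpha>(2) er_m]) (use w_er[of T] EE T in \<open>auto intro: le_less_trans\<close>)
    have w_d: "weighted_int \<alpha> (\<lambda>s. ennreal (norm (d s))) t \<le> FF" if t: "t \<in> {0..T}" for t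
    proof -
      have "weighted_int \<alpha> (\<lambda>s. ennreal (norm (d s))) t = weighted_int \<alpha> (\<lambda>s. ennreal (norm (f s - Fbar N P f s))) t"
        by (rule weighted_int_cong_AE[of T])
           (use t in \<open>auto simp: d_def F_def Fbar_def step_fun_eq[OF P]\<close>)
      also have "\<dots> \<le> FF" unfolding FF_def Lpa_norm_ext_1 by (rule SUP_upper[OF t])
      finally show ?thesis .
    qed
    have p: "set_integrable lebesgue {0..T} p"
      unfolding p_def using er set_integrable_inner_continuous[OF cv d] by (rule set_integral_add)

    \<comment> \<open>Pointwise inequality between moduli, estimator and data error\<close>
    have slack: "AE t in lebesgue. t \<in> {0<..<T} \<longrightarrow> h t \<bullet> v t \<le> p t \<and>
        e2ennreal (coerc_mod \<Phi> (u t) (Uhat \<alpha> N P U t) + coerc_mod \<Phi> (Ubar N P U t) (u t)) \<le> ennreal (p t - h t \<bullet> v t)"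
      using sub_u Uh_fin
    proof eventually_elim
      case (elim t)
      show ?case
      proof
        assume t: "t \<in> {0<..<T}"
        then have s1: "f t - g t \<in> subdiff \<Phi> (u t)" and s2: "F t - D t \<in> subdiff \<Phi> (Ub t)"
          and \<Phi>u: "\<Phi> (u t) = ereal (\<phi> (u t))" and \<Phi>Uh: "\<Phi> (Uh t) = ereal (\<phi> (Uh t))"
          using elim sub_U[OF t] fin[of "u t"] subdiff_dom[OF _ u0 c] fin[of "Uh t"] by auto
        have Ubar: "Ubar N P U t = Ub t" using t by (simp add: Ubar_def Ub_def step_fun_eq[OF P])
        \<comment> \<open>Slacks of the two subgradient inequalities: at u tested with
          \<open>Uh\<close>, and at \<open>Ub\<close> tested with u. In the sum the energy of u
          cancels, and writing u - \<open>Ub\<close> = v + (\<open>Uh\<close> - \<open>Ub\<close>)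
          regroups the inner products into estimator, data term and - h \<bullet> v.\<close>
        define r1 where "r1 = \<phi> (Uh t) - \<phi> (u t) - (f t - g t) \<bullet> (Uh t - u t)"
        define r2 where "r2 = \<phi> (u t) - \<phi> (Ub t) - (F t - D t) \<bullet> (u t - Ub t)"
        have r: "r1 + r2 = p t - h t \<bullet> v t"
          by (simp add: r1_def r2_def p_def er_def h_def v_def d_def inner_diff_left inner_diff_right)
        have "0 \<le> r1" "0 \<le> r2"
          unfolding r1_def r2_def
          by (rule subdiff_slack_nonneg[OF s1 \<Phi>u \<Phi>Uh], rule subdiff_slack_nonneg[OF s2 \<Phi>Ub[OF t] \<Phi>u])
        moreover have "coerc_mod \<Phi> (u t) (Uh t) + coerc_mod \<Phi> (Ub t) (u t) \<le> ereal r1 + ereal r2"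
          unfolding r1_def r2_def
          by (intro add_mono coerc_mod_le[OF s1 \<Phi>u \<Phi>Uh] coerc_mod_le[OF s2 \<Phi>Ub[OF t] \<Phi>u])
        ultimately show "h t \<bullet> v t \<le> p t \<and>
            e2ennreal (coerc_mod \<Phi> (u t) (Uhat \<alpha> N P U t) + coerc_mod \<Phi> (Ubar N P U t) (u t)) \<le> ennreal (p t - h t \<bullet> v t)"
          using e2ennreal_mono[of "coerc_mod \<Phi> (u t) (Uh t) + coerc_mod \<Phi> (Ub t) (u t)" "ereal (r1 + r2)"] r
          by (simp add: Ubar Uh_def)
      qed
    qed

    \<comment> \<open>Energy bound in terms of the maximal norm of the difference\<close>
    define C where "C = (norm (u0 - U 0))\<^sup>2 + eA + b * norm (v tm)"
    have C0: "0 \<le> C" using eA b by (simp add: C_def)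
    \<comment> \<open>The constant C still contains the unknown maximum \<open>norm (v tm)\<close>;
      it is absorbed once the supremum defining the error has been formed.\<close>
    have bound: "ennreal ((norm (v t))\<^sup>2) + 2 * frac_nn \<alpha> (\<lambda>s. ennreal (p s - h s \<bullet> v s)) t \<le> ennreal C"
      if t: "t \<in> {0..T}" for t
    proof (rule fractional_energy_bound[OF \<alpha> T cv h p vh _ _ t])
      show "AE s in lebesgue. s \<in> {0<..<T} \<longrightarrow> h s \<bullet> v s \<le> p s"
        using slack by eventually_elim auto
      fix t assume t: "0 \<le> t" "t < T" and i: "set_integrable lebesgue {0..t} (\<lambda>s. kap \<alpha> (t - s) * p s)"
      have "2 * RL \<alpha> p t \<le> eA + b * norm (v tm)"
      proof (rule RL_le_of_norm_le[OF \<alpha>(1) _ _ er_m _ _ i, where d = "\<lambda>s. norm (d s)"])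
        show "t \<le> T" "0 \<le> norm (v tm)" "0 \<le> eA" "0 \<le> b" using t eA b by auto
        have "(\<lambda>s. norm (indicator {0..T} s *\<^sub>R d s)) \<in> borel_measurable lebesgue"
          by (rule measurable_compose[OF borel_measurable_integrable[OF d[unfolded set_integrable_def]] borel_measurable_norm])
        then show "set_borel_measurable lebesgue {0..T} (\<lambda>s. norm (d s))"
          by (simp add: set_borel_measurable_def)
        show "\<bar>p s\<bar> \<le> \<bar>er s\<bar> + norm (v tm) * \<bar>norm (d s)\<bar>" if "s \<in> {0..t}" for s
        proof -
          have "\<bar>d s \<bullet> v s\<bar> \<le> norm (d s) * norm (v s)" by (rule Cauchy_Schwarz_ineq2)
          also have "\<dots> \<le> norm (d s) * norm (v tm)" using tm(2)[of s] that t by (intro mult_left_mono) auto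
          finally show ?thesis unfolding p_def by (simp add: mult.commute abs_triangle_ineq[THEN order_trans])
        qed
        show "ennreal (2 / Gamma \<alpha>) * weighted_int \<alpha> (\<lambda>s. ennreal \<bar>er s\<bar>) t \<le> ennreal eA"
          unfolding eA(1)[symmetric] k_def using w_er[of t] t by (intro mult_left_mono) auto
        show "ennreal (2 / Gamma \<alpha>) * weighted_int \<alpha> (\<lambda>s. ennreal \<bar>norm (d s)\<bar>) t \<le> ennreal b"
          unfolding b(1)[symmetric] k_def using w_d[of t] t by (intro mult_left_mono) auto
      qed
      then show "(norm (v 0))\<^sup>2 + 2 * RL \<alpha> p t \<le> C" by (simp add: C_def v0)
    qed

    \<comment> \<open>Passage to the supremum and solution of the quadratic inequality\<close>
    define M where "M = (SUP t\<in>{0..T}. ennreal ((err_H \<alpha> N P u U t)\<^sup>2) + (err_sigma \<alpha> N P \<Phi> u U t)\<^sup>2)"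
    have rm: "(\<lambda>s. ennreal (p s - h s \<bullet> v s) * indicator {0..T} s) \<in> borel_measurable lebesgue"
    proof -
      have "set_integrable lebesgue {0..T} (\<lambda>s. p s - h s \<bullet> v s)"
        using p set_integrable_inner_continuous[OF cv h] by (rule set_integral_diff)
      then have "(\<lambda>s. ennreal (indicator {0..T} s *\<^sub>R (p s - h s \<bullet> v s))) \<in> borel_measurable lebesgue"
        unfolding set_integrable_def by measurable
      also have "(\<lambda>s. ennreal (indicator {0..T} s *\<^sub>R (p s - h s \<bullet> v s))) = (\<lambda>s. ennreal (p s - h s \<bullet> v s) * indicator {0..T} s)"
        by (auto simp: indicator_def)
      finally show ?thesis .
    qed
    have "M \<le> ennreal C"
      unfolding M_def
    proof (rule SUP_least)
      fix t assume t: "t \<in> {0..T}"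
      have "(err_sigma \<alpha> N P \<Phi> u U t)\<^sup>2 = ennreal k * weighted_int \<alpha>
          (\<lambda>s. e2ennreal (coerc_mod \<Phi> (u s) (Uhat \<alpha> N P U s) + coerc_mod \<Phi> (Ubar N P U s) (u s))) t"
        unfolding err_sigma_def ennreal_powr_half_square k_def ..
      also have "\<dots> \<le> ennreal k * weighted_int \<alpha> (\<lambda>s. ennreal (p s - h s \<bullet> v s)) t"
        by (intro mult_left_mono weighted_int_mono_AE[of T]) (use slack t in \<open>auto elim!: eventually_mono\<close>)
      also have "\<dots> = 2 * frac_nn \<alpha> (\<lambda>s. ennreal (p s - h s \<bullet> v s)) t"
        unfolding k_def by (rule frac_nn_weighted_int[OF \<alpha>(1) _ rm, symmetric]) (use t in auto)
      finally have "ennreal ((err_H \<alpha> N P u U t)\<^sup>2) + (err_sigma \<alpha> N P \<Phi> u U t)\<^sup>2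
          \<le> ennreal ((norm (v t))\<^sup>2) + 2 * frac_nn \<alpha> (\<lambda>s. ennreal (p s - h s \<bullet> v s)) t"
        by (simp add: err_H_def v_def Uh_def add_left_mono)
      also have "\<dots> \<le> ennreal C" by (rule bound[OF t])
      finally show "ennreal ((err_H \<alpha> N P u U t)\<^sup>2) + (err_sigma \<alpha> N P \<Phi> u U t)\<^sup>2 \<le> ennreal C" .
    qed
    define m where "m = enn2real M"
    have M: "M = ennreal m" "0 \<le> m"
    proof -
      have "M < top" using \<open>M \<le> ennreal C\<close> ennreal_less_top by (rule le_less_trans)
      then show "M = ennreal m" by (simp add: m_def)
    qed (simp add: m_def)
    have mC: "m \<le> C" using \<open>M \<le> ennreal C\<close> C0 unfolding M(1) by (simp add: ennreal_le_iff)
    \<comment> \<open>The sigma part being nonnegative, M dominates the squared maximal norm of v,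
      which closes the inequality in M.\<close>
    have "ennreal ((norm (v tm))\<^sup>2) \<le> ennreal ((err_H \<alpha> N P u U tm)\<^sup>2) + (err_sigma \<alpha> N P \<Phi> u U tm)\<^sup>2"
      by (simp add: err_H_def v_def Uh_def)
    also have "\<dots> \<le> M" unfolding M_def by (rule SUP_upper[OF tm(1)])
    finally have "norm (v tm) \<le> sqrt m"
      unfolding M(1) using M(2) by (simp add: ennreal_le_iff real_le_rsqrt)
    then have "m \<le> ((norm (u0 - U 0))\<^sup>2 + eA) + b * sqrt m"
      using mC mult_left_mono[OF _ b(2), of "norm (v tm)" "sqrt m"] by (simp add: C_def)
    then have "sqrt m \<le> sqrt ((norm (u0 - U 0))\<^sup>2 + eA) + b"
      using M(2) eA(2) b(2) by (intro sqrt_le_of_quadratic) auto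
    then have "ennreal (sqrt m) \<le> ennreal (sqrt ((norm (u0 - U 0))\<^sup>2 + eA) + b)"
      by (rule ennreal_leI)
    also have "\<dots> = ennreal (sqrt ((norm (u0 - U 0))\<^sup>2 + eA)) + ennreal b"
      using eA(2) b(2) by (intro ennreal_plus) auto
    finally have "ennreal (sqrt m) \<le> ennreal (sqrt ((norm (u0 - U 0))\<^sup>2 + eA)) + ennreal b" .
    moreover have "total_err \<alpha> T N P \<Phi> u U = ennreal (sqrt m)"
      unfolding total_err_def M_def[symmetric] M(1) by (rule ennreal_powr_half[OF M(2)])
    moreover have "ennreal_powr (ennreal ((norm (u0 - U 0))\<^sup>2) + ennreal k * EE) (1 / 2)
        = ennreal (sqrt ((norm (u0 - U 0))\<^sup>2 + eA))"
      using eA(2) ennreal_powr_half[of "(norm (u0 - U 0))\<^sup>2 + eA"] unfolding eA(1)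
      by (simp add: ennreal_plus)
    ultimately show ?thesis by (simp add: b(1))
  qed
  show ?thesis using goal unfolding k_def EE_def FF_def est_def .
qed

end
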